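(* Let $g$ be an analytic function on the unit disc $\mathbb{D}$ and let $T_g(f)(z)=\int_0^z f(\zeta)g'(\zeta)\,d\zeta$. Then: (1) The operator $T_g: BMOA\to BMOA_1$ is bounded if and only if $$\sup_{I\subset\partial\mathbb{D}}\left(\frac{\log\frac{2}{|I|}}{|I|}\int_{S(I)}|g'(z)|\,dm(z)\right)<\infty .$$ (2) The following are equivalent: (i) $T_g: BMOA\to BMOA_1$ is compact; (ii) $\displaystyle\lim_{|I|\to0}\left(\frac{\log\frac{2}{|I|}}{|I|}\int_{S(I)}|g'(z)|\,dm(z)\right)=0$; (iii) $T_g(BMOA)\subset VMOA_1$.
   Context: $\mathbb{D}$ is the open unit disc, $H(\mathbb{D})$ the space of analytic functions on $\mathbb{D}$, $dm$ the normalized Lebesgue area measure on $\mathbb{D}$, and $\varphi_a(z)=\frac{a-z}{1-\bar a z}$ for $a\in\mathbb{D}$. For $p\geq 1$, $BMOA_p$ is the Banach space of $f\in H(\mathbb{D})$ with finite norm $$\|f\|_{BMOA_p}^p=|f(0)|^p+\sup_{a\in\mathbb{D}}\int_{\mathbb{D}}|f'(z)|^p(1-|z|^2)^{p-2}(1-|\varphi_a(z)|^2)\,dm(z).$$ $VMOA_p$ is the closed subspace of those $f\in BMOA_p$ for which $\lim_{|a|\to1}\int_{\mathbb{D}}|f'(z)|^p(1-|z|^2)^{p-2}(1-|\varphi_a(z)|^2)\,dm(z)=0$. $BMOA=BMOA_2$ is the classical space of analytic functions of bounded mean oscillation. For an arc $I\subset\partial\mathbb{D}$, $|I|$ is its length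 normalized so that $|\partial\mathbb{D}|=1$, and $S(I)=\{re^{it}:e^{it}\in I,\ 1-|I|<r<1\}$ is the Carleson square. The limit as $|I|\to0$ is uniform over all arcs $I$ with $|I|\to0$. *)

theory Defs
  imports "HOL-Complex_Analysis.Complex_Analysis"
begin

definition disc_area :: "complex measure" where
  "disc_area = uniform_measure lborel (ball 0 1)"

definition disc_auto :: "complex \<Rightarrow> complex \<Rightarrow> complex" where
  "disc_auto a z = (a - z) / (1 - cnj a * z)"

text \<open>
  An analytic function on the disc is a function on the complex plane that is holomorphic on
  \<open>ball 0 1\<close>; its values elsewhere are irrelevant to every notion below.
\<close>

definition BMOA_integral :: "real \<Rightarrow> (complex \<Rightarrow> complex) \<Rightarrow> complex \<Rightarrow> ennreal" where
  "BMOA_integral p f a =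
     (\<integral>\<^sup>+z\<in>ball 0 1. ennreal (norm (deriv f z) powr p * (1 - (norm z)\<^sup>2) powr (p - 2)
        * (1 - (norm (disc_auto a z))\<^sup>2)) \<partial>disc_area)"

definition BMOA :: "real \<Rightarrow> (complex \<Rightarrow> complex) set" where
  "BMOA p = {f. f holomorphic_on ball 0 1 \<and> (SUP a\<in>ball 0 1. BMOA_integral p f a) < \<infinity>}"

text \<open>The norm is meaningful only on \<open>BMOA p\<close>: \<open>enn2real\<close> sends an infinite supremum to 0.\<close>

definition BMOA_norm :: "real \<Rightarrow> (complex \<Rightarrow> complex) \<Rightarrow> real" where
  "BMOA_norm p f =
     (norm (f 0) powr p + enn2real (SUP a\<in>ball 0 1. BMOA_integral p f a)) powr (1 / p)"

text \<open>The filter below is \<open>norm a \<longlongrightarrow> 1\<close> from inside the disc.\<close>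

definition VMOA :: "real \<Rightarrow> (complex \<Rightarrow> complex) set" where
  "VMOA p = {f \<in> BMOA p. (BMOA_integral p f \<longlongrightarrow> 0) (filtercomap norm (at_left 1))}"

definition T_op :: "(complex \<Rightarrow> complex) \<Rightarrow> (complex \<Rightarrow> complex) \<Rightarrow> complex \<Rightarrow> complex" where
  "T_op g f z = contour_integral (linepath 0 z) (\<lambda>\<zeta>. f \<zeta> * deriv g \<zeta>)"

text \<open>
  Boundedness and compactness of a linear operator from \<open>BMOA p\<close> to \<open>BMOA q\<close>. Linearity is not
  part of these predicates; for \<open>T_op g\<close> it holds automatically.
\<close>

definition BMOA_bounded ::
    "real \<Rightarrow> real \<Rightarrow> ((complex \<Rightarrow> complex) \<Rightarrow> complex \<Rightarrow> complex) \<Rightarrow> bool" where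
  "BMOA_bounded p q T \<longleftrightarrow> T ` BMOA p \<subseteq> BMOA q \<and>
     (\<exists>C. \<forall>f\<in>BMOA p. BMOA_norm q (T f) \<le> C * BMOA_norm p f)"

definition BMOA_compact ::
    "real \<Rightarrow> real \<Rightarrow> ((complex \<Rightarrow> complex) \<Rightarrow> complex \<Rightarrow> complex) \<Rightarrow> bool" where
  "BMOA_compact p q T \<longleftrightarrow> T ` BMOA p \<subseteq> BMOA q \<and>
     (\<forall>f :: nat \<Rightarrow> complex \<Rightarrow> complex.
        range f \<subseteq> BMOA p \<and> bounded (range (\<lambda>n. BMOA_norm p (f n))) \<longrightarrow>
        (\<exists>h\<in>BMOA q. \<exists>r :: nat \<Rightarrow> nat. strict_mono r \<and>
           (\<lambda>n. BMOA_norm q (\<lambda>z. T (f (r n)) z - h z)) \<longlonglongrightarrow> 0))"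

text \<open>Nondegenerate arcs of the unit circle, with or without their endpoints.\<close>

definition circle_arcs :: "complex set set" where
  "circle_arcs = {cis ` J | J a b. a < b \<and> b \<le> a + 2 * pi \<and> {a<..<b} \<subseteq> J \<and> J \<subseteq> {a..b}}"

definition arc_length :: "complex set \<Rightarrow> real" where
  "arc_length I = measure lborel {t \<in> {0..<2 * pi}. cis t \<in> I} / (2 * pi)"

definition carleson_square :: "complex set \<Rightarrow> complex set" where
  "carleson_square I = {of_real r * w | r w. w \<in> I \<and> 1 - arc_length I < r \<and> r < 1}"

definition log_carleson_quotient :: "(complex \<Rightarrow> complex) \<Rightarrow> complex set \<Rightarrow> ennreal" where
  "log_carleson_quotient g I = ennreal (ln (2 / arc_length I) / arc_length I) *
     (\<integral>\<^sup>+z\<in>carleson_square I. ennreal (norm (deriv g z)) \<partial>disc_area)"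

text \<open>Arcs shrinking to length 0, uniformly in their position.\<close>

definition small_arcs :: "complex set filter" where
  "small_arcs = inf (filtercomap arc_length (at_right 0)) (principal circle_arcs)"

end

theory Submission imports Defs begin

text \<open>
  Write \<open>K\<^sub>a(z) = (1 - |a|\<^sup>2) / |1 - cnj a z|\<^sup>2\<close>. Since \<open>(T\<^sub>g f)' = f g'\<close>, everything rests on bounding
  \<open>\<integral> |f| K\<^sub>a |g'| dm\<close>. A weighted Bergman reproducing formula yields the pointwise estimate
  \<open>|f(z) - f(a)| K\<^sub>a(z) \<le> 3 \<integral> |f'(w)| K\<^sub>a(w) K\<^sub>w(z) dm(w)\<close>. The logarithmic Carleson condition amounts to
  \<open>\<integral> K\<^sub>w |g'| dm \<le> C / L(w)\<close> with \<open>L(w) = log (2 / (1 - |w|\<^sup>2))\<close>, so integrating the estimate against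
  \<open>|g'| dm\<close> leaves \<open>\<integral> |f'| K\<^sub>a / L dm\<close>, which by Cauchy-Schwarz is bounded by the BMOA norm times
  the square root of \<open>\<integral> K\<^sub>a / ((1 - |w|\<^sup>2) L\<^sup>2) dm\<close>, and the latter is bounded uniformly in \<open>a\<close>. The term
  \<open>|f(a)|\<close> is \<open>O(L(a))\<close>. Splitting \<open>|g'| dm\<close> at a radius close to 1 gives the little-oh statements.

  Conversely the functions \<open>(log (12 / (1 - cnj w z)))\<^sup>2 / log (12 / (1 - |w|))\<close> are bounded in BMOA, are
  comparable to \<open>log (2 / |I|)\<close> on the Carleson square of the arc \<open>I\<close> of length \<open>1 - |w|\<close> centred at
  \<open>w / |w|\<close>, and tend to 0 locally uniformly. They detect boundedness and compactness, and a gliding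
  hump argument with them shows that \<open>T\<^sub>g(BMOA) \<subseteq> VMOA\<^sub>1\<close> forces the vanishing condition.
\<close>

text \<open>Explicit constants come from one computation. On the circle |zeta|^2 = s one has conj
  zeta = s / zeta, so a mean involving 1 / (1 - z conj zeta) is a Cauchy integral, evaluated in
  closed form at a point scaled by s. With the squared radius as coordinate, area integrals then
  become integrals over the unit interval with elementary primitives; the decisive one, of 1 / ((1 -
  s) L^2), has primitive -1 / L, and without the logarithms it would diverge. The hypothesis speaks
  of arcs, the embedding of kernels. A dyadic decomposition of the kernel into sets |1 - conj w z| <
  t connects them: k doublings of t cost the logarithm a factor linear in k, against a geometric
  gain. In the test functions a plain logarithm would be large on the Carleson square but would not
  tend to 0; its square divided by its size at the tip does both. The inclusion in
  \<open>VMOA 1\<close> is purely qualitative: it gives a limit for each function separately, with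
  no uniformity over a ball of BMOA. A failing sequence must therefore be packed into a single
  function, which is what forces the gliding hump.\<close>

section \<open>Normalized area as a finite measure whose space is the disc\<close>

text \<open>The space itself is cut down to the disc: functions such as \<open>deriv f\<close> are
  controlled only there, and continuity on the disc then suffices for measurability.\<close>

definition disc_measure :: "complex measure" where
  "disc_measure = restrict_space disc_area (ball 0 1)"

lemma space_disc_measure [simp]: "space disc_measure = ball 0 1"
  by (simp add: disc_measure_def disc_area_def space_restrict_space)

lemma sets_disc_measure: "sets disc_measure = sets (restrict_space borel (ball 0 1))"
  unfolding disc_measure_def by (rule sets_restrict_space_cong) (simp add: disc_area_def)

lemma emeasure_unit_disc: "emeasure lborel (ball (0::complex) 1) = ennreal pi"
  by (simp add: emeasure_ball unit_ball_vol_2)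

lemma nn_integral_disc_measure:
  "(\<integral>\<^sup>+z. f z \<partial>disc_measure) = (\<integral>\<^sup>+z\<in>ball 0 1. f z \<partial>disc_area)"
  unfolding disc_measure_def by (rule nn_integral_restrict_space) (simp add: disc_area_def)

lemma emeasure_disc_area_ball: "emeasure disc_area (ball 0 1) = 1"
proof -
  have "emeasure disc_area (ball 0 1) = ennreal pi / ennreal pi"
    unfolding disc_area_def by (subst emeasure_uniform_measure) (auto simp: emeasure_unit_disc)
  also have "\<dots> = 1" by (rule ennreal_divide_self) auto
  finally show ?thesis .
qed

lemma emeasure_disc_measure_space [simp]: "emeasure disc_measure (ball 0 1) = 1"
proof -
  have "ball 0 1 \<inter> space disc_area \<in> sets disc_area"
    by (simp add: disc_area_def)
  then show ?thesis
    by (simp add: disc_measure_def emeasure_restrict_space emeasure_disc_area_ball)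
qed

interpretation disc: finite_measure disc_measure
  by (rule finite_measureI) simp

lemma measurable_disc_borel: "f \<in> borel \<rightarrow>\<^sub>M N \<Longrightarrow> f \<in> disc_measure \<rightarrow>\<^sub>M N"
  by (simp add: disc_measure_def disc_area_def measurable_restrict_space1)

lemma measurable_disc_pair_borel:
  assumes "f \<in> borel \<Otimes>\<^sub>M borel \<rightarrow>\<^sub>M N"
  shows "f \<in> disc_measure \<Otimes>\<^sub>M disc_measure \<rightarrow>\<^sub>M N"
proof -
  have [measurable]: "(\<lambda>z. z) \<in> borel_measurable disc_measure"
    by (rule measurable_disc_borel) simp
  have "(\<lambda>p. (fst p, snd p)) \<in> disc_measure \<Otimes>\<^sub>M disc_measure \<rightarrow>\<^sub>M borel \<Otimes>\<^sub>M borel"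
    by (intro measurable_Pair measurable_compose[OF measurable_fst] measurable_compose[OF measurable_snd]) measurable
  from measurable_compose[OF this assms] show ?thesis by simp
qed

lemma measurable_disc_continuous:
  fixes f :: "complex \<Rightarrow> 'a::topological_space"
  shows "continuous_on (ball 0 1) f \<Longrightarrow> f \<in> borel_measurable disc_measure"
  by (subst measurable_cong_sets[OF sets_disc_measure refl]) (rule borel_measurable_continuous_on_restrict)

section \<open>Polar coordinates on the unit disc\<close>

text \<open>
  Both measures are translation invariant and give every unit ball the mass \<open>\<pi>\<close>; computing
  \<open>\<integral>\<integral> 1\<^sub>B(y) 1\<^sub>A(x + y)\<close> in both orders shows that they agree on \<open>A\<close>.
\<close>

lemma distr_lborel_rotation:
  assumes "norm c = 1"
  shows "distr lborel borel ((*) c) = (lborel :: complex measure)"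
proof -
  let ?N = "distr lborel borel ((*) c) :: complex measure"
  have inv: "cnj c * c = 1" using assms by (simp add: complex_norm_square[symmetric] mult.commute)
  define B where "B = ball (0::complex) 1"
  have [measurable]: "B \<in> sets borel" by (simp add: B_def)
  have ball: "emeasure ?N (ball x 1) = ennreal pi" for x
  proof -
    have "(*) c -` ball x 1 = ball (cnj c * x) 1"
    proof (rule set_eqI)
      fix y
      have "x - c * y = c * (cnj c * x - y)" using inv by (simp add: algebra_simps)
      then have "norm (x - c * y) = norm (cnj c * x - y)" using assms by (simp add: norm_mult)
      then show "(y \<in> (*) c -` ball x 1) = (y \<in> ball (cnj c * x) 1)" by (simp add: dist_norm)
    qed
    then show ?thesis by (simp add: emeasure_distr emeasure_ball unit_ball_vol_2)
  qed
  have sub: "sigma_finite_measure ?N"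
  proof
    show "\<exists>A. countable A \<and> A \<subseteq> sets ?N \<and> \<Union> A = space ?N \<and> (\<forall>a\<in>A. emeasure ?N a \<noteq> \<infinity>)"
    proof (intro exI[of _ "range (\<lambda>n::nat. ball (0::complex) n)"] conjI)
      show "\<Union> (range (\<lambda>n::nat. ball (0::complex) n)) = space ?N"
        by (auto simp: reals_Archimedean2)
      have "(*) c -` ball 0 r = ball 0 r" for r
        using assms by (auto simp: norm_mult)
      then show "\<forall>a\<in>range (\<lambda>n::nat. ball (0::complex) n). emeasure ?N a \<noteq> \<infinity>"
        by (auto simp: emeasure_distr emeasure_ball unit_ball_vol_2 ennreal_power[symmetric] simp flip: ennreal_mult)
    qed auto
  qed
  interpret N: sigma_finite_measure ?N by fact
  interpret P: pair_sigma_finite lborel ?N by (intro pair_sigma_finite.intro sub sigma_finite_lborel)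
  have shift: "(\<integral>\<^sup>+x. f (y + x) \<partial>lborel) = (\<integral>\<^sup>+x. f x \<partial>lborel)" if [measurable]: "f \<in> borel_measurable borel" for f and y :: complex
    by (subst (2) lborel_distr_plus[of y, symmetric], subst nn_integral_distr) auto
  have shiftN: "(\<integral>\<^sup>+x. f (y + x) \<partial>?N) = (\<integral>\<^sup>+x. f x \<partial>?N)" if [measurable]: "f \<in> borel_measurable borel" for f and y :: complex
  proof -
    have "(\<integral>\<^sup>+x. f (y + x) \<partial>?N) = (\<integral>\<^sup>+x. f (c * (cnj c * y + x)) \<partial>lborel)"
    proof -
      have "c * (cnj c * y + x) = y + c * x" for x
        using inv by (simp add: distrib_left mult.assoc[symmetric] mult.commute)
      then show ?thesis by (simp add: nn_integral_distr)
    qed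
    also have "\<dots> = (\<integral>\<^sup>+x. f (c * x) \<partial>lborel)"
      by (rule shift) measurable
    finally show ?thesis by (simp add: nn_integral_distr)
  qed
  have "emeasure ?N A = emeasure lborel A" if A[measurable]: "A \<in> sets borel" for A
  proof -
    have "ennreal pi * emeasure ?N A = (\<integral>\<^sup>+y. indicator B y * (\<integral>\<^sup>+x. indicator A (y + x) \<partial>?N) \<partial>lborel)"
    proof -
      have "(\<integral>\<^sup>+x. indicator A (y + x) \<partial>?N) = emeasure ?N A" for y
        by (subst shiftN) auto
      then show ?thesis
        by (simp add: nn_integral_multc) (simp add: B_def emeasure_ball unit_ball_vol_2)
    qed
    also have "\<dots> = (\<integral>\<^sup>+y. (\<integral>\<^sup>+x. indicator B y * indicator A (y + x) \<partial>?N) \<partial>lborel)"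
      by (subst nn_integral_cmult) auto
    also have "\<dots> = (\<integral>\<^sup>+x. (\<integral>\<^sup>+y. indicator B y * indicator A (y + x) \<partial>lborel) \<partial>?N)"
      by (rule P.Fubini'[symmetric]) measurable
    also have "\<dots> = (\<integral>\<^sup>+x. (\<integral>\<^sup>+y. indicator B (y - x) * indicator A y \<partial>lborel) \<partial>?N)"
    proof (rule nn_integral_cong)
      fix x :: complex
      show "(\<integral>\<^sup>+y. indicator B y * indicator A (y + x) \<partial>lborel) = (\<integral>\<^sup>+y. indicator B (y - x) * indicator A y \<partial>lborel)"
        using shift[of "\<lambda>y. indicator B (y - x) * indicator A y" x] by (simp add: add.commute)
    qed
    also have "\<dots> = (\<integral>\<^sup>+y. (\<integral>\<^sup>+x. indicator B (y - x) * indicator A y \<partial>?N) \<partial>lborel)"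
      by (rule P.Fubini') measurable
    also have "\<dots> = (\<integral>\<^sup>+y. (\<integral>\<^sup>+x. indicator (ball y 1) x \<partial>?N) * indicator A y \<partial>lborel)"
      by (subst nn_integral_multc[symmetric])
         (auto intro!: nn_integral_cong borel_measurable_indicator simp: B_def indicator_def dist_norm norm_minus_commute)
    also have "\<dots> = (\<integral>\<^sup>+y. ennreal pi * indicator A y \<partial>lborel)"
      by (simp add: ball)
    also have "\<dots> = ennreal pi * emeasure lborel A"
      by (simp add: nn_integral_cmult)
    finally show ?thesis
      by (subst (asm) ennreal_mult_cancel_left) auto
  qed
  then show ?thesis by (intro measure_eqI) auto
qed

lemma emeasure_disc_measure:
  assumes "A \<in> sets disc_measure"
  shows "emeasure disc_measure A = emeasure lborel A / ennreal pi" "A \<in> sets borel" "A \<subseteq> ball 0 1"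
proof -
  show A: "A \<in> sets borel" "A \<subseteq> ball 0 1"
    using assms by (auto simp: sets_disc_measure sets_restrict_space)
  then have "ball 0 1 \<inter> A = A" by auto
  then show "emeasure disc_measure A = emeasure lborel A / ennreal pi"
    using A by (simp add: disc_measure_def disc_area_def emeasure_restrict_space
        emeasure_uniform_measure emeasure_unit_disc)
qed

lemma measurable_disc_rotation:
  "norm c = 1 \<Longrightarrow> (*) c \<in> disc_measure \<rightarrow>\<^sub>M disc_measure"
  unfolding disc_measure_def
  by (rule measurable_restrict_space3) (auto simp: disc_area_def norm_mult)

lemma distr_disc_rotation:
  assumes "norm c = 1"
  shows "distr disc_measure disc_measure ((*) c) = disc_measure"
proof (rule measure_eqI)
  fix A assume "A \<in> sets (distr disc_measure disc_measure ((*) c))"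
  then have A: "A \<in> sets disc_measure" by simp
  note m = measurable_disc_rotation[OF assms]
  note A' = emeasure_disc_measure[OF A]
  have sub: "(*) c -` A \<subseteq> ball 0 1"
    using A'(3) assms by (force simp: norm_mult)
  have "emeasure (distr disc_measure disc_measure ((*) c)) A = emeasure disc_measure ((*) c -` A)"
    using emeasure_distr[OF m A] sub by (simp add: Int_absorb2)
  also have "\<dots> = emeasure lborel ((*) c -` A) / ennreal pi"
    using measurable_sets[OF m A] sub by (intro emeasure_disc_measure) (simp add: Int_absorb2)
  also have "emeasure lborel ((*) c -` A) = emeasure (distr lborel borel ((*) c)) A"
    using A'(2) by (subst emeasure_distr) auto
  also have "\<dots> / ennreal pi = emeasure disc_measure A"
    using A' by (simp add: distr_lborel_rotation[OF assms])
  finally show "emeasure (distr disc_measure disc_measure ((*) c)) A = emeasure disc_measure A" .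
qed simp

text \<open>The disc of squared radius x has normalized area x, so the squared modulus is uniformly
  distributed on the unit interval. Comparing the finite masses of the half-lines
  \<open>{x<..}\<close> is enough.\<close>

lemma distr_disc_norm_square:
  "distr disc_measure borel (\<lambda>z. (norm z)\<^sup>2) = density lborel (indicator {0<..<1::real})"
proof (rule measure_eqI_lessThan)
  have normsq [measurable]: "(\<lambda>z. (norm z)\<^sup>2) \<in> borel_measurable disc_measure"
    by (rule measurable_disc_borel) measurable
  fix x :: real
  have lhs: "emeasure (distr disc_measure borel (\<lambda>z. (norm z)\<^sup>2)) {x<..} = emeasure disc_measure {z \<in> ball 0 1. x < (norm z)\<^sup>2}"
    by (subst emeasure_distr) (auto intro!: arg_cong[where f = "emeasure disc_measure"])
  have rhs: "emeasure (density lborel (indicator {0<..<1})) {x<..} = emeasure lborel ({0<..<1} \<inter> {x<..})"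
    by (subst emeasure_density) (auto simp: indicator_inter_arith[symmetric])
  have meas: "{z \<in> ball 0 1. x < (norm z)\<^sup>2} \<in> sets disc_measure"
    using measurable_sets[of "\<lambda>z. (norm z)\<^sup>2" disc_measure borel "{x<..}"] normsq
    by (simp add: vimage_def Int_def conj_commute)
  have "emeasure disc_measure {z \<in> ball 0 1. x < (norm z)\<^sup>2} = emeasure lborel ({0<..<1} \<inter> {x<..})"
  proof (cases "x < 0")
    case True
    then have "{z \<in> ball (0::complex) 1. x < (norm z)\<^sup>2} = ball 0 1" "{0<..<1} \<inter> {x<..} = {0<..<1}"
      by (auto intro: less_le_trans)
    then show ?thesis by simp
  next
    case x0: False
    show ?thesis
    proof (cases "x < 1")
      case True
      have "norm z \<le> sqrt x \<longleftrightarrow> (norm z)\<^sup>2 \<le> x" for z :: complex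
        using real_sqrt_le_iff[of "(norm z)\<^sup>2" x] by simp
      then have "{z \<in> ball (0::complex) 1. x < (norm z)\<^sup>2} = ball 0 1 - cball 0 (sqrt x)"
        by (auto simp: not_le)
      moreover have "emeasure lborel (ball (0::complex) 1 - cball 0 (sqrt x)) = ennreal pi - ennreal (x * pi)"
        using True x0
      proof -
        have "emeasure lborel (cball (0::complex) (sqrt x)) = ennreal (x * pi)"
          using x0 emeasure_cball[of "sqrt x" "0::complex"] by (simp add: unit_ball_vol_2 mult.commute)
        moreover have "cball (0::complex) (sqrt x) \<subseteq> ball 0 1"
          using True by (simp add: cball_subset_ball_iff)
        ultimately show ?thesis
          by (subst emeasure_Diff) (simp_all add: emeasure_unit_disc)
      qed
      moreover have "ennreal pi - ennreal (x * pi) = ennreal (1 - x) * ennreal pi"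
        using x0 True by (simp add: ennreal_minus ennreal_mult[symmetric] left_diff_distrib)
      moreover have "({0<..<1} \<inter> {x<..}) = {x<..<1}"
        using x0 by auto
      ultimately show ?thesis
        using x0 True emeasure_disc_measure(1)[OF meas]
        by (simp add: ennreal_mult_divide_eq)
    next
      case False
      have "(norm z)\<^sup>2 < 1" if "norm z < 1" for z :: complex
        using that by (simp add: power_less_one_iff)
      with False have "{z \<in> ball (0::complex) 1. x < (norm z)\<^sup>2} = {}" "{0<..<1} \<inter> {x<..} = {}"
        by force+
      then show ?thesis by (simp only: emeasure_empty)
    qed
  qed
  then show "emeasure (distr disc_measure borel (\<lambda>z. (norm z)\<^sup>2)) {x<..} =
    emeasure (density lborel (indicator {0<..<1})) {x<..}"
    by (simp add: lhs rhs)
  show "emeasure (distr disc_measure borel (\<lambda>z. (norm z)\<^sup>2)) {x<..} < \<infinity>"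
    unfolding lhs infinity_ennreal_def using disc.emeasure_finite less_top by blast
qed auto

text \<open>Open at both ends, so that a squared radius taken from its space satisfies
  \<open>0 < s\<close> and \<open>s < 1\<close>, as the circle means require.\<close>

definition unit_measure :: "real measure" where
  "unit_measure = restrict_space lborel {0<..<1}"

lemma space_unit_measure [simp]: "space unit_measure = {0<..<1}"
  by (simp add: unit_measure_def space_restrict_space)

lemma nn_integral_unit_measure:
  "(\<integral>\<^sup>+t. f t \<partial>unit_measure) = (\<integral>\<^sup>+t\<in>{0<..<1}. f t \<partial>lborel)"
  unfolding unit_measure_def by (rule nn_integral_restrict_space) simp

lemma emeasure_unit_measure_space [simp]: "emeasure unit_measure {0<..<1} = 1"
  by (simp add: unit_measure_def emeasure_restrict_space)

interpretation unit: finite_measure unit_measure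
  by (rule finite_measureI) simp

lemma measurable_unit_borel: "f \<in> borel \<rightarrow>\<^sub>M N \<Longrightarrow> f \<in> unit_measure \<rightarrow>\<^sub>M N"
  by (simp add: unit_measure_def measurable_restrict_space1)

lemma measurable_unit_pair_borel:
  assumes f: "f \<in> borel \<Otimes>\<^sub>M M \<rightarrow>\<^sub>M N" and M: "\<And>g. g \<in> M \<rightarrow>\<^sub>M M \<Longrightarrow> g \<in> M' \<rightarrow>\<^sub>M M"
  shows "f \<in> unit_measure \<Otimes>\<^sub>M M' \<rightarrow>\<^sub>M N"
proof -
  have "(\<lambda>p. (fst p, snd p)) \<in> unit_measure \<Otimes>\<^sub>M M' \<rightarrow>\<^sub>M borel \<Otimes>\<^sub>M M"
    by (intro measurable_Pair measurable_compose[OF measurable_fst] measurable_compose[OF measurable_snd]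
        measurable_unit_borel M measurable_ident[unfolded id_def])
  from measurable_compose[OF this f] show ?thesis by simp
qed

lemmas measurable_unit_disc_borel = measurable_unit_pair_borel[where M = borel and M' = disc_measure, OF _ measurable_disc_borel]
lemmas measurable_unit_unit_borel = measurable_unit_pair_borel[where M = borel and M' = unit_measure, OF _ measurable_unit_borel]

text \<open>A periodic function may be integrated over any window of length 1: the part of
  \<open>{c<..<c+1}\<close> beyond 1 is moved back by a period, and the cut points 1 and c are
  null.\<close>

lemma nn_integral_unit_shift:
  fixes f :: "real \<Rightarrow> ennreal"
  assumes [measurable]: "f \<in> borel_measurable borel"
    and periodic: "\<And>t. f (t + 1) = f t" and c: "0 \<le> c" "c < 1"
  shows "(\<integral>\<^sup>+t. f (t + c) \<partial>unit_measure) = (\<integral>\<^sup>+t. f t \<partial>unit_measure)"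
proof -
  have shift: "(\<integral>\<^sup>+t. h (t + d) \<partial>lborel) = (\<integral>\<^sup>+t. h t \<partial>lborel)"
    if [measurable]: "h \<in> borel_measurable borel" for h :: "real \<Rightarrow> ennreal" and d
    by (subst (2) lborel_distr_plus[of d, symmetric], subst nn_integral_distr) (auto simp: add.commute)
  have "(\<integral>\<^sup>+t. f (t + c) \<partial>unit_measure) = (\<integral>\<^sup>+t. f (t + c) * indicator {c<..<c+1} (t + c) \<partial>lborel)"
    unfolding nn_integral_unit_measure by (intro nn_integral_cong) (auto simp: indicator_def)
  also have "\<dots> = (\<integral>\<^sup>+t. f t * indicator {c<..<c+1} t \<partial>lborel)"
    by (rule shift) measurable
  also have "\<dots> = (\<integral>\<^sup>+t. f t * indicator {c<..<1} t + f t * indicator {1<..<1+c} t \<partial>lborel)"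
    using AE_lborel_singleton[of 1] c
    by (intro nn_integral_cong_AE) (auto simp: indicator_def elim!: eventually_mono)
  also have "\<dots> = (\<integral>\<^sup>+t. f t * indicator {c<..<1} t \<partial>lborel) + (\<integral>\<^sup>+t. f t * indicator {1<..<1+c} t \<partial>lborel)"
    by (rule nn_integral_add) measurable
  also have "(\<integral>\<^sup>+t. f t * indicator {1<..<1+c} t \<partial>lborel) = (\<integral>\<^sup>+t. f (t + 1) * indicator {1<..<1+c} (t + 1) \<partial>lborel)"
    by (rule shift[symmetric]) measurable
  also have "\<dots> = (\<integral>\<^sup>+t. f t * indicator {0<..<c} t \<partial>lborel)"
    by (intro nn_integral_cong) (auto simp: indicator_def periodic)
  also have "(\<integral>\<^sup>+t. f t * indicator {c<..<1} t \<partial>lborel) + (\<integral>\<^sup>+t. f t * indicator {0<..<c} t \<partial>lborel)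
    = (\<integral>\<^sup>+t. f t * indicator {c<..<1} t + f t * indicator {0<..<c} t \<partial>lborel)"
    by (rule nn_integral_add[symmetric]) measurable
  also have "\<dots> = (\<integral>\<^sup>+t. f t * indicator {0<..<1} t \<partial>lborel)"
    using AE_lborel_singleton[of c] c
    by (intro nn_integral_cong_AE) (auto simp: indicator_def elim!: eventually_mono)
  finally show ?thesis by (simp add: nn_integral_unit_measure)
qed

text \<open>
  The first coordinate is the square of the radius, which makes the Jacobian constant.
\<close>

definition polar :: "real \<times> real \<Rightarrow> complex" where
  "polar p = of_real (sqrt (fst p)) * cis (2 * pi * snd p)"

lemma norm_polar: "0 \<le> s \<Longrightarrow> norm (polar (s, t)) = sqrt s"
  by (simp add: polar_def norm_mult)

lemma measurable_polar [measurable]: "polar \<in> unit_measure \<Otimes>\<^sub>M unit_measure \<rightarrow>\<^sub>M disc_measure"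
  unfolding disc_measure_def
proof (rule measurable_restrict_space2)
  show "polar \<in> space (unit_measure \<Otimes>\<^sub>M unit_measure) \<rightarrow> ball 0 1"
    by (auto simp: space_pair_measure norm_polar)
  have "polar \<in> borel_measurable (unit_measure \<Otimes>\<^sub>M unit_measure)"
    unfolding polar_def cis_conv_exp by (intro measurable_unit_unit_borel) measurable
  then show "polar \<in> unit_measure \<Otimes>\<^sub>M unit_measure \<rightarrow>\<^sub>M disc_area"
    by (simp add: disc_area_def)
qed

lemma borel_measurable_disc_extend:
  fixes F :: "complex \<Rightarrow> ennreal"
  assumes "F \<in> borel_measurable disc_measure"
  shows "(\<lambda>z. F z * indicator (ball 0 1) z) \<in> borel_measurable borel"
proof -
  have "F \<in> borel_measurable (restrict_space borel (ball 0 1))"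
    using assms by (subst (asm) measurable_cong_sets[OF sets_disc_measure refl])
  then show ?thesis by (subst (asm) borel_measurable_restrict_space_iff_ennreal) auto
qed

text \<open>No Jacobian is computed. By rotation invariance the integrand may be averaged over all
  rotations; the average depends on the point only through its modulus, and the law of the squared
  modulus is already known.\<close>

lemma nn_integral_disc_polar:
  fixes F :: "complex \<Rightarrow> ennreal"
  assumes F: "F \<in> borel_measurable disc_measure"
  shows "(\<integral>\<^sup>+z. F z \<partial>disc_measure) = (\<integral>\<^sup>+s. \<integral>\<^sup>+t. F (polar (s, t)) \<partial>unit_measure \<partial>unit_measure)"
proof -
  \<comment> \<open>Extension by 0 gives a Borel function on the whole plane, which can be composed
    with rotations and with the polar map.\<close>
  define H where "H z = F z * indicator (ball 0 1) z" for z
  have [measurable]: "H \<in> borel_measurable borel"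
    unfolding H_def using F by (rule borel_measurable_disc_extend)
  have H: "H z = F z" if "norm z < 1" for z using that by (simp add: H_def)
  define G where "G s = (\<integral>\<^sup>+t. H (of_real (sqrt s) * cis (2 * pi * t)) \<partial>unit_measure)" for s
  have [measurable]: "G \<in> borel_measurable borel"
    unfolding G_def cis_conv_exp nn_integral_unit_measure by measurable
  interpret P: pair_sigma_finite unit_measure disc_measure
    by (intro pair_sigma_finite.intro unit.sigma_finite_measure_axioms disc.sigma_finite_measure_axioms)
  have "(\<integral>\<^sup>+z. F z \<partial>disc_measure) = (\<integral>\<^sup>+t. (\<integral>\<^sup>+z. H z \<partial>disc_measure) \<partial>unit_measure)"
  proof -
    have "(\<integral>\<^sup>+z. F z \<partial>disc_measure) = (\<integral>\<^sup>+z. H z \<partial>disc_measure)"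
      by (rule nn_integral_cong) (simp add: H)
    then show ?thesis by simp
  qed
  also have "\<dots> = (\<integral>\<^sup>+t. (\<integral>\<^sup>+z. H (cis (2 * pi * t) * z) \<partial>disc_measure) \<partial>unit_measure)"
  proof (rule nn_integral_cong)
    fix t :: real
    have "norm (cis (2 * pi * t)) = 1" by simp
    then show "(\<integral>\<^sup>+z. H z \<partial>disc_measure) = (\<integral>\<^sup>+z. H (cis (2 * pi * t) * z) \<partial>disc_measure)"
      by (subst distr_disc_rotation[symmetric], assumption, subst nn_integral_distr)
         (auto intro: measurable_disc_rotation measurable_disc_borel)
  qed
  also have "\<dots> = (\<integral>\<^sup>+z. (\<integral>\<^sup>+t. H (cis (2 * pi * t) * z) \<partial>unit_measure) \<partial>disc_measure)"
    unfolding cis_conv_exp by (rule P.Fubini'[symmetric], rule measurable_unit_disc_borel) measurable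
  also have "\<dots> = (\<integral>\<^sup>+z. G ((norm z)\<^sup>2) \<partial>disc_measure)"
  proof (rule nn_integral_cong)
    fix z :: complex
    define c where "c = Arg2pi z / (2 * pi)"
    have c: "0 \<le> c" "c < 1" by (auto simp: c_def Arg2pi_lt_2pi divide_simps Arg2pi_ge_0)
    have z: "z = of_real (norm z) * cis (2 * pi * c)"
      using Arg2pi_eq[of z] by (simp add: c_def cis_conv_exp mult.commute)
    have "cis (2 * pi * t) * z = of_real (norm z) * cis (2 * pi * (t + c))" for t
      by (subst z) (simp add: cis_mult distrib_left)
    then have "(\<integral>\<^sup>+t. H (cis (2 * pi * t) * z) \<partial>unit_measure) = (\<integral>\<^sup>+t. H (of_real (norm z) * cis (2 * pi * (t + c))) \<partial>unit_measure)"
      by simp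
    also have "\<dots> = (\<integral>\<^sup>+t. H (of_real (norm z) * cis (2 * pi * t)) \<partial>unit_measure)"
    proof (rule nn_integral_unit_shift[OF _ _ c])
      show "H (of_real (norm z) * cis (2 * pi * (t + 1))) = H (of_real (norm z) * cis (2 * pi * t))" for t
        by (simp add: distrib_left cis_mult[symmetric])
    qed (unfold cis_conv_exp, measurable)
    also have "\<dots> = G ((norm z)\<^sup>2)" by (simp add: G_def)
    finally show "(\<integral>\<^sup>+t. H (cis (2 * pi * t) * z) \<partial>unit_measure) = G ((norm z)\<^sup>2)" .
  qed
  also have "\<dots> = (\<integral>\<^sup>+s. G s \<partial>distr disc_measure borel (\<lambda>z. (norm z)\<^sup>2))"
    by (rule nn_integral_distr[symmetric]) (auto intro: measurable_disc_borel)
  also have "\<dots> = (\<integral>\<^sup>+s. G s \<partial>unit_measure)"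
    unfolding distr_disc_norm_square nn_integral_unit_measure
    by (subst nn_integral_density) (auto simp: mult.commute)
  also have "\<dots> = (\<integral>\<^sup>+s. \<integral>\<^sup>+t. F (polar (s, t)) \<partial>unit_measure \<partial>unit_measure)"
    unfolding G_def polar_def
    by (intro nn_integral_cong) (simp add: H norm_mult)
  finally show ?thesis .
qed

lemma pair_sigma_finite_unit: "pair_sigma_finite unit_measure unit_measure"
  by (intro pair_sigma_finite.intro unit.sigma_finite_measure_axioms)

text \<open>Indicators in the nonnegative formula turn it into an identity of measures, along which
  the Bochner integral can be transported as well.\<close>

lemma distr_polar: "distr (unit_measure \<Otimes>\<^sub>M unit_measure) disc_measure polar = disc_measure"
proof (rule measure_eqI)
  fix A assume "A \<in> sets (distr (unit_measure \<Otimes>\<^sub>M unit_measure) disc_measure polar)"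
  then have A[measurable]: "A \<in> sets disc_measure" by simp
  interpret P: pair_sigma_finite unit_measure unit_measure by (rule pair_sigma_finite_unit)
  have "emeasure (distr (unit_measure \<Otimes>\<^sub>M unit_measure) disc_measure polar) A =
      (\<integral>\<^sup>+z. indicator A z \<partial>distr (unit_measure \<Otimes>\<^sub>M unit_measure) disc_measure polar)"
    by simp
  also have "\<dots> = (\<integral>\<^sup>+p. indicator A (polar p) \<partial>(unit_measure \<Otimes>\<^sub>M unit_measure))"
    by (rule nn_integral_distr) measurable
  also have "\<dots> = (\<integral>\<^sup>+s. \<integral>\<^sup>+t. indicator A (polar (s, t)) \<partial>unit_measure \<partial>unit_measure)"
    by (subst unit.nn_integral_fst) (auto intro: measurable_compose[OF measurable_polar])
  also have "\<dots> = emeasure disc_measure A"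
    by (subst nn_integral_disc_polar[symmetric]) auto
  finally show "emeasure (distr (unit_measure \<Otimes>\<^sub>M unit_measure) disc_measure polar) A = emeasure disc_measure A" .
qed simp

lemma integral_disc_polar:
  fixes F :: "complex \<Rightarrow> complex"
  assumes F: "integrable disc_measure F"
  shows "(\<integral>z. F z \<partial>disc_measure) = (\<integral>s. \<integral>t. F (polar (s, t)) \<partial>unit_measure \<partial>unit_measure)"
    and "integrable unit_measure (\<lambda>s. \<integral>t. F (polar (s, t)) \<partial>unit_measure)"
proof -
  interpret P: pair_sigma_finite unit_measure unit_measure by (rule pair_sigma_finite_unit)
  have *: "integrable (unit_measure \<Otimes>\<^sub>M unit_measure) (\<lambda>p. F (polar p))"
    using F by (subst (asm) distr_polar[symmetric], subst (asm) integrable_distr_eq) (auto)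
  have "(\<integral>z. F z \<partial>disc_measure) = (\<integral>p. F (polar p) \<partial>(unit_measure \<Otimes>\<^sub>M unit_measure))"
    using F by (subst distr_polar[symmetric], subst integral_distr) auto
  also have "\<dots> = (\<integral>s. \<integral>t. F (polar (s, t)) \<partial>unit_measure \<partial>unit_measure)"
    by (rule P.integral_fst'[symmetric]) (rule *)
  finally show "(\<integral>z. F z \<partial>disc_measure) = (\<integral>s. \<integral>t. F (polar (s, t)) \<partial>unit_measure \<partial>unit_measure)" .
  show "integrable unit_measure (\<lambda>s. \<integral>t. F (polar (s, t)) \<partial>unit_measure)"
    using P.integrable_fst'[OF *] .
qed

text \<open>Bridge from the gauge integral, in which contour integrals and the fundamental theorem
  of calculus are available, to the Lebesgue integral on the open interval.\<close>

lemma integral_unit_measure: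
  fixes g :: "real \<Rightarrow> complex"
  assumes cont: "continuous_on {0..1} g" and int: "(g has_integral I) {0..1}"
  shows "integrable unit_measure g" "(\<integral>t. g t \<partial>unit_measure) = I"
proof -
  have "set_integrable lborel {0..1} g"
    using borel_integrable_atLeastAtMost'[OF cont] .
  then have si': "set_integrable lborel {0<..<1} g"
    by (rule set_integrable_subset) auto
  then show "integrable unit_measure g"
    by (simp add: unit_measure_def integrable_restrict_space set_integrable_def)
  have "(\<integral>t. g t \<partial>unit_measure) = (LINT t:{0<..<1}|lborel. g t)"
    by (simp add: unit_measure_def integral_restrict_space set_lebesgue_integral_def)
  also have "\<dots> = integral {0<..<1} g"
    using set_borel_integral_eq_integral(2)[OF si'] .
  also have "\<dots> = I"
    using int by (simp add: has_integral_Icc_iff_Ioo integral_unique)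
  finally show "(\<integral>t. g t \<partial>unit_measure) = I" .
qed

section \<open>Means over circles\<close>

text \<open>Cauchy's formula for derivatives with d zeta = 2 pi i zeta dt: the extra factor
  \<open>p t\<close> is what remains of the velocity of the circle after division by 2 pi i.\<close>

lemma circle_mean_Cauchy:
  assumes h: "h holomorphic_on ball 0 1" and r: "0 < r" "r < 1" and w: "norm w < r"
  defines "p \<equiv> \<lambda>t. of_real r * cis (2 * pi * t)"
  shows "(\<integral>t. h (p t) * (p t / (p t - w) ^ Suc k) \<partial>unit_measure) = (deriv ^^ k) h w / fact k"
    and "integrable unit_measure (\<lambda>t. h (p t) * (p t / (p t - w) ^ Suc k))"
proof -
  have c: "circlepath 0 r t = p t" for t
    by (simp add: circlepath p_def cis_conv_exp mult_ac)
  have p: "norm (p t) = r" for t using r by (simp add: p_def norm_mult)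
  have hc: "continuous_on (cball 0 r) h"
    using r by (intro holomorphic_on_imp_continuous_on holomorphic_on_subset[OF h]) (simp add: cball_subset_ball_iff)
  have hh: "h holomorphic_on ball 0 r"
    using r by (intro holomorphic_on_subset[OF h]) (simp add: subset_ball)
  have "((\<lambda>u. h u / (u-w) ^ (Suc k)) has_contour_integral ((2 * pi * \<i>) / (fact k) * (deriv ^^ k) h w)) (circlepath 0 r)"
    using w by (intro Cauchy_has_contour_integral_higher_derivative_circlepath hc hh) auto
  then have "((\<lambda>t. h (p t) / (p t - w) ^ Suc k * vector_derivative (circlepath 0 r) (at t)) has_integral
      ((2 * pi * \<i>) / (fact k) * (deriv ^^ k) h w)) {0..1}"
    by (simp only: has_contour_integral c)
  then have "((\<lambda>t. h (p t) / (p t - w) ^ Suc k * (2 * pi * \<i> * p t)) has_integral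
      ((2 * pi * \<i>) / (fact k) * (deriv ^^ k) h w)) {0..1}"
    by (simp add: vector_derivative_circlepath p_def cis_conv_exp mult_ac)
  from has_integral_mult_right[OF this, of "1 / (2 * pi * \<i>)"]
  have I: "((\<lambda>t. h (p t) * (p t / (p t - w) ^ Suc k)) has_integral ((deriv ^^ k) h w / fact k)) {0..1}"
    by (simp add: field_simps)
  have ne: "p t \<noteq> w" for t using p[of t] w by auto
  have pc: "continuous_on {0..1} p"
    unfolding p_def cis_conv_exp by (intro continuous_intros)
  have "continuous_on {0..1} (\<lambda>t. h (p t))"
    by (rule continuous_on_compose2[OF hc pc]) (auto simp: p)
  then have C: "continuous_on {0..1} (\<lambda>t. h (p t) * (p t / (p t - w) ^ Suc k))"
    using ne by (intro continuous_intros pc) auto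
  show "(\<integral>t. h (p t) * (p t / (p t - w) ^ Suc k) \<partial>unit_measure) = (deriv ^^ k) h w / fact k"
    "integrable unit_measure (\<lambda>t. h (p t) * (p t / (p t - w) ^ Suc k))"
    using integral_unit_measure[OF C I] by auto
qed

lemma one_minus_cnj_mult_nonzero:
  assumes "norm a < 1" "norm z < 1"
  shows "1 - cnj a * z \<noteq> 0" "1 - a * cnj z \<noteq> 0"
proof -
  have "norm a * norm z < 1" using assms by (metis mult_strict_mono norm_ge_zero mult_1 zero_less_one)
  then have "norm (cnj a * z) \<noteq> 1" "norm (a * cnj z) \<noteq> 1" by (simp_all add: norm_mult)
  then show "1 - cnj a * z \<noteq> 0" "1 - a * cnj z \<noteq> 0"
    by (metis norm_one right_minus_eq)+
qed

text \<open>On this circle 1 - b conj zeta = (zeta - b s) / zeta. One of the two factors of the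
  squared modulus thus becomes a Cauchy kernel with pole b s, inside the circle because |b| s < sqrt
  s; the other stays holomorphic in zeta and is evaluated at that pole.\<close>

lemma circle_mean_Poisson:
  assumes h: "h holomorphic_on ball 0 1" and s: "0 < s" "s < 1" and b: "norm b < 1"
  shows "(\<integral>t. h (polar (s, t)) / of_real ((norm (1 - cnj b * polar (s, t)))\<^sup>2) \<partial>unit_measure)
      = h (b * s) / (1 - (norm b)\<^sup>2 * s)"
    and "integrable unit_measure (\<lambda>t. h (polar (s, t)) / of_real ((norm (1 - cnj b * polar (s, t)))\<^sup>2))"
proof -
  define r where "r = sqrt s"
  have r: "0 < r" "r < 1" "r * r = s" using s by (auto simp: r_def)
  define p where "p t = of_real r * cis (2 * pi * t)" for t
  have p: "polar (s, t) = p t" for t by (simp add: p_def polar_def r_def)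
  have np: "norm (p t) = r" for t using r by (simp add: p_def norm_mult)
  have bs: "norm (b * s) < r"
  proof -
    have "norm (b * s) = norm b * r * r" using s by (simp add: norm_mult r(3) mult.assoc)
    also have "\<dots> < 1 * r" using b r by (intro mult_strict_right_mono) (use mult_strict_mono[of "norm b" 1 r 1] in auto)
    finally show ?thesis by simp
  qed
  have ne: "1 - cnj b * z \<noteq> 0" if "norm z < 1" for z
    using b that one_minus_cnj_mult_nonzero by blast
  have hol: "(\<lambda>z. h z / (1 - cnj b * z)) holomorphic_on ball 0 1"
    using ne by (intro holomorphic_intros h) auto
  have "h (p t) / of_real ((norm (1 - cnj b * p t))\<^sup>2)
      = (h (p t) / (1 - cnj b * p t)) * (p t / (p t - b * s) ^ Suc 0)" for t
  proof -
    have 1: "of_real ((norm (1 - cnj b * p t))\<^sup>2) = (1 - cnj b * p t) * (1 - b * cnj (p t))"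
      using complex_norm_square[of "1 - cnj b * p t"] by simp
    have 2: "p t * cnj (p t) = s"
      using np[of t] r by (simp add: complex_norm_square[symmetric] power2_eq_square flip: of_real_mult)
    have "p t - b * s = p t * (1 - b * cnj (p t))"
      by (simp add: algebra_simps flip: 2)
    moreover have "p t \<noteq> 0" using np[of t] r by auto
    ultimately show ?thesis unfolding 1 by simp
  qed
  moreover have "(of_real (norm b))\<^sup>2 = cnj b * b"
    using complex_norm_square[of b] by (simp add: mult_ac)
  ultimately show "(\<integral>t. h (polar (s, t)) / of_real ((norm (1 - cnj b * polar (s, t)))\<^sup>2) \<partial>unit_measure)
      = h (b * s) / (1 - (norm b)\<^sup>2 * s)"
    and "integrable unit_measure (\<lambda>t. h (polar (s, t)) / of_real ((norm (1 - cnj b * polar (s, t)))\<^sup>2))"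
    using circle_mean_Cauchy[OF hol r(1,2) bs, of 0, folded p_def] by (simp_all add: p)
qed

lemma nn_circle_mean_Poisson:
  assumes h: "h holomorphic_on ball 0 1" and s: "0 < s" "s < 1" and b: "norm b < 1"
    and nn: "\<And>z. (norm z)\<^sup>2 = s \<Longrightarrow> 0 \<le> Re (h z)"
  shows "(\<integral>\<^sup>+t. ennreal (Re (h (polar (s, t))) / (norm (1 - cnj b * polar (s, t)))\<^sup>2) \<partial>unit_measure)
      = ennreal (Re (h (b * s)) / (1 - (norm b)\<^sup>2 * s))"
proof -
  note P = circle_mean_Poisson[OF assms(1-4)]
  have "(\<integral>\<^sup>+t. ennreal (Re (h (polar (s, t))) / (norm (1 - cnj b * polar (s, t)))\<^sup>2) \<partial>unit_measure)
    = ennreal (\<integral>t. Re (h (polar (s, t))) / (norm (1 - cnj b * polar (s, t)))\<^sup>2 \<partial>unit_measure)"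
    using integrable_Re[OF P(2)] nn s
    by (intro nn_integral_eq_integral) (auto simp: norm_polar Re_divide_of_real simp del: of_real_power intro!: AE_I2 divide_nonneg_nonneg)
  also have "(\<integral>t. Re (h (polar (s, t))) / (norm (1 - cnj b * polar (s, t)))\<^sup>2 \<partial>unit_measure)
     = Re (\<integral>t. h (polar (s, t)) / of_real ((norm (1 - cnj b * polar (s, t)))\<^sup>2) \<partial>unit_measure)"
    using integral_Re[OF P(2)] by (simp add: Re_divide_of_real del: of_real_power)
  also have "\<dots> = Re (h (b * s)) / (1 - (norm b)\<^sup>2 * s)"
    unfolding P(1) using Re_divide_of_real[of "h (b * s)" "1 - (norm b)\<^sup>2 * s"] by simp
  finally show ?thesis .
qed

lemma circle_mean_kernel:
  assumes s: "0 < s" "s < 1" and b: "norm b < 1"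
  shows "(\<integral>\<^sup>+t. ennreal (1 / (norm (1 - cnj b * polar (s, t)))\<^sup>2) \<partial>unit_measure) = ennreal (1 / (1 - (norm b)\<^sup>2 * s))"
  using nn_circle_mean_Poisson[of "\<lambda>_. 1", OF _ assms] by simp

text \<open>Up to the constant 1 - |a|^2 s, the factor belonging to \<open>a\<close> is the real
  part of (1 + conj a z) / (1 - conj a z) on the circle. The Poisson formula for \<open>b\<close>
  evaluates that holomorphic function at b s, where its modulus is at most 2 / (1 - |a| |b|
  s).\<close>

lemma circle_mean_kernel_product:
  assumes s: "0 < s" "s < 1" and a: "norm a < 1" and b: "norm b < 1"
  shows "(\<integral>\<^sup>+t. ennreal (1 / ((norm (1 - cnj a * polar (s, t)))\<^sup>2 * (norm (1 - cnj b * polar (s, t)))\<^sup>2)) \<partial>unit_measure)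
     \<le> ennreal (2 / ((1 - (norm a)\<^sup>2 * s) * (1 - (norm b)\<^sup>2 * s) * (1 - norm a * norm b * s)))"
proof -
  define h where "h z = (1 + cnj a * z) / (1 - cnj a * z)" for z
  have hol: "h holomorphic_on ball 0 1"
    unfolding h_def using one_minus_cnj_mult_nonzero[OF a] by (intro holomorphic_intros) auto
  have sq: "(norm x)\<^sup>2 < 1" if "norm x < 1" for x :: complex
    using that by (simp add: power_less_one_iff)
  have as: "(norm a)\<^sup>2 * s < 1" "(norm b)\<^sup>2 * s < 1"
    using sq[OF a] sq[OF b] s by (auto intro: le_less_trans[OF mult_left_le])
  have re: "Re (h z) = (1 - (norm a)\<^sup>2 * s) / (norm (1 - cnj a * z))\<^sup>2" if "(norm z)\<^sup>2 = s" for z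
  proof -
    have "Re (h z) = Re ((1 + cnj a * z) * cnj (1 - cnj a * z)) / (norm (1 - cnj a * z))\<^sup>2"
      unfolding h_def by (rule Re_divide'[unfolded complex_mult_cnj, THEN trans])
        (simp add: complex_div_cnj, simp add: algebra_simps)
    moreover have "Re ((1 + cnj a * z) * cnj (1 - cnj a * z)) = 1 - (norm (cnj a * z))\<^sup>2"
      unfolding cmod_power2 by (simp add: algebra_simps power2_eq_square)
    ultimately show ?thesis by (simp add: norm_mult power_mult_distrib that)
  qed
  have "ennreal (1 / ((norm (1 - cnj a * polar (s, t)))\<^sup>2 * (norm (1 - cnj b * polar (s, t)))\<^sup>2))
    = ennreal (1 / (1 - (norm a)\<^sup>2 * s)) * ennreal (Re (h (polar (s, t))) / (norm (1 - cnj b * polar (s, t)))\<^sup>2)" for t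
    using as s by (subst re) (auto simp: norm_polar simp flip: ennreal_mult)
  then have "(\<integral>\<^sup>+t. ennreal (1 / ((norm (1 - cnj a * polar (s, t)))\<^sup>2 * (norm (1 - cnj b * polar (s, t)))\<^sup>2)) \<partial>unit_measure)
    = ennreal (1 / (1 - (norm a)\<^sup>2 * s)) * (\<integral>\<^sup>+t. ennreal (Re (h (polar (s, t))) / (norm (1 - cnj b * polar (s, t)))\<^sup>2) \<partial>unit_measure)"
    using integrable_Re[OF circle_mean_Poisson(2)[OF hol s b]]
    by (simp add: Re_divide_of_real nn_integral_cmult del: of_real_power)
  also have "\<dots> = ennreal (1 / (1 - (norm a)\<^sup>2 * s)) * ennreal (Re (h (b * s)) / (1 - (norm b)\<^sup>2 * s))"
    using as by (subst nn_circle_mean_Poisson[OF hol s b]) (auto simp: re)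
  also have "\<dots> = ennreal (1 / (1 - (norm a)\<^sup>2 * s) * (Re (h (b * s)) / (1 - (norm b)\<^sup>2 * s)))"
    using as by (intro ennreal_mult'[symmetric]) auto
  also have "\<dots> \<le> ennreal (2 / ((1 - (norm a)\<^sup>2 * s) * (1 - (norm b)\<^sup>2 * s) * (1 - norm a * norm b * s)))"
  proof -
    have x: "norm (cnj a * (b * s)) = norm a * norm b * s" using s by (simp add: norm_mult)
    have lt: "norm a * norm b * s < 1"
      using a b s by (metis mult_less_cancel_left2 mult_strict_mono norm_ge_zero mult_1 zero_less_one mult_nonneg_nonneg less_eq_real_def not_less order.strict_trans1)
    have "Re (h (b * s)) \<le> norm (h (b * s))" by (rule complex_Re_le_cmod)
    also have "\<dots> = norm (1 + cnj a * (b * s)) / norm (1 - cnj a * (b * s))" by (simp add: h_def norm_divide)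
    also have "\<dots> \<le> 2 / (1 - norm a * norm b * s)"
    proof (rule frac_le)
      show "norm (1 + cnj a * (b * s)) \<le> 2"
        using norm_triangle_ineq[of 1 "cnj a * (b * s)"] lt x by simp
      show "1 - norm a * norm b * s \<le> norm (1 - cnj a * (b * s))"
        using norm_triangle_ineq2[of 1 "cnj a * (b * s)"] x by simp
    qed (use lt in auto)
    finally have "Re (h (b * s)) \<le> 2 / (1 - norm a * norm b * s)" .
    then have "1 / (1 - (norm a)\<^sup>2 * s) * (Re (h (b * s)) / (1 - (norm b)\<^sup>2 * s))
       \<le> 1 / (1 - (norm a)\<^sup>2 * s) * (2 / (1 - norm a * norm b * s) / (1 - (norm b)\<^sup>2 * s))"
      using as by (intro mult_left_mono divide_right_mono) auto
    then show ?thesis by (intro ennreal_leI) (simp add: mult_ac)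
  qed
  finally show ?thesis .
qed


section \<open>The kernel and its area integrals\<close>

text \<open>This is \<open>|\<phi>\<^sub>a'(z)|\<close>, so that \<open>1 - |\<phi>\<^sub>a(z)|\<^sup>2 = (1 - |z|\<^sup>2) kern a z\<close>.\<close>

definition kern :: "complex \<Rightarrow> complex \<Rightarrow> real" where
  "kern a z = (1 - (norm a)\<^sup>2) / (norm (1 - cnj a * z))\<^sup>2"

lemma kern_nonneg: "norm a \<le> 1 \<Longrightarrow> 0 \<le> kern a z"
  by (simp add: kern_def power_le_one)

lemma borel_measurable_kern [measurable]: "kern a \<in> borel_measurable borel"
  unfolding kern_def by measurable

text \<open>The primitive need not extend to 1: the fundamental theorem is applied on
  \<open>{0..b n}\<close> with \<open>b n\<close> increasing to 1, and monotone convergence carries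
  the bound over.\<close>

lemma nn_integral_unit_FTC:
  assumes [measurable]: "f \<in> borel_measurable borel"
    and F: "\<And>t. 0 \<le> t \<Longrightarrow> t < 1 \<Longrightarrow> (F has_real_derivative f t) (at t)"
    and nn: "\<And>t. 0 \<le> t \<Longrightarrow> t < 1 \<Longrightarrow> 0 \<le> f t"
    and le: "\<And>t. 0 \<le> t \<Longrightarrow> t < 1 \<Longrightarrow> F t - F 0 \<le> C"
  shows "(\<integral>\<^sup>+t. ennreal (f t) \<partial>unit_measure) \<le> ennreal C"
proof -
  define b where "b n = 1 - 1 / (real n + 1)" for n
  have b: "0 \<le> b n" "b n < 1" for n by (auto simp: b_def field_simps)
  have mono: "b m \<le> b n" if "m \<le> n" for m n
    using that by (simp add: b_def frac_le)
  have ex: "\<exists>n. t \<le> b n" if "t < 1" for t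
  proof -
    obtain n where "1 / (1 - t) < real n" using reals_Archimedean2 by blast
    then have "1 / (real n + 1) \<le> 1 - t" using that by (simp add: field_simps)
    then show ?thesis by (auto simp: b_def intro!: exI[of _ n])
  qed
  have "(\<integral>\<^sup>+t. ennreal (f t) \<partial>unit_measure) = (\<integral>\<^sup>+t. ennreal (f t) * indicator {0<..<1} t \<partial>lborel)"
    by (rule nn_integral_unit_measure)
  also have "\<dots> \<le> (\<integral>\<^sup>+t. (SUP n. ennreal (f t) * indicator {0..b n} t) \<partial>lborel)"
  proof (rule nn_integral_mono)
    fix t :: real
    show "ennreal (f t) * indicator {0<..<1} t \<le> (SUP n. ennreal (f t) * indicator {0..b n} t)"
    proof (cases "0 < t \<and> t < 1")
      case True
      then obtain n where "t \<le> b n" using ex by blast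
      then show ?thesis using True by (intro SUP_upper2[of n]) auto
    qed auto
  qed
  also have "\<dots> = (SUP n. (\<integral>\<^sup>+t. ennreal (f t) * indicator {0..b n} t \<partial>lborel))"
    using mono by (intro nn_integral_monotone_convergence_SUP)
      (auto simp: incseq_def le_fun_def indicator_def intro: order_trans)
  also have "\<dots> \<le> ennreal C"
  proof (rule SUP_least)
    fix n
    have "(\<integral>\<^sup>+t. ennreal (f t) * indicator {0..b n} t \<partial>lborel) = ennreal (F (b n) - F 0)"
      using b[of n] by (intro nn_integral_FTC_Icc) (auto intro!: F nn DERIV_subset[OF F])
    also have "\<dots> \<le> ennreal C" using b le by (intro ennreal_leI) auto
    finally show "(\<integral>\<^sup>+t. ennreal (f t) * indicator {0..b n} t \<partial>lborel) \<le> ennreal C" .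
  qed
  finally show ?thesis .
qed

text \<open>Since Ln (1 - conj a z) has derivative of modulus |a| / |1 - conj a z|, this says that
  these logarithms are bounded in BMOA uniformly in \<open>a\<close>. The circle means leave 2 (1 -
  \<beta>^2) / (1 - \<beta> s)^2 with \<beta> = |b|, whose integral is 2 (1 + \<beta>).\<close>

lemma nn_integral_two_kernels:
  assumes a: "norm a < 1" and b: "norm b < 1"
  shows "(\<integral>\<^sup>+z. ennreal ((1 - (norm z)\<^sup>2) * kern b z / (norm (1 - cnj a * z))\<^sup>2) \<partial>disc_measure) \<le> 4"
proof -
  define \<beta> where "\<beta> = norm b"
  have \<beta>: "0 \<le> \<beta>" "\<beta> < 1" using b by (auto simp: \<beta>_def)
  have pos: "0 < 1 - \<beta> * s" if "0 \<le> s" "s < 1" for s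
    using \<beta> that mult_strict_mono[of \<beta> 1 s 1] by auto
  have bsq: "0 \<le> 1 - \<beta>\<^sup>2" using \<beta> by (simp add: power_le_one)
  have "(\<integral>\<^sup>+z. ennreal ((1 - (norm z)\<^sup>2) * kern b z / (norm (1 - cnj a * z))\<^sup>2) \<partial>disc_measure)
     = (\<integral>\<^sup>+s. \<integral>\<^sup>+t. ennreal ((1 - (norm (polar (s, t)))\<^sup>2) * kern b (polar (s, t)) / (norm (1 - cnj a * polar (s, t)))\<^sup>2) \<partial>unit_measure \<partial>unit_measure)"
    by (rule nn_integral_disc_polar, rule measurable_disc_borel) measurable
  also have "\<dots> \<le> (\<integral>\<^sup>+s. ennreal (2 * (1 - \<beta>\<^sup>2) / (1 - \<beta> * s)\<^sup>2) \<partial>unit_measure)"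
  proof (rule nn_integral_mono)
    fix s assume "s \<in> space unit_measure"
    then have s: "0 < s" "s < 1" by auto
    have asq: "1 - s \<le> 1 - (norm a)\<^sup>2 * s" "0 < 1 - s"
      using s a by (auto intro!: mult_left_le_one_le simp: power_le_one)
    have bs: "1 - \<beta> * s \<le> 1 - \<beta>\<^sup>2 * s" "1 - \<beta> * s \<le> 1 - norm a * \<beta> * s"
      using \<beta> s a by (auto simp: power2_eq_square intro!: mult_right_mono mult_left_le_one_le mult_right_le_one_le)
    have "(\<integral>\<^sup>+t. ennreal ((1 - (norm (polar (s, t)))\<^sup>2) * kern b (polar (s, t)) / (norm (1 - cnj a * polar (s, t)))\<^sup>2) \<partial>unit_measure)
      = (\<integral>\<^sup>+t. ennreal ((1 - s) * (1 - \<beta>\<^sup>2)) * ennreal (1 / ((norm (1 - cnj a * polar (s, t)))\<^sup>2 * (norm (1 - cnj b * polar (s, t)))\<^sup>2)) \<partial>unit_measure)"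
      using s bsq by (intro nn_integral_cong) (simp add: norm_polar kern_def \<beta>_def mult_ac flip: ennreal_mult)
    also have "\<dots> = ennreal ((1 - s) * (1 - \<beta>\<^sup>2)) * (\<integral>\<^sup>+t. ennreal (1 / ((norm (1 - cnj a * polar (s, t)))\<^sup>2 * (norm (1 - cnj b * polar (s, t)))\<^sup>2)) \<partial>unit_measure)"
      by (rule nn_integral_cmult, rule measurable_unit_borel) (simp add: polar_def cis_conv_exp)
    also have "\<dots> \<le> ennreal ((1 - s) * (1 - \<beta>\<^sup>2)) * ennreal (2 / ((1 - (norm a)\<^sup>2 * s) * (1 - \<beta>\<^sup>2 * s) * (1 - norm a * \<beta> * s)))"
      unfolding \<beta>_def by (intro mult_left_mono circle_mean_kernel_product s a b) auto
    also have "\<dots> = ennreal ((1 - s) * (1 - \<beta>\<^sup>2) * (2 / ((1 - (norm a)\<^sup>2 * s) * (1 - \<beta>\<^sup>2 * s) * (1 - norm a * \<beta> * s))))"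
      using s bsq by (intro ennreal_mult'[symmetric]) auto
    \<comment> \<open>The denominator coming from \<open>a\<close> alone is estimated so as to
      cancel the weight 1 - s; the other two are both estimated by 1 - \<beta> s, which removes
      every dependence on \<open>a\<close>.\<close>
    also have "\<dots> \<le> ennreal ((1 - s) * (1 - \<beta>\<^sup>2) * (2 / ((1 - s) * (1 - \<beta> * s) * (1 - \<beta> * s))))"
    proof -
      have "0 < 1 - \<beta> * s" using pos[of s] s by simp
      with asq bs have p: "0 < 1 - (norm a)\<^sup>2 * s" "0 < 1 - \<beta>\<^sup>2 * s" "0 < 1 - norm a * \<beta> * s" "0 < 1 - \<beta> * s"
        by linarith+
      show ?thesis
        using s bsq asq bs p
        by (intro ennreal_leI mult_left_mono divide_left_mono mult_mono mult_pos_pos mult_nonneg_nonneg) auto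
    qed
    also have "(1 - s) * (1 - \<beta>\<^sup>2) * (2 / ((1 - s) * (1 - \<beta> * s) * (1 - \<beta> * s))) = 2 * (1 - \<beta>\<^sup>2) / (1 - \<beta> * s)\<^sup>2"
      using asq by (simp add: power2_eq_square)
    finally show "(\<integral>\<^sup>+t. ennreal ((1 - (norm (polar (s, t)))\<^sup>2) * kern b (polar (s, t)) / (norm (1 - cnj a * polar (s, t)))\<^sup>2) \<partial>unit_measure)
      \<le> ennreal (2 * (1 - \<beta>\<^sup>2) / (1 - \<beta> * s)\<^sup>2)" .
  qed
  also have "\<dots> \<le> ennreal 4"
  proof (rule nn_integral_unit_FTC[where F = "\<lambda>s. 2 * (1 - \<beta>\<^sup>2) * (s / (1 - \<beta> * s))"])
    fix t :: real assume t: "0 \<le> t" "t < 1"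
    note p = pos[OF t]
    show "((\<lambda>s. 2 * (1 - \<beta>\<^sup>2) * (s / (1 - \<beta> * s))) has_real_derivative 2 * (1 - \<beta>\<^sup>2) / (1 - \<beta> * t)\<^sup>2) (at t)"
    proof -
      have "((\<lambda>s. 1 - \<beta> * s) has_real_derivative - \<beta>) (at t)"
        by (auto intro!: derivative_eq_intros)
      from DERIV_cmult[OF DERIV_divide[OF DERIV_ident this], of "2 * (1 - \<beta>\<^sup>2)"] p
      show ?thesis by (simp add: power2_eq_square algebra_simps)
    qed
    show "0 \<le> 2 * (1 - \<beta>\<^sup>2) / (1 - \<beta> * t)\<^sup>2" using bsq by simp
    have "t / (1 - \<beta> * t) \<le> 1 / (1 - \<beta>)"
      using p \<beta> t by (intro frac_le) (auto intro: mult_left_le)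
    then have "2 * (1 - \<beta>\<^sup>2) * (t / (1 - \<beta> * t)) \<le> 2 * (1 - \<beta>\<^sup>2) * (1 / (1 - \<beta>))"
      using bsq by (intro mult_left_mono) auto
    also have "\<dots> = 2 * (1 + \<beta>)" using \<beta> by (simp add: power2_eq_square field_simps)
    also have "\<dots> \<le> 4" using \<beta> by simp
    finally show "2 * (1 - \<beta>\<^sup>2) * (t / (1 - \<beta> * t)) - 2 * (1 - \<beta>\<^sup>2) * (0 / (1 - \<beta> * 0)) \<le> 4" by simp
  qed measurable
  finally show ?thesis by simp
qed

lemma nn_integral_radial_kernel:
  assumes [measurable]: "\<omega> \<in> borel_measurable borel"
    and nn: "\<And>s. 0 < s \<Longrightarrow> s < 1 \<Longrightarrow> 0 \<le> \<omega> s" and b: "norm b < 1"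
  shows "(\<integral>\<^sup>+z. ennreal (\<omega> ((norm z)\<^sup>2) / (norm (1 - cnj b * z))\<^sup>2) \<partial>disc_measure)
    = (\<integral>\<^sup>+s. ennreal (\<omega> s / (1 - (norm b)\<^sup>2 * s)) \<partial>unit_measure)"
proof -
  have "(\<integral>\<^sup>+z. ennreal (\<omega> ((norm z)\<^sup>2) / (norm (1 - cnj b * z))\<^sup>2) \<partial>disc_measure)
    = (\<integral>\<^sup>+s. \<integral>\<^sup>+t. ennreal (\<omega> ((norm (polar (s, t)))\<^sup>2) / (norm (1 - cnj b * polar (s, t)))\<^sup>2) \<partial>unit_measure \<partial>unit_measure)"
    by (rule nn_integral_disc_polar, rule measurable_disc_borel) measurable
  also have "\<dots> = (\<integral>\<^sup>+s. ennreal (\<omega> s / (1 - (norm b)\<^sup>2 * s)) \<partial>unit_measure)"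
  proof (rule nn_integral_cong)
    fix s assume "s \<in> space unit_measure"
    then have s: "0 < s" "s < 1" by auto
    have "(\<integral>\<^sup>+t. ennreal (\<omega> ((norm (polar (s, t)))\<^sup>2) / (norm (1 - cnj b * polar (s, t)))\<^sup>2) \<partial>unit_measure)
      = (\<integral>\<^sup>+t. ennreal (\<omega> s) * ennreal (1 / (norm (1 - cnj b * polar (s, t)))\<^sup>2) \<partial>unit_measure)"
      using s nn[OF s] by (intro nn_integral_cong) (simp add: norm_polar flip: ennreal_mult)
    also have "\<dots> = ennreal (\<omega> s) * (\<integral>\<^sup>+t. ennreal (1 / (norm (1 - cnj b * polar (s, t)))\<^sup>2) \<partial>unit_measure)"
      by (rule nn_integral_cmult, rule measurable_unit_borel) (simp add: polar_def cis_conv_exp)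
    also have "\<dots> = ennreal (\<omega> s) * ennreal (1 / (1 - (norm b)\<^sup>2 * s))"
      by (simp only: circle_mean_kernel[OF s b])
    also have "\<dots> = ennreal (\<omega> s / (1 - (norm b)\<^sup>2 * s))"
      using nn[OF s] by (subst ennreal_mult'[symmetric]) auto
    finally show "(\<integral>\<^sup>+t. ennreal (\<omega> ((norm (polar (s, t)))\<^sup>2) / (norm (1 - cnj b * polar (s, t)))\<^sup>2) \<partial>unit_measure)
      = ennreal (\<omega> s / (1 - (norm b)\<^sup>2 * s))" .
  qed
  finally show ?thesis .
qed

lemma square_norm_mult_le:
  assumes "norm (b::complex) < 1" "0 < s" "s < 1"
  shows "(norm b)\<^sup>2 * s \<le> s" "(norm b)\<^sup>2 * s \<le> (norm b)\<^sup>2" "0 < 1 - (norm b)\<^sup>2 * s" "0 < 1 - (norm b)\<^sup>2"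
proof -
  have b: "(norm b)\<^sup>2 < 1" using assms(1) by (simp add: power_less_one_iff)
  show le: "(norm b)\<^sup>2 * s \<le> s" using assms b by (intro mult_left_le_one_le) auto
  show "(norm b)\<^sup>2 * s \<le> (norm b)\<^sup>2" using assms by (intro mult_left_le) auto
  show "0 < 1 - (norm b)\<^sup>2 * s" "0 < 1 - (norm b)\<^sup>2" using le b assms by linarith+
qed

text \<open>The 2 keeps the weight at least ln 2 even at the origin, so that one may divide by it
  throughout the disc.\<close>

definition log_weight :: "complex \<Rightarrow> real" where
  "log_weight z = ln (2 / (1 - (norm z)\<^sup>2))"

text \<open>After the circle means the kernel contributes at most 1. What remains, 1 / ((1 - s)
  l(s)^2), has the primitive -1 / l(s), which is bounded up to the boundary, and the total is at
  most 1 / ln 2.\<close>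

lemma nn_integral_kern_log_weight:
  assumes a: "norm a < 1"
  shows "(\<integral>\<^sup>+z. ennreal (kern a z / ((1 - (norm z)\<^sup>2) * (log_weight z)\<^sup>2)) \<partial>disc_measure) \<le> 2"
proof -
  define l where "l s = ln (2 / (1 - s))" for s :: real
  have [measurable]: "l \<in> borel_measurable borel" unfolding l_def by measurable
  have l: "ln 2 \<le> l s" if "0 \<le> s" "s < 1" for s
    using that unfolding l_def by (subst ln_le_cancel_iff) (auto simp: field_simps)
  have lp: "0 < l s" if "0 \<le> s" "s < 1" for s
    using l[OF that] ln_gt_zero[of 2] by linarith
  define \<omega> where "\<omega> s = (1 - (norm a)\<^sup>2) / ((1 - s) * (l s)\<^sup>2)" for s
  have "(\<integral>\<^sup>+z. ennreal (kern a z / ((1 - (norm z)\<^sup>2) * (log_weight z)\<^sup>2)) \<partial>disc_measure)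
     = (\<integral>\<^sup>+z. ennreal (\<omega> ((norm z)\<^sup>2) / (norm (1 - cnj a * z))\<^sup>2) \<partial>disc_measure)"
    by (simp add: \<omega>_def kern_def log_weight_def l_def mult_ac)
  also have "\<dots> = (\<integral>\<^sup>+s. ennreal (\<omega> s / (1 - (norm a)\<^sup>2 * s)) \<partial>unit_measure)"
    unfolding \<omega>_def using a by (intro nn_integral_radial_kernel) (auto simp: power_le_one)
  also have "\<dots> \<le> (\<integral>\<^sup>+s. ennreal (1 / ((1 - s) * (l s)\<^sup>2)) \<partial>unit_measure)"
  proof (intro nn_integral_mono ennreal_leI)
    fix s assume "s \<in> space unit_measure"
    then have s: "0 < s" "s < 1" by auto
    note as = square_norm_mult_le[OF a s]
    have "\<omega> s / (1 - (norm a)\<^sup>2 * s) = 1 / ((1 - s) * (l s)\<^sup>2) * ((1 - (norm a)\<^sup>2) / (1 - (norm a)\<^sup>2 * s))"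
      by (simp add: \<omega>_def)
    also have "\<dots> \<le> 1 / ((1 - s) * (l s)\<^sup>2) * 1" using s as by (intro mult_left_mono) auto
    finally show "\<omega> s / (1 - (norm a)\<^sup>2 * s) \<le> 1 / ((1 - s) * (l s)\<^sup>2)" by simp
  qed
  also have "\<dots> \<le> ennreal 2"
  proof (rule nn_integral_unit_FTC[where F = "\<lambda>s. - 1 / l s"])
    fix t :: real assume t: "0 \<le> t" "t < 1"
    show "((\<lambda>s. - 1 / l s) has_real_derivative 1 / ((1 - t) * (l t)\<^sup>2)) (at t)"
    proof -
      have "((\<lambda>s. 2 / (1 - s)) has_real_derivative (0 * (1 - t) - 2 * (- 1)) / ((1 - t) * (1 - t))) (at t)"
        using t by (intro DERIV_divide DERIV_const) (auto intro!: derivative_eq_intros)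
      from DERIV_chain2[OF DERIV_ln_divide this] t have "(l has_real_derivative 1 / (2 / (1 - t)) * (2 / ((1 - t) * (1 - t)))) (at t)"
        by (simp add: l_def[abs_def])
      moreover have "1 / (2 / u) * (2 / (u * u)) = 1 / u" if "u \<noteq> 0" for u :: real
        using that by simp
      ultimately have "(l has_real_derivative 1 / (1 - t)) (at t)"
        using t by (metis diff_gt_0_iff_gt less_irrefl)
      from DERIV_divide[OF DERIV_const[of "- 1"] this] lp[OF t]
      show ?thesis by (simp add: power2_eq_square)
    qed
    show "0 \<le> 1 / ((1 - t) * (l t)\<^sup>2)" using t by simp
    have "- 1 / l t - - 1 / l 0 \<le> 1 / l 0" using lp[OF t] by simp
    also have "\<dots> \<le> 2" using ln_2_less_1 ln2_ge_two_thirds by (simp add: l_def field_simps)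
    finally show "- 1 / l t - - 1 / l 0 \<le> 2" .
  qed measurable
  finally show ?thesis by simp
qed

text \<open>Supplies the decay, as \<open>a\<close> approaches the circle, of the integrals of a
  function with bounded derivative; see \<open>test_fun_integral_boundary\<close>.\<close>

lemma nn_integral_one_minus_norm_kern:
  assumes a: "norm a < 1"
  shows "(\<integral>\<^sup>+z. ennreal ((1 - (norm z)\<^sup>2) * kern a z) \<partial>disc_measure) \<le> ennreal (1 - (norm a)\<^sup>2)"
proof -
  define \<omega> where "\<omega> s = (1 - s) * (1 - (norm a)\<^sup>2)" for s
  have "(\<integral>\<^sup>+z. ennreal ((1 - (norm z)\<^sup>2) * kern a z) \<partial>disc_measure)
     = (\<integral>\<^sup>+z. ennreal (\<omega> ((norm z)\<^sup>2) / (norm (1 - cnj a * z))\<^sup>2) \<partial>disc_measure)"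
    by (simp add: \<omega>_def kern_def)
  also have "\<dots> = (\<integral>\<^sup>+s. ennreal (\<omega> s / (1 - (norm a)\<^sup>2 * s)) \<partial>unit_measure)"
    unfolding \<omega>_def using a by (intro nn_integral_radial_kernel) (auto simp: power_le_one)
  also have "\<dots> \<le> (\<integral>\<^sup>+s. ennreal (1 - (norm a)\<^sup>2) \<partial>unit_measure)"
  proof (intro nn_integral_mono ennreal_leI)
    fix s assume "s \<in> space unit_measure"
    then have "0 < s" "s < 1" by auto
    note as = square_norm_mult_le[OF a this]
    have "(1 - (norm a)\<^sup>2) * ((1 - s) / (1 - (norm a)\<^sup>2 * s)) \<le> (1 - (norm a)\<^sup>2) * 1"
      using as by (intro mult_left_mono) auto
    then show "\<omega> s / (1 - (norm a)\<^sup>2 * s) \<le> 1 - (norm a)\<^sup>2" by (simp add: \<omega>_def mult.commute)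
  qed
  finally show ?thesis by simp
qed

lemma borel_measurable_cnj [measurable]: "cnj \<in> borel_measurable borel"
  by (intro borel_measurable_continuous_onI continuous_intros)

lemma one_minus_cnj_mult_lower:
  assumes "norm z \<le> 1"
  shows "1 - norm a \<le> norm (1 - cnj a * z)"
proof -
  have "norm (cnj a * z) \<le> norm a" using assms by (simp add: norm_mult mult_left_le)
  then show ?thesis using norm_triangle_ineq2[of 1 "cnj a * z"] by simp
qed

lemma one_minus_cnj_mult_upper:
  assumes "norm z \<le> 1" "norm a \<le> 1"
  shows "norm (1 - cnj a * z) \<le> 2"
proof -
  have "norm (cnj a * z) \<le> 1" using assms by (simp add: norm_mult mult_le_one)
  then show ?thesis using norm_triangle_ineq4[of 1 "cnj a * z"] by simp
qed

lemma norm_one_minus_cnj_swap: "norm (1 - z * cnj w) = norm (1 - cnj z * w)"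
  by (metis complex_cnj_cnj complex_cnj_diff complex_cnj_mult complex_cnj_one complex_mod_cnj)

text \<open>Again 1 - z conj zeta = (zeta - z s) / zeta. The cube leaves zeta^3 in the numerator:
  one factor belongs to Cauchy's formula, the other two are absorbed into w^2 h(w), and the triple
  pole produces a second derivative.\<close>

lemma circle_mean_cubic:
  assumes h: "h holomorphic_on ball 0 1" and s: "0 < s" "s < 1" and z: "norm z < 1"
  shows "(\<integral>t. h (polar (s, t)) / (1 - z * cnj (polar (s, t))) ^ 3 \<partial>unit_measure)
      = (deriv ^^ 2) (\<lambda>w. w\<^sup>2 * h w) (z * s) / 2"
proof -
  define r where "r = sqrt s"
  have r: "0 < r" "r < 1" "r * r = s" using s by (auto simp: r_def)
  define p where "p t = of_real r * cis (2 * pi * t)" for t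
  have p: "polar (s, t) = p t" for t by (simp add: p_def polar_def r_def)
  have np: "norm (p t) = r" for t using r by (simp add: p_def norm_mult)
  have zs: "norm (z * s) < r"
  proof -
    have "norm (z * s) = norm z * r * r" using s by (simp add: norm_mult r(3) mult.assoc)
    also have "\<dots> < 1 * r" using z r by (intro mult_strict_right_mono) (use mult_strict_mono[of "norm z" 1 r 1] in auto)
    finally show ?thesis by simp
  qed
  have hol: "(\<lambda>w. w\<^sup>2 * h w) holomorphic_on ball 0 1"
    by (intro holomorphic_intros h)
  have "h (p t) / (1 - z * cnj (p t)) ^ 3 = ((p t)\<^sup>2 * h (p t)) * (p t / (p t - z * s) ^ Suc 2)" for t
  proof -
    have 2: "p t * cnj (p t) = s"
      using np[of t] r by (simp add: complex_norm_square[symmetric] power2_eq_square flip: of_real_mult)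
    have 3: "p t - z * s = p t * (1 - z * cnj (p t))"
      by (simp add: algebra_simps flip: 2)
    have "p t \<noteq> 0" using np[of t] r by auto
    then show ?thesis unfolding 3 by (simp add: power_mult_distrib power3_eq_cube power2_eq_square)
  qed
  then show ?thesis
    using circle_mean_Cauchy(1)[OF hol r(1,2) zs, of 2, folded p_def] by (simp add: p)
qed

lemma measurable_disc_complex_integrable_bound:
  fixes q :: "complex \<Rightarrow> complex"
  assumes q: "integrable disc_measure q" and m: "m \<in> borel_measurable disc_measure"
    and le: "\<And>w. norm w < 1 \<Longrightarrow> norm (m w) \<le> M"
  shows "integrable disc_measure (\<lambda>w. q w * m w)"
proof (rule Bochner_Integration.integrable_bound)
  show "integrable disc_measure (\<lambda>w. of_real M * q w)" using q by simp
  show "(\<lambda>w. q w * m w) \<in> borel_measurable disc_measure"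
    using m borel_measurable_integrable[OF q] by measurable
  show "AE w in disc_measure. norm (q w * m w) \<le> norm (of_real M * q w)"
    using le by (intro AE_I2)
      (auto simp: norm_mult mult.commute intro!: mult_right_mono order_trans[OF _ abs_ge_self])
qed

section \<open>The reproducing formula and increments\<close>

text \<open>The circle means turn the left side into the integral of (1 - s) H''(z s) / 2 over the
  unit interval, with H(w) = w^2 h(w), and integration by parts in s gives h(z) / 2. The factor 1/2
  is the total mass of the weight 1 - |w|^2.\<close>

lemma Bergman_reproducing:
  assumes h: "h holomorphic_on ball 0 1" and z: "norm z < 1"
    and int: "integrable disc_measure (\<lambda>w. h w * (1 - (norm w)\<^sup>2))"
  shows "(\<integral>w. h w * (1 - (norm w)\<^sup>2) / (1 - z * cnj w) ^ 3 \<partial>disc_measure) = h z / 2"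
    and "integrable disc_measure (\<lambda>w. h w * (1 - (norm w)\<^sup>2) / (1 - z * cnj w) ^ 3)"
proof -
  define H where "H w = w\<^sup>2 * h w" for w
  have H: "H holomorphic_on ball 0 1" unfolding H_def by (intro holomorphic_intros h)
  have ne: "1 - z * cnj w \<noteq> 0" if "norm w < 1" for w
    using one_minus_cnj_mult_nonzero(2)[OF z that] .
  have "integrable disc_measure (\<lambda>w. (h w * (1 - (norm w)\<^sup>2)) * (1 / (1 - z * cnj w) ^ 3))"
  proof (rule measurable_disc_complex_integrable_bound[OF int])
    show "(\<lambda>w. 1 / (1 - z * cnj w) ^ 3) \<in> borel_measurable disc_measure"
      using ne by (intro measurable_disc_continuous continuous_intros) auto
    fix w :: complex assume w: "norm w < 1"
    have "(1 - norm z) ^ 3 \<le> norm (1 - z * cnj w) ^ 3"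
      using one_minus_cnj_mult_lower[of w z] z w by (intro power_mono) (auto simp: norm_one_minus_cnj_swap)
    then show "norm (1 / (1 - z * cnj w) ^ 3) \<le> 1 / (1 - norm z) ^ 3"
      using z by (simp add: norm_divide norm_power frac_le)
  qed
  then show int': "integrable disc_measure (\<lambda>w. h w * (1 - (norm w)\<^sup>2) / (1 - z * cnj w) ^ 3)"
    by simp
  define g where "g s = of_real (1 - s) * ((deriv ^^ 2) H (z * of_real s) / 2)" for s :: real
  have "(\<integral>w. h w * (1 - (norm w)\<^sup>2) / (1 - z * cnj w) ^ 3 \<partial>disc_measure)
      = (\<integral>s. \<integral>t. h (polar (s, t)) * (1 - (norm (polar (s, t)))\<^sup>2) / (1 - z * cnj (polar (s, t))) ^ 3 \<partial>unit_measure \<partial>unit_measure)"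
    by (rule integral_disc_polar(1)[OF int'])
  also have "\<dots> = (\<integral>s. g s \<partial>unit_measure)"
  proof (rule Bochner_Integration.integral_cong[OF refl])
    fix s assume "s \<in> space unit_measure"
    then have s: "0 < s" "s < 1" by auto
    have "(\<integral>t. h (polar (s, t)) * (1 - (norm (polar (s, t)))\<^sup>2) / (1 - z * cnj (polar (s, t))) ^ 3 \<partial>unit_measure)
       = (\<integral>t. of_real (1 - s) * (h (polar (s, t)) / (1 - z * cnj (polar (s, t))) ^ 3) \<partial>unit_measure)"
      using s by (simp add: norm_polar mult_ac flip: of_real_power)
    also have "\<dots> = g s"
      unfolding integral_mult_right_zero circle_mean_cubic[OF h s z] by (simp add: g_def H_def[abs_def])
    finally show "(\<integral>t. h (polar (s, t)) * (1 - (norm (polar (s, t)))\<^sup>2) / (1 - z * cnj (polar (s, t))) ^ 3 \<partial>unit_measure) = g s" .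
  qed
  also have "\<dots> = h z / 2"
  proof (rule integral_unit_measure(2))
    have zs: "norm (z * of_real s) < 1" if "s \<in> {0..1}" for s :: real
      using z that by (auto simp: norm_mult intro: le_less_trans[OF mult_left_le])
    have H1: "deriv H holomorphic_on ball 0 1" by (rule holomorphic_deriv[OF H open_ball])
    have H2: "deriv (deriv H) holomorphic_on ball 0 1" by (rule holomorphic_deriv[OF H1 open_ball])
    have e2: "(deriv ^^ 2) H = deriv (deriv H)" by (simp add: numeral_2_eq_2)
    have cz: "continuous_on {0..1} (\<lambda>s. z * complex_of_real s)" by (intro continuous_intros)
    show "continuous_on {0..1} g"
      unfolding g_def e2
      by (intro continuous_intros continuous_on_compose2[OF holomorphic_on_imp_continuous_on[OF H2] cz])
         (use zs in auto)
    show "(g has_integral h z / 2) {0..1}"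
    proof (cases "z = 0")
      case True
      \<comment> \<open>For z = 0 the cubic and the Poisson formula both compute the plain mean of
        \<open>h\<close> over a circle; the squared radius 1/2 is an arbitrary choice.\<close>
      have h0: "(deriv ^^ 2) H 0 / 2 = h 0"
      proof -
        have "(deriv ^^ 2) H 0 / 2 = (\<integral>t. h (polar (1/2, t)) \<partial>unit_measure)"
          using circle_mean_cubic[OF h, of "1/2" 0] by (simp add: H_def[abs_def])
        also have "\<dots> = h 0"
          using circle_mean_Poisson(1)[OF h, of "1/2" 0] by simp
        finally show ?thesis .
      qed
      have "((\<lambda>s. of_real (1 - s) * h 0) has_integral (of_real (1 - 1\<^sup>2 / 2) * h 0 - of_real (0 - 0\<^sup>2 / 2) * h 0)) {0..1}"
      proof (rule fundamental_theorem_of_calculus)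
        fix s :: real
        have "((\<lambda>s. s - s\<^sup>2 / 2) has_real_derivative (1 - s)) (at s within {0..1})"
          by (auto intro!: derivative_eq_intros)
        then have "((\<lambda>s. complex_of_real (s - s\<^sup>2 / 2)) has_vector_derivative of_real (1 - s)) (at s within {0..1})"
          by (intro has_vector_derivative_of_real) (simp add: has_real_derivative_iff_has_vector_derivative)
        then show "((\<lambda>s. complex_of_real (s - s\<^sup>2 / 2) * h 0) has_vector_derivative of_real (1 - s) * h 0) (at s within {0..1})"
          by (rule has_vector_derivative_mult_left)
      qed simp
      then show ?thesis using True by (simp add: g_def[abs_def] h0)
    next
      case False
      \<comment> \<open>The integration by parts written as a primitive. Its divisions by z are the
        reason for treating z = 0 apart; its value at 0 vanishes because H has a double zero
        there.\<close>
      define G where "G s = (of_real (1 - s) * deriv H (z * of_real s) / z + H (z * of_real s) / z\<^sup>2) / 2" for s :: real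
      have "(g has_integral (G 1 - G 0)) {0..1}"
      proof (rule fundamental_theorem_of_calculus)
        fix s :: real assume s: "s \<in> {0..1}"
        have d: "(H has_field_derivative deriv H (z * of_real s)) (at (z * of_real s))"
          "(deriv H has_field_derivative deriv (deriv H) (z * of_real s)) (at (z * of_real s))"
          using holomorphic_derivI[OF H open_ball] holomorphic_derivI[OF H1 open_ball] zs[OF s] by auto
        have d1: "((\<lambda>x. H (z * x)) has_field_derivative deriv H (z * of_real s) * z) (at (of_real s))"
          by (rule DERIV_chain2[of H _ "\<lambda>x. z * x"], rule d) (auto intro!: derivative_eq_intros)
        have d2: "((\<lambda>x. deriv H (z * x)) has_field_derivative deriv (deriv H) (z * of_real s) * z) (at (of_real s))"
          by (rule DERIV_chain2[of "deriv H" _ "\<lambda>x. z * x"], rule d) (auto intro!: derivative_eq_intros)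
        have c: "((\<lambda>x. (of_real 1 - x) * deriv H (z * x) / z + H (z * x) / z\<^sup>2) has_field_derivative
            2 * g s) (at (of_real s))"
        proof -
          have "((\<lambda>x. of_real 1 - x :: complex) has_field_derivative - 1) (at (of_real s))"
            by (auto intro!: derivative_eq_intros)
          from DERIV_add[OF DERIV_cdivide[OF DERIV_mult[OF this d2], of z] DERIV_cdivide[OF d1, of "z\<^sup>2"]]
          show ?thesis using False
            by (simp add: g_def e2 power2_eq_square add_divide_distrib diff_divide_distrib mult.commute)
        qed
        have "((\<lambda>x. ((of_real 1 - x) * deriv H (z * x) / z + H (z * x) / z\<^sup>2) / 2) has_field_derivative
            g s) (at (of_real s))"
          using DERIV_cdivide[OF c, of 2] by simp
        from field_vector_diff_chain_at[OF has_vector_derivative_of_real[OF DERIV_ident] this]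
        show "(G has_vector_derivative g s) (at s within {0..1})"
          by (auto simp: G_def[abs_def] o_def intro: has_vector_derivative_at_within)
      qed simp
      moreover have "deriv H 0 = 0"
      proof -
        have "(H has_field_derivative 0) (at 0)"
          unfolding H_def using holomorphic_derivI[OF h open_ball, of 0]
          by (auto intro!: derivative_eq_intros)
        then show ?thesis by (rule DERIV_imp_deriv)
      qed
      ultimately show ?thesis using False by (simp add: G_def H_def)
    qed
  qed
  finally show "(\<integral>w. h w * (1 - (norm w)\<^sup>2) / (1 - z * cnj w) ^ 3 \<partial>disc_measure) = h z / 2" .
qed


section \<open>Conformal inequalities and the kernel for increments\<close>

text \<open>This is |phi_a(z)| \<le> 1 without a division, from |1 - conj a z|^2 - |z - a|^2 = (1 -
  |a|^2)(1 - |z|^2).\<close>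

lemma norm_diff_le_one_minus_cnj:
  assumes "norm a \<le> 1" "norm z \<le> 1"
  shows "norm (z - a) \<le> norm (1 - cnj a * z)"
proof -
  have "0 \<le> (1 - (norm a)\<^sup>2) * (1 - (norm z)\<^sup>2)"
    using assms by (intro mult_nonneg_nonneg) (auto simp: power_le_one)
  also have "\<dots> = (norm (1 - cnj a * z))\<^sup>2 - (norm (z - a))\<^sup>2"
  proof -
    have "complex_of_real ((1 - (norm a)\<^sup>2) * (1 - (norm z)\<^sup>2)) = of_real ((norm (1 - cnj a * z))\<^sup>2 - (norm (z - a))\<^sup>2)"
      by (simp only: of_real_diff of_real_mult of_real_1 complex_norm_square) (simp add: algebra_simps)
    then show ?thesis by (simp only: of_real_eq_iff)
  qed
  finally show ?thesis by (auto intro: power2_le_imp_le)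
qed

text \<open>Divided by the product on the right this is |1 - phi_a(z) conj phi_a(w)| \<le> 2. The
  identity used is (1 - |a|^2)(1 - z conj w) = (1 - conj a z)(1 - a conj w) - (z - a) conj (w -
  a).\<close>

lemma one_minus_norm_square_mult_le:
  assumes "norm a \<le> 1" "norm z \<le> 1" "norm w \<le> 1"
  shows "(1 - (norm a)\<^sup>2) * norm (1 - z * cnj w) \<le> 2 * (norm (1 - cnj a * z) * norm (1 - a * cnj w))"
proof -
  have "(1 - of_real ((norm a)\<^sup>2)) * (1 - z * cnj w) = (1 - cnj a * z) * (1 - a * cnj w) - (z - a) * cnj (w - a)"
    unfolding complex_norm_square by (simp add: algebra_simps)
  then have "norm (1 - complex_of_real ((norm a)\<^sup>2)) * norm (1 - z * cnj w)
      = norm ((1 - cnj a * z) * (1 - a * cnj w) - (z - a) * cnj (w - a))"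
    by (simp only: norm_mult[symmetric])
  also have "\<dots> \<le> norm (1 - cnj a * z) * norm (1 - a * cnj w) + norm (z - a) * norm (w - a)"
    using norm_triangle_ineq4[of "(1 - cnj a * z) * (1 - a * cnj w)" "(z - a) * cnj (w - a)"]
    by (simp add: norm_mult del: complex_cnj_diff)
  also have "norm (z - a) * norm (w - a) \<le> norm (1 - cnj a * z) * norm (1 - a * cnj w)"
    using norm_diff_le_one_minus_cnj assms
    by (intro mult_mono) (auto simp: norm_one_minus_cnj_swap)
  also have "norm (1 - complex_of_real ((norm a)\<^sup>2)) = 1 - (norm a)\<^sup>2"
  proof -
    have "1 - complex_of_real ((norm a)\<^sup>2) = of_real (1 - (norm a)\<^sup>2)" by simp
    moreover have "0 \<le> 1 - (norm a)\<^sup>2" using assms by (simp add: power_le_one)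
    ultimately show ?thesis by (simp only: norm_of_real abs_of_nonneg)
  qed
  finally show ?thesis by (simp add: mult.commute)
qed

text \<open>
  Applying the reproducing formula to \<open>f'(w) / (1 - cnj a * w)\<close> instead of \<open>f'\<close> gives a kernel whose
  primitive in \<open>z\<close> vanishing at \<open>a\<close> is rational and conformally covariant; this replaces a change of
  variables by \<open>\<phi>\<^sub>a\<close>.
\<close>

definition increment_kernel :: "complex \<Rightarrow> complex \<Rightarrow> complex \<Rightarrow> complex" where
  "increment_kernel a z v = (z - a) / ((1 - z * v) * (1 - a * v)) *
     ((1 - cnj a * z) / (1 - z * v) + (1 - a * cnj a) / (1 - a * v))"

lemma increment_kernel_deriv:
  assumes z: "1 - z * v \<noteq> 0" and a: "1 - a * v \<noteq> 0"
  shows "((\<lambda>z. increment_kernel a z v) has_field_derivative 2 * (1 - cnj a * z) / (1 - z * v) ^ 3) (at z)"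
proof -
  define A where "A = cnj a"
  have d: "((\<lambda>z. 1 - z * v) has_field_derivative - v) (at z)"
    "((\<lambda>z. (z - a) * (1 - A * z)) has_field_derivative (1 - A * z) - A * (z - a)) (at z)"
    "((\<lambda>z. z - a) has_field_derivative 1) (at z)"
    "((\<lambda>z. (1 - z * v)\<^sup>2) has_field_derivative 2 * (1 - z * v) * - v) (at z)"
    by (auto intro!: derivative_eq_intros simp: algebra_simps)
  define X where "X = 1 - z * v"
  define Y where "Y = 1 - a * v"
  have XY0: "X \<noteq> 0" "Y \<noteq> 0" using z a by (simp_all add: X_def Y_def)
  have "((\<lambda>z. (z - a) * (1 - A * z) / (1 - z * v)\<^sup>2 / Y + (1 - a * A) * ((z - a) / (1 - z * v)) / Y\<^sup>2)
      has_field_derivative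
      (((1 - A * z) - A * (z - a)) * X\<^sup>2 - (z - a) * (1 - A * z) * (2 * X * - v)) / (X\<^sup>2 * X\<^sup>2) / Y
      + (1 - a * A) * ((1 * X - (z - a) * - v) / (X * X)) / Y\<^sup>2) (at z)"
    using z unfolding X_def
    by (intro DERIV_add DERIV_cdivide DERIV_cmult DERIV_divide d) auto
  moreover have "(((1 - A * z) - A * (z - a)) * X\<^sup>2 - (z - a) * (1 - A * z) * (2 * X * - v)) / (X\<^sup>2 * X\<^sup>2) / Y
      + (1 - a * A) * ((1 * X - (z - a) * - v) / (X * X)) / Y\<^sup>2 = 2 * (1 - A * z) / X ^ 3"
  proof -
    have XY: "1 * X - (z - a) * - v = Y" by (simp add: X_def Y_def algebra_simps)
    have "(((1 - A * z) - A * (z - a)) * X\<^sup>2 - (z - a) * (1 - A * z) * (2 * X * - v)) / (X\<^sup>2 * X\<^sup>2)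
      = (((1 - A * z) - A * (z - a)) * X + 2 * v * (z - a) * (1 - A * z)) / X ^ 3"
      using XY0 by (simp add: power2_eq_square power3_eq_cube field_simps)
    moreover have "(1 - a * A) * (Y / (X * X)) / Y\<^sup>2 = (1 - a * A) * X / X ^ 3 / Y"
      using XY0 by (simp add: power2_eq_square power3_eq_cube)
    \<comment> \<open>The cancellation behind the shape of the kernel: the numerators add up to a
      multiple of \<open>Y\<close>, so the poles at \<open>Y = 0\<close> disappear from the
      derivative.\<close>
    moreover have "((1 - A * z) - A * (z - a)) * X + 2 * v * (z - a) * (1 - A * z) + (1 - a * A) * X = 2 * (1 - A * z) * Y"
      by (simp add: X_def Y_def algebra_simps)
    ultimately show ?thesis unfolding XY using XY0
      by (simp add: add_divide_distrib[symmetric])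
  qed
  moreover have "increment_kernel a z v = (z - a) * (1 - A * z) / (1 - z * v)\<^sup>2 / Y + (1 - a * A) * ((z - a) / (1 - z * v)) / Y\<^sup>2" for z
    by (simp add: increment_kernel_def A_def Y_def power2_eq_square distrib_left mult_ac)
  ultimately show ?thesis by (simp add: X_def A_def)
qed

text \<open>With |z - a| \<le> |1 - conj a z|, the first summand of the kernel contributes 1 to the
  constant; the second contributes 2, after (1 - |a|^2) / Y is traded for 2 N / X by
  \<open>one_minus_norm_square_mult_le\<close>.\<close>

lemma norm_increment_kernel_le:
  assumes a: "norm a < 1" and z: "norm z < 1" and w: "norm w < 1"
  shows "norm (increment_kernel a z (cnj w)) \<le> 3 * (norm (1 - cnj a * z))\<^sup>2 / ((norm (1 - z * cnj w))\<^sup>2 * norm (1 - a * cnj w))"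
proof -
  define X where "X = norm (1 - z * cnj w)"
  define Y where "Y = norm (1 - a * cnj w)"
  define N where "N = norm (1 - cnj a * z)"
  have pos: "0 < X" "0 < Y" "0 < N"
    using one_minus_cnj_mult_nonzero a z w by (auto simp: X_def Y_def N_def)
  have "1 - a * cnj a = of_real (1 - (norm a)\<^sup>2)" using complex_norm_square[of a] by simp
  then have aa: "norm (1 - a * cnj a) = 1 - (norm a)\<^sup>2"
    using a by (simp only: norm_of_real) (simp add: power_le_one)
  have "norm (increment_kernel a z (cnj w)) \<le> norm (z - a) / (X * Y) * (N / X + (1 - (norm a)\<^sup>2) / Y)"
    unfolding increment_kernel_def norm_mult norm_divide X_def Y_def N_def
    using norm_triangle_ineq[of "(1 - cnj a * z) / (1 - z * cnj w)" "(1 - a * cnj a) / (1 - a * cnj w)"]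
    by (intro mult_left_mono) (auto simp: norm_divide aa)
  also have "\<dots> \<le> N / (X * Y) * (N / X + 2 * N / X)"
  proof (intro mult_mono add_mono divide_right_mono)
    show "norm (z - a) \<le> N" using norm_diff_le_one_minus_cnj a z by (simp add: N_def)
    have "(1 - (norm a)\<^sup>2) * X \<le> 2 * (N * Y)"
      using one_minus_norm_square_mult_le[of a z w] a z w by (simp add: X_def Y_def N_def)
    then show "(1 - (norm a)\<^sup>2) / Y \<le> 2 * N / X"
      using pos by (simp add: field_simps)
  qed (use pos a in \<open>auto simp: power_le_one\<close>)
  also have "\<dots> = 3 * N\<^sup>2 / (X\<^sup>2 * Y)" using pos by (simp add: power2_eq_square field_simps)
  finally show ?thesis by (simp add: X_def Y_def N_def)
qed

text \<open>The increment is the integral of f' along the segment from a to z. There f' is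
  represented through the reproducing formula for f'(w) / (1 - conj a w), the two integrations are
  exchanged, and the inner one is the increment of an explicit primitive that vanishes at a.\<close>

lemma increment_formula:
  assumes f: "f holomorphic_on ball 0 1" and a: "norm a < 1" and z: "norm z < 1"
    and int: "integrable disc_measure (\<lambda>w. deriv f w * (1 - (norm w)\<^sup>2))"
  shows "f z - f a = (\<integral>w. deriv f w * (1 - (norm w)\<^sup>2) / (1 - cnj a * w) * increment_kernel a z (cnj w) \<partial>disc_measure)"
proof -
  define q where "q w = deriv f w * (1 - (norm w)\<^sup>2) / (1 - cnj a * w)" for w
  define \<gamma> where "\<gamma> t = a + of_real t * (z - a)" for t
  \<comment> \<open>By convexity the whole segment stays in the closed disc of this radius, where
    the reproducing kernel is bounded; this justifies Fubini.\<close>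
  define \<rho> where "\<rho> = max (norm a) (norm z)"
  have \<rho>: "\<rho> < 1" "0 \<le> \<rho>" using a z by (auto simp: \<rho>_def max_def)
  have \<gamma>: "norm (\<gamma> t) \<le> \<rho>" if "t \<in> {0..1}" for t
  proof -
    have "\<gamma> t = (1 - t) *\<^sub>R a + t *\<^sub>R z" by (simp add: \<gamma>_def algebra_simps scaleR_conv_of_real)
    moreover have "(1 - t) *\<^sub>R a + t *\<^sub>R z \<in> cball 0 \<rho>"
      using that by (intro convexD[OF convex_cball]) (auto simp: \<rho>_def)
    ultimately show ?thesis by simp
  qed
  have \<gamma>1: "norm (\<gamma> t) < 1" if "t \<in> {0..1}" for t using \<gamma>[OF that] \<rho> by linarith
  have df: "deriv f holomorphic_on ball 0 1" by (rule holomorphic_deriv[OF f open_ball])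
  have ne: "1 - cnj a * w \<noteq> 0" if "norm w < 1" for w using one_minus_cnj_mult_nonzero(1)[OF a that] .
  have hol: "(\<lambda>w. deriv f w / (1 - cnj a * w)) holomorphic_on ball 0 1"
    using ne by (intro holomorphic_intros df) auto
  have q: "integrable disc_measure q"
  proof -
    have "integrable disc_measure (\<lambda>w. (deriv f w * (1 - (norm w)\<^sup>2)) * (1 / (1 - cnj a * w)))"
    proof (rule measurable_disc_complex_integrable_bound[OF int])
      show "(\<lambda>w. 1 / (1 - cnj a * w)) \<in> borel_measurable disc_measure"
        using ne by (intro measurable_disc_continuous continuous_intros) auto
      fix w :: complex assume w: "norm w < 1"
      then show "norm (1 / (1 - cnj a * w)) \<le> 1 / (1 - norm a)"
        using a one_minus_cnj_mult_lower[of w a] by (simp add: norm_divide frac_le)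
    qed
    then show ?thesis by (simp add: q_def[abs_def])
  qed
  define N where "N t w = (z - a) * (2 * (1 - cnj a * \<gamma> t) / (1 - \<gamma> t * cnj w) ^ 3)" for t w
  have lower: "1 - \<rho> \<le> norm (1 - \<gamma> t * cnj w)" if "t \<in> {0..1}" "norm w < 1" for t w
    using one_minus_cnj_mult_lower[of w "\<gamma> t"] that \<gamma>[of t] by (auto simp: norm_one_minus_cnj_swap)
  have Nle: "norm (N t w) \<le> 8 / (1 - \<rho>) ^ 3" if "t \<in> {0..1}" "norm w < 1" for t w
  proof -
    have "norm (N t w) = norm (z - a) * (2 * norm (1 - cnj a * \<gamma> t)) / norm (1 - \<gamma> t * cnj w) ^ 3"
      unfolding N_def norm_mult norm_divide norm_power by simp
    also have "\<dots> \<le> 2 * (2 * 2) / (1 - \<rho>) ^ 3"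
    proof (rule frac_le)
      show "norm (z - a) * (2 * norm (1 - cnj a * \<gamma> t)) \<le> 2 * (2 * 2)"
        using norm_triangle_ineq4[of z a] a z one_minus_cnj_mult_upper[of "\<gamma> t" a] \<gamma>1[OF that(1)]
        by (intro mult_mono) auto
      show "(1 - \<rho>) ^ 3 \<le> norm (1 - \<gamma> t * cnj w) ^ 3"
        using lower[OF that] \<rho> by (intro power_mono) auto
    qed (use \<rho> in auto)
    finally show ?thesis by simp
  qed
  interpret P: pair_sigma_finite unit_measure disc_measure
    by (intro pair_sigma_finite.intro unit.sigma_finite_measure_axioms disc.sigma_finite_measure_axioms)
  have qm [measurable]: "q \<in> borel_measurable disc_measure" by (rule borel_measurable_integrable[OF q])
  have Nm [measurable]: "(\<lambda>p. N (fst p) (snd p)) \<in> borel_measurable (unit_measure \<Otimes>\<^sub>M disc_measure)"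
    unfolding N_def \<gamma>_def by (rule measurable_unit_disc_borel) measurable
  have int2: "integrable (unit_measure \<Otimes>\<^sub>M disc_measure) (\<lambda>(t, w). q w * N t w)"
  proof (rule integrableI_bounded)
    have "(\<integral>\<^sup>+p. ennreal (norm (case p of (t, w) \<Rightarrow> q w * N t w)) \<partial>(unit_measure \<Otimes>\<^sub>M disc_measure))
      \<le> (\<integral>\<^sup>+p. ennreal (norm (q (snd p))) * ennreal (8 / (1 - \<rho>) ^ 3) \<partial>(unit_measure \<Otimes>\<^sub>M disc_measure))"
    proof (rule nn_integral_mono)
      fix p assume "p \<in> space (unit_measure \<Otimes>\<^sub>M disc_measure)"
      then have p: "fst p \<in> {0..1}" "norm (snd p) < 1" by (auto simp: space_pair_measure)
      show "ennreal (norm (case p of (t, w) \<Rightarrow> q w * N t w)) \<le> ennreal (norm (q (snd p))) * ennreal (8 / (1 - \<rho>) ^ 3)"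
        using mult_left_mono[OF Nle[OF p], of "norm (q (snd p))"] \<rho>
        by (simp add: norm_mult split_beta flip: ennreal_mult)
    qed
    also have "\<dots> = (\<integral>\<^sup>+t. \<integral>\<^sup>+w. ennreal (norm (q w)) * ennreal (8 / (1 - \<rho>) ^ 3) \<partial>disc_measure \<partial>unit_measure)"
      by (subst disc.nn_integral_fst[symmetric]) auto
    also have "\<dots> < \<infinity>"
      using q unfolding integrable_iff_bounded by (simp add: nn_integral_multc ennreal_mult_less_top)
    finally show "(\<integral>\<^sup>+p. ennreal (norm (case p of (t, w) \<Rightarrow> q w * N t w)) \<partial>(unit_measure \<Otimes>\<^sub>M disc_measure)) < \<infinity>" .
  qed (simp add: split_beta)
  have cg: "continuous_on {0..1} \<gamma>" unfolding \<gamma>_def by (intro continuous_intros)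
  have dg: "(\<gamma> has_vector_derivative (z - a)) (at t within {0..1})" for t
    unfolding \<gamma>_def by (auto intro!: derivative_eq_intros has_vector_derivative_mult_left has_vector_derivative_of_real)
  have "(\<integral>t. (z - a) * deriv f (\<gamma> t) \<partial>unit_measure) = f z - f a"
  proof (rule integral_unit_measure(2))
    show "continuous_on {0..1} (\<lambda>t. (z - a) * deriv f (\<gamma> t))"
      by (intro continuous_intros continuous_on_compose2[OF holomorphic_on_imp_continuous_on[OF df] cg])
         (use \<gamma>1 in auto)
    have "((\<lambda>t. (z - a) * deriv f (\<gamma> t)) has_integral (f (\<gamma> 1) - f (\<gamma> 0))) {0..1}"
    proof (rule fundamental_theorem_of_calculus)
      fix t :: real assume t: "t \<in> {0..1}"
      have "(f has_field_derivative deriv f (\<gamma> t)) (at (\<gamma> t))"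
        using holomorphic_derivI[OF f open_ball] \<gamma>1[OF t] by auto
      from field_vector_diff_chain_within[OF dg has_field_derivative_at_within[OF this]]
      show "((\<lambda>t. f (\<gamma> t)) has_vector_derivative (z - a) * deriv f (\<gamma> t)) (at t within {0..1})"
        by (simp add: o_def)
    qed simp
    then show "((\<lambda>t. (z - a) * deriv f (\<gamma> t)) has_integral (f z - f a)) {0..1}" by (simp add: \<gamma>_def)
  qed
  also have "(\<integral>t. (z - a) * deriv f (\<gamma> t) \<partial>unit_measure) = (\<integral>t. (\<integral>w. q w * N t w \<partial>disc_measure) \<partial>unit_measure)"
  proof (rule Bochner_Integration.integral_cong[OF refl])
    fix t assume "t \<in> space unit_measure"
    then have t: "t \<in> {0..1}" by auto
    have q': "integrable disc_measure (\<lambda>w. deriv f w / (1 - cnj a * w) * (1 - (norm w)\<^sup>2))"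
      using q by (simp add: q_def[abs_def])
    \<comment> \<open>Multiplying and dividing by 1 - conj a \<gamma>(t) brings in the value at
      \<gamma>(t) of the function to which the reproducing formula is applied.\<close>
    have "(z - a) * deriv f (\<gamma> t) = 2 * (z - a) * (1 - cnj a * \<gamma> t) * (deriv f (\<gamma> t) / (1 - cnj a * \<gamma> t) / 2)"
    proof -
      have "u * d = 2 * u * c * (d / c / 2)" if "c \<noteq> 0" for u d c :: complex
        using that by simp
      then show ?thesis using ne[OF \<gamma>1[OF t]] .
    qed
    also have "\<dots> = 2 * (z - a) * (1 - cnj a * \<gamma> t) * (\<integral>w. deriv f w / (1 - cnj a * w) * (1 - (norm w)\<^sup>2) / (1 - \<gamma> t * cnj w) ^ 3 \<partial>disc_measure)"
      by (simp only: Bergman_reproducing(1)[OF hol \<gamma>1[OF t] q'])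
    also have "\<dots> = (\<integral>w. 2 * (z - a) * (1 - cnj a * \<gamma> t) * (deriv f w / (1 - cnj a * w) * (1 - (norm w)\<^sup>2) / (1 - \<gamma> t * cnj w) ^ 3) \<partial>disc_measure)"
      by (rule integral_mult_right_zero[symmetric])
    also have "\<dots> = (\<integral>w. q w * N t w \<partial>disc_measure)"
    proof -
      have "2 * u * c * (d / e * k / D) = d * k / e * (u * (2 * c / D))" for u c d e k D :: complex
        by simp
      then show ?thesis unfolding q_def N_def by (simp only:)
    qed
    finally show "(z - a) * deriv f (\<gamma> t) = (\<integral>w. q w * N t w \<partial>disc_measure)" .
  qed
  also have "\<dots> = (\<integral>w. (\<integral>t. q w * N t w \<partial>unit_measure) \<partial>disc_measure)"
    by (rule P.Fubini_integral[symmetric]) (rule int2)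
  also have "\<dots> = (\<integral>w. q w * increment_kernel a z (cnj w) \<partial>disc_measure)"
  proof (rule Bochner_Integration.integral_cong[OF refl])
    fix w assume "w \<in> space disc_measure"
    then have w: "norm w < 1" by simp
    have ne': "1 - x * cnj w \<noteq> 0" if "norm x < 1" for x using one_minus_cnj_mult_nonzero(2)[OF that w] .
    have "(\<integral>t. N t w \<partial>unit_measure) = increment_kernel a z (cnj w)"
    proof (rule integral_unit_measure(2))
      show "continuous_on {0..1} (\<lambda>t. N t w)"
        unfolding N_def using ne' \<gamma>1 by (intro continuous_intros cg) auto
      have "((\<lambda>t. N t w) has_integral (increment_kernel a (\<gamma> 1) (cnj w) - increment_kernel a (\<gamma> 0) (cnj w))) {0..1}"
      proof (rule fundamental_theorem_of_calculus)
        fix t :: real assume t: "t \<in> {0..1}"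
        from field_vector_diff_chain_within[OF dg has_field_derivative_at_within[OF increment_kernel_deriv[OF ne'[OF \<gamma>1[OF t]] ne'[OF a]]]]
        show "((\<lambda>t. increment_kernel a (\<gamma> t) (cnj w)) has_vector_derivative N t w) (at t within {0..1})"
          by (simp add: o_def N_def)
      qed simp
      then show "((\<lambda>t. N t w) has_integral increment_kernel a z (cnj w)) {0..1}"
        by (simp add: \<gamma>_def increment_kernel_def)
    qed
    then show "(\<integral>t. q w * N t w \<partial>unit_measure) = q w * increment_kernel a z (cnj w)" by simp
  qed
  finally show ?thesis by (simp add: q_def)
qed

text \<open>Integrability can be left unchecked: in its absence the Bochner integral is 0 by
  convention.\<close>

lemma norm_integral_le_nn_integral:
  fixes F :: "'a \<Rightarrow> 'b::{banach, second_countable_topology}"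
  shows "ennreal (norm (\<integral>x. F x \<partial>M)) \<le> (\<integral>\<^sup>+x. ennreal (norm (F x)) \<partial>M)"
proof (cases "integrable M F")
  case True
  then show ?thesis by (rule integral_norm_bound_ennreal)
next
  case False
  then show ?thesis by (simp add: not_integrable_integral_eq)
qed

text \<open>A regrouping of the kernel bound: its N^2 cancels the denominator of
  \<open>kern a z\<close>, the freed 1 - |a|^2 with Y^2 forms \<open>kern a w\<close>, and the
  Bergman weight 1 - |w|^2 with X^2 forms \<open>kern w z\<close>.\<close>

lemma increment_kern_le:
  assumes f: "f holomorphic_on ball 0 1" and a: "norm a < 1" and z: "norm z < 1"
    and int: "integrable disc_measure (\<lambda>w. deriv f w * (1 - (norm w)\<^sup>2))"
  shows "ennreal (norm (f z - f a) * kern a z) \<le>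
    (\<integral>\<^sup>+w. ennreal (3 * norm (deriv f w) * kern a w * kern w z) \<partial>disc_measure)"
proof -
  have K: "0 \<le> kern a z" using a by (intro kern_nonneg) simp
  have "ennreal (norm (f z - f a) * kern a z)
     = ennreal (norm (\<integral>w. kern a z * (deriv f w * (1 - (norm w)\<^sup>2) / (1 - cnj a * w) * increment_kernel a z (cnj w)) \<partial>disc_measure))"
    unfolding increment_formula[OF f a z int] integral_mult_right_zero norm_mult using K by (simp add: mult.commute)
  also have "\<dots> \<le> (\<integral>\<^sup>+w. ennreal (norm (kern a z * (deriv f w * (1 - (norm w)\<^sup>2) / (1 - cnj a * w) * increment_kernel a z (cnj w)))) \<partial>disc_measure)"
    by (rule norm_integral_le_nn_integral)
  also have "\<dots> \<le> (\<integral>\<^sup>+w. ennreal (3 * norm (deriv f w) * kern a w * kern w z) \<partial>disc_measure)"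
  proof (intro nn_integral_mono ennreal_leI)
    fix w assume "w \<in> space disc_measure"
    then have w: "norm w < 1" by simp
    have sq: "norm (1 - complex_of_real (norm w) ^ 2) = 1 - (norm w)\<^sup>2" "0 \<le> 1 - (norm w)\<^sup>2" "0 \<le> 1 - (norm a)\<^sup>2"
    proof -
      show nn: "0 \<le> 1 - (norm w)\<^sup>2" "0 \<le> 1 - (norm a)\<^sup>2" using w a by (auto simp: power_le_one)
      have "1 - complex_of_real (norm w) ^ 2 = of_real (1 - (norm w)\<^sup>2)" by simp
      then show "norm (1 - complex_of_real (norm w) ^ 2) = 1 - (norm w)\<^sup>2"
        using nn by (simp only: norm_of_real abs_of_nonneg)
    qed
    define N where "N = norm (1 - cnj a * z)"
    define X where "X = norm (1 - cnj w * z)"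
    define Y where "Y = norm (1 - cnj a * w)"
    have swap: "norm (1 - z * cnj w) = X" "norm (1 - a * cnj w) = Y"
      unfolding X_def Y_def by (simp add: mult.commute) (rule norm_one_minus_cnj_swap)
    have pos: "0 < N" "0 < X" "0 < Y"
      using one_minus_cnj_mult_nonzero a z w by (auto simp: X_def Y_def N_def)
    have "norm (kern a z * (deriv f w * (1 - (norm w)\<^sup>2) / (1 - cnj a * w) * increment_kernel a z (cnj w)))
      = kern a z * (norm (deriv f w) * (1 - (norm w)\<^sup>2) / Y) * norm (increment_kernel a z (cnj w))"
      using K by (simp add: norm_mult norm_divide sq Y_def)
    also have "\<dots> \<le> kern a z * (norm (deriv f w) * (1 - (norm w)\<^sup>2) / Y) * (3 * N\<^sup>2 / (X\<^sup>2 * Y))"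
      using norm_increment_kernel_le[OF a z w] K pos sq
      by (intro mult_left_mono) (auto simp: N_def swap)
    also have "\<dots> = 3 * norm (deriv f w) * kern a w * kern w z"
    proof -
      have "A / N\<^sup>2 * (d * B / Y) * (3 * N\<^sup>2 / (X\<^sup>2 * Y)) = 3 * d * (A / Y\<^sup>2) * (B / X\<^sup>2)" for A B d
        using pos by (simp add: power2_eq_square mult_ac)
      then show ?thesis unfolding kern_def N_def X_def Y_def .
    qed
    finally show "norm (kern a z * (deriv f w * (1 - (norm w)\<^sup>2) / (1 - cnj a * w) * increment_kernel a z (cnj w)))
      \<le> 3 * norm (deriv f w) * kern a w * kern w z" .
  qed
  finally show ?thesis .
qed

section \<open>Growth of functions of bounded mean oscillation\<close>

abbreviation energy_density :: "(complex \<Rightarrow> complex) \<Rightarrow> complex \<Rightarrow> complex \<Rightarrow> ennreal" where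
  "energy_density f a z \<equiv> ennreal ((norm (deriv f z))\<^sup>2 * (1 - (norm z)\<^sup>2) * kern a z)"

text \<open>A ball of BMOA, up to constants, with its bounds stated in \<open>ennreal\<close>: this
  avoids the conversion inside \<open>BMOA_norm\<close>, passes to locally uniform limits with the
  same constant, and strict positivity allows division by \<open>A\<close>.\<close>

definition bmoa_bound :: "(complex \<Rightarrow> complex) \<Rightarrow> real \<Rightarrow> bool" where
  "bmoa_bound f A \<longleftrightarrow> f holomorphic_on ball 0 1 \<and> 0 < A \<and> norm (f 0) \<le> A \<and>
     (\<forall>a. norm a < 1 \<longrightarrow>
       (\<integral>\<^sup>+z. energy_density f a z \<partial>disc_measure) \<le> ennreal (A\<^sup>2))"

lemma bmoa_boundD:
  assumes "bmoa_bound f A"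
  shows "f holomorphic_on ball 0 1" "0 < A" "norm (f 0) \<le> A"
    "norm a < 1 \<Longrightarrow> (\<integral>\<^sup>+z. energy_density f a z \<partial>disc_measure) \<le> ennreal (A\<^sup>2)"
  using assms by (auto simp: bmoa_bound_def)

lemma measurable_disc_deriv:
  "f holomorphic_on ball 0 1 \<Longrightarrow> deriv f \<in> borel_measurable disc_measure"
  by (intro measurable_disc_continuous holomorphic_on_imp_continuous_on holomorphic_deriv) auto

lemma measurable_disc_holomorphic:
  "f holomorphic_on ball 0 1 \<Longrightarrow> f \<in> borel_measurable disc_measure"
  by (intro measurable_disc_continuous holomorphic_on_imp_continuous_on)

lemma measurable_energy_density:
  assumes "f holomorphic_on ball 0 1"
  shows "energy_density f a \<in> borel_measurable disc_measure"
proof -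
  note [measurable] = measurable_disc_deriv[OF assms]
  have [measurable]: "(\<lambda>z. 1 - (norm z)\<^sup>2) \<in> borel_measurable disc_measure" "kern a \<in> borel_measurable disc_measure"
    by (rule measurable_disc_borel, measurable)+
  show ?thesis by measurable
qed

lemma one_minus_norm_square_pos: "norm z < 1 \<Longrightarrow> 0 < 1 - (norm (z::complex))\<^sup>2"
  by (simp add: power_less_one_iff)

lemma kern_0 [simp]: "kern 0 z = 1"
  by (simp add: kern_def)

lemma log_weight_ge: "norm z < 1 \<Longrightarrow> 1 / 2 \<le> log_weight z"
proof -
  assume "norm z < 1"
  then have z: "0 < 1 - (norm z)\<^sup>2" by (rule one_minus_norm_square_pos)
  have "1 / 2 \<le> ln (2::real)" using ln2_ge_two_thirds by simp
  also have "\<dots> \<le> log_weight z" unfolding log_weight_def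
    using z by (subst ln_le_cancel_iff) (auto simp: field_simps)
  finally show ?thesis .
qed

text \<open>Supplies the hypothesis of the reproducing formula for f'. Only base point 0 enters,
  where the kernel is 1, together with x \<le> x^2 + 1 and the finite total mass.\<close>

lemma bmoa_bound_integrable:
  assumes f: "bmoa_bound f A"
  shows "integrable disc_measure (\<lambda>w. deriv f w * (1 - (norm w)\<^sup>2))"
proof (rule integrableI_bounded)
  note [measurable] = measurable_disc_deriv[OF bmoa_boundD(1)[OF f]]
  have m [measurable]: "(\<lambda>w. 1 - complex_of_real (norm w) ^ 2) \<in> borel_measurable disc_measure"
    "(\<lambda>w. 1 - (norm w)\<^sup>2) \<in> borel_measurable disc_measure" "kern 0 \<in> borel_measurable disc_measure"
    by (rule measurable_disc_borel, measurable)+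
  show "(\<lambda>w. deriv f w * (1 - (norm w)\<^sup>2)) \<in> borel_measurable disc_measure"
    by simp
  have "(\<integral>\<^sup>+w. ennreal (norm (deriv f w * (1 - (norm w)\<^sup>2))) \<partial>disc_measure)
     \<le> (\<integral>\<^sup>+w. energy_density f 0 w + 1 \<partial>disc_measure)"
  proof (rule nn_integral_mono)
    fix w assume "w \<in> space disc_measure"
    then have w: "0 < 1 - (norm w)\<^sup>2" "1 - (norm w)\<^sup>2 \<le> 1" using one_minus_norm_square_pos[of w] by auto
    have "1 - complex_of_real (norm w) ^ 2 = of_real (1 - (norm w)\<^sup>2)" by simp
    then have "norm (deriv f w * (1 - (norm w)\<^sup>2)) = norm (deriv f w) * (1 - (norm w)\<^sup>2)"
      using w by (simp only: norm_mult norm_of_real abs_of_pos)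
    also have "\<dots> \<le> ((norm (deriv f w))\<^sup>2 + 1) * (1 - (norm w)\<^sup>2)"
    proof (rule mult_right_mono)
      show "norm (deriv f w) \<le> (norm (deriv f w))\<^sup>2 + 1"
        using sum_squares_bound[of "norm (deriv f w)" 1] norm_ge_zero[of "deriv f w"]
        unfolding power_one mult_1_right by linarith
    qed (use w in simp)
    also have "\<dots> \<le> (norm (deriv f w))\<^sup>2 * (1 - (norm w)\<^sup>2) * kern 0 w + 1"
      using w by (simp add: distrib_right)
    finally have "ennreal (norm (deriv f w * (1 - (norm w)\<^sup>2))) \<le> ennreal ((norm (deriv f w))\<^sup>2 * (1 - (norm w)\<^sup>2) * kern 0 w + 1)"
      by (rule ennreal_leI)
    moreover have "0 \<le> (norm (deriv f w))\<^sup>2 * (1 - (norm w)\<^sup>2) * kern 0 w"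
      unfolding kern_0 by (intro mult_nonneg_nonneg less_imp_le[OF w(1)]) auto
    ultimately show "ennreal (norm (deriv f w * (1 - (norm w)\<^sup>2))) \<le> energy_density f 0 w + 1"
      by (subst (asm) ennreal_plus) auto
  qed
  also have "\<dots> = (\<integral>\<^sup>+w. energy_density f 0 w \<partial>disc_measure) + 1"
    by (subst nn_integral_add) auto
  also have "\<dots> < \<infinity>"
    using bmoa_boundD(4)[OF f, of 0] by (auto simp: ennreal_add_less_top intro: le_less_trans)
  finally show "(\<integral>\<^sup>+w. ennreal (norm (deriv f w * (1 - (norm w)\<^sup>2))) \<partial>disc_measure) < \<infinity>" .
qed

text \<open>BMOA functions are Bloch functions. In the reproducing formula for f'(a) the integrand
  is split by 2xy \<le> x^2 + y^2 into the energy at \<open>a\<close>, at most A^2, and A^2 times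
  the two-kernel integral, at most 4 A^2.\<close>

lemma bmoa_bound_deriv:
  assumes f: "bmoa_bound f A" and a: "norm a < 1"
  shows "norm (deriv f a) * (1 - (norm a)\<^sup>2) \<le> 5 * A"
proof -
  note D = bmoa_boundD[OF f]
  note [measurable] = measurable_disc_deriv[OF D(1)]
  have A: "0 < A" by (rule D)
  have asq: "0 < 1 - (norm a)\<^sup>2" by (rule one_minus_norm_square_pos[OF a])
  have [measurable]: "(\<lambda>w. 1 - (norm w)\<^sup>2) \<in> borel_measurable disc_measure" "kern b \<in> borel_measurable disc_measure"
    "(\<lambda>w. ennreal ((1 - (norm w)\<^sup>2) * kern a w / (norm (1 - cnj a * w))\<^sup>2)) \<in> borel_measurable disc_measure" for b
    by (rule measurable_disc_borel, measurable)+
  \<comment> \<open>This multiple makes the integrand exactly the cross term 2xy with x = |f'(w)| /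
    X and y = A / X^2, both weighted by (1 - |a|^2)(1 - |w|^2).\<close>
  define c where "c = 2 * A * (1 - (norm a)\<^sup>2)"
  have c: "0 < c" using A asq by (simp add: c_def)
  have hd: "deriv f holomorphic_on ball 0 1" by (rule holomorphic_deriv[OF D(1) open_ball])
  have "ennreal (c * norm (deriv f a) / 2) = ennreal (norm (complex_of_real c * (deriv f a / 2)))"
    using c by (simp add: norm_mult norm_divide)
  also have "complex_of_real c * (deriv f a / 2) = (\<integral>w. of_real c * (deriv f w * (1 - (norm w)\<^sup>2) / (1 - a * cnj w) ^ 3) \<partial>disc_measure)"
    by (simp only: integral_mult_right_zero Bergman_reproducing(1)[OF hd a bmoa_bound_integrable[OF f]])
  also have "ennreal (norm \<dots>) \<le> (\<integral>\<^sup>+w. ennreal (norm (of_real c * (deriv f w * (1 - (norm w)\<^sup>2) / (1 - a * cnj w) ^ 3))) \<partial>disc_measure)"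
    by (rule norm_integral_le_nn_integral)
  also have "\<dots> \<le> (\<integral>\<^sup>+w. energy_density f a w + ennreal (A\<^sup>2) * ennreal ((1 - (norm w)\<^sup>2) * kern a w / (norm (1 - cnj a * w))\<^sup>2) \<partial>disc_measure)"
  proof (rule nn_integral_mono)
    fix w assume "w \<in> space disc_measure"
    then have w1: "norm w < 1" by simp
    then have w: "0 < 1 - (norm w)\<^sup>2" by (rule one_minus_norm_square_pos)
    define X where "X = norm (1 - cnj a * w)"
    define d where "d = norm (deriv f w)"
    have X: "0 < X" using one_minus_cnj_mult_nonzero(1)[OF a w1] by (simp add: X_def)
    have swap: "norm (1 - a * cnj w) = X" unfolding X_def by (rule norm_one_minus_cnj_swap)
    have "1 - complex_of_real (norm w) ^ 2 = of_real (1 - (norm w)\<^sup>2)" by simp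
    then have "norm (of_real c * (deriv f w * (1 - (norm w)\<^sup>2) / (1 - a * cnj w) ^ 3)) = c * (d * (1 - (norm w)\<^sup>2) / X ^ 3)"
      using w c by (simp only: norm_mult norm_divide norm_power norm_of_real abs_of_pos swap d_def)
    also have "\<dots> = (1 - (norm a)\<^sup>2) * (1 - (norm w)\<^sup>2) * (2 * (d / X) * (A / X\<^sup>2))"
    proof -
      have "2 * A * u * (d * v / X ^ 3) = u * v * (2 * (d / X) * (A / X\<^sup>2))" for u v
        using X by (simp add: power2_eq_square power3_eq_cube mult_ac)
      then show ?thesis unfolding c_def .
    qed
    also have "\<dots> \<le> (1 - (norm a)\<^sup>2) * (1 - (norm w)\<^sup>2) * ((d / X)\<^sup>2 + (A / X\<^sup>2)\<^sup>2)"
      using w asq sum_squares_bound[of "d / X" "A / X\<^sup>2"] by (intro mult_left_mono) auto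
    also have "\<dots> = d\<^sup>2 * (1 - (norm w)\<^sup>2) * kern a w + A\<^sup>2 * ((1 - (norm w)\<^sup>2) * kern a w / X\<^sup>2)"
      unfolding kern_def X_def[symmetric] by (simp add: power2_eq_square distrib_left mult_ac)
    finally have "ennreal (norm (of_real c * (deriv f w * (1 - (norm w)\<^sup>2) / (1 - a * cnj w) ^ 3)))
      \<le> ennreal (d\<^sup>2 * (1 - (norm w)\<^sup>2) * kern a w + A\<^sup>2 * ((1 - (norm w)\<^sup>2) * kern a w / X\<^sup>2))"
      by (rule ennreal_leI)
    also have "\<dots> = ennreal (d\<^sup>2 * (1 - (norm w)\<^sup>2) * kern a w) + ennreal (A\<^sup>2) * ennreal ((1 - (norm w)\<^sup>2) * kern a w / X\<^sup>2)"
    proof -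
      have "ennreal (x + A\<^sup>2 * y) = ennreal x + ennreal (A\<^sup>2) * ennreal y" if "0 \<le> x" "0 \<le> y" for x y
        using that by (simp add: ennreal_mult')
      moreover have "0 \<le> kern a w" using a by (intro kern_nonneg) simp
      with w have "0 \<le> d\<^sup>2 * (1 - (norm w)\<^sup>2) * kern a w" "0 \<le> (1 - (norm w)\<^sup>2) * kern a w / X\<^sup>2"
        by auto
      ultimately show ?thesis by blast
    qed
    finally show "ennreal (norm (of_real c * (deriv f w * (1 - (norm w)\<^sup>2) / (1 - a * cnj w) ^ 3)))
      \<le> energy_density f a w + ennreal (A\<^sup>2) * ennreal ((1 - (norm w)\<^sup>2) * kern a w / (norm (1 - cnj a * w))\<^sup>2)"
      by (simp add: d_def X_def)
  qed
  also have "\<dots> = (\<integral>\<^sup>+w. energy_density f a w \<partial>disc_measure)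
     + ennreal (A\<^sup>2) * (\<integral>\<^sup>+w. ennreal ((1 - (norm w)\<^sup>2) * kern a w / (norm (1 - cnj a * w))\<^sup>2) \<partial>disc_measure)"
    by (subst nn_integral_add) (auto simp: nn_integral_cmult)
  also have "\<dots> \<le> ennreal (A\<^sup>2) + ennreal (A\<^sup>2) * 4"
    by (intro add_mono mult_left_mono nn_integral_two_kernels a D(4)) auto
  also have "\<dots> = ennreal (5 * A\<^sup>2)"
  proof -
    have "ennreal (A\<^sup>2) + ennreal (A\<^sup>2) * ennreal 4 = ennreal (A\<^sup>2 + A\<^sup>2 * 4)"
      by (subst ennreal_plus) (simp_all add: ennreal_mult' del: ennreal_numeral)
    then show ?thesis by (simp add: mult.commute)
  qed
  finally have "c * norm (deriv f a) / 2 \<le> 5 * A\<^sup>2"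
    by (subst (asm) ennreal_le_iff) auto
  then have "A * (norm (deriv f a) * (1 - (norm a)\<^sup>2)) \<le> A * (5 * A)"
    by (simp add: c_def power2_eq_square algebra_simps)
  then show ?thesis using A by (simp only: mult_le_cancel_left_pos)
qed

text \<open>Integrating the Bloch bound along the radius gives 5 A ln (1 / (1 - |a|)), and the value
  at 0 costs at most A \<le> 2 A \<open>log_weight a\<close>; hence 7.\<close>

lemma bmoa_bound_growth:
  assumes f: "bmoa_bound f A" and a: "norm a < 1"
  shows "norm (f a) \<le> 7 * A * log_weight a"
proof -
  note D = bmoa_boundD[OF f]
  define r where "r = norm a"
  have r: "0 \<le> r" "r < 1" using a by (auto simp: r_def)
  have tr: "t * r < 1" if "t \<in> {0..1}" for t using that r by (auto intro: le_less_trans[OF mult_left_le_one_le])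
  have ta: "norm (of_real t * a) < 1" if "t \<in> {0..1}" for t
    using tr[OF that] that by (simp add: norm_mult r_def)
  have "((\<lambda>t. a * deriv f (of_real t * a)) has_integral (f (of_real 1 * a) - f (of_real 0 * a))) {0..1}"
  proof (rule fundamental_theorem_of_calculus)
    fix t :: real assume t: "t \<in> {0..1}"
    have "(f has_field_derivative deriv f (of_real t * a)) (at (of_real t * a))"
      using holomorphic_derivI[OF D(1) open_ball] ta[OF t] by auto
    moreover have "((\<lambda>t. of_real t * a) has_vector_derivative (1 * a)) (at t within {0..1})"
      using has_vector_derivative_mult_left[OF has_vector_derivative_of_real[OF DERIV_ident]] by simp
    ultimately show "((\<lambda>t. f (of_real t * a)) has_vector_derivative a * deriv f (of_real t * a)) (at t within {0..1})"
      using field_vector_diff_chain_within[of "\<lambda>t. of_real t * a" a t "{0..1}" f "deriv f (of_real t * a)"]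
      by (auto simp: o_def intro: has_field_derivative_at_within)
  qed simp
  then have 1: "((\<lambda>t. a * deriv f (of_real t * a)) has_integral (f a - f 0)) {0..1}" by simp
  have "((\<lambda>t. 5 * A * r / (1 - t * r)) has_integral (- (5 * A) * ln (1 - 1 * r) - - (5 * A) * ln (1 - 0 * r))) {0..1}"
  proof (rule fundamental_theorem_of_calculus)
    fix t :: real assume t: "t \<in> {0..1}"
    show "((\<lambda>t. - (5 * A) * ln (1 - t * r)) has_vector_derivative 5 * A * r / (1 - t * r)) (at t within {0..1})"
      using tr[OF t] unfolding has_real_derivative_iff_has_vector_derivative[symmetric]
      by (auto intro!: derivative_eq_intros simp: field_simps)
  qed simp
  then have 2: "((\<lambda>t. 5 * A * r / (1 - t * r)) has_integral (- (5 * A) * ln (1 - r))) {0..1}" by simp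
  have "norm (f a - f 0) \<le> - (5 * A) * ln (1 - r)"
  proof (rule integral_norm_bound_integral[OF has_integral_integrable[OF 1] has_integral_integrable[OF 2], unfolded integral_unique[OF 1] integral_unique[OF 2]])
    fix t :: real assume t: "t \<in> {0..1}"
    have "norm (deriv f (of_real t * a)) * (1 - (t * r)\<^sup>2) \<le> 5 * A"
      using bmoa_bound_deriv[OF f ta[OF t]] t by (simp add: norm_mult r_def)
    moreover have "1 - t * r \<le> 1 - (t * r)\<^sup>2"
      using tr[OF t] t r by (simp add: power2_eq_square mult_left_le)
    ultimately have "norm (deriv f (of_real t * a)) * (1 - t * r) \<le> 5 * A"
      by (meson mult_left_mono norm_ge_zero order_trans)
    then have "norm (deriv f (of_real t * a)) \<le> 5 * A / (1 - t * r)"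
      using tr[OF t] by (simp add: field_simps)
    then have "r * norm (deriv f (of_real t * a)) \<le> r * (5 * A / (1 - t * r))"
      using r by (intro mult_left_mono)
    then show "norm (a * deriv f (of_real t * a)) \<le> 5 * A * r / (1 - t * r)"
      by (simp add: norm_mult r_def mult_ac)
  qed
  moreover have "- ln (1 - r) \<le> log_weight a"
  proof -
    have rr: "0 < 1 - r\<^sup>2" "0 < 1 - r" using one_minus_norm_square_pos[OF a] r by (simp_all add: r_def)
    have "1 / (1 - r) \<le> 2 / (1 - r\<^sup>2)"
    proof -
      have "1 - r\<^sup>2 = (1 - r) * (1 + r)" by (simp add: power2_eq_square algebra_simps)
      also have "\<dots> \<le> (1 - r) * 2" using r by (intro mult_left_mono) auto
      finally show ?thesis using rr by (simp add: field_simps)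
    qed
    then have "ln (1 / (1 - r)) \<le> ln (2 / (1 - r\<^sup>2))" using rr by (subst ln_le_cancel_iff) auto
    then show ?thesis using rr by (simp add: log_weight_def r_def ln_div)
  qed
  ultimately have "norm (f a - f 0) \<le> 5 * A * log_weight a"
    using mult_left_mono[of "- ln (1 - r)" "log_weight a" "5 * A"] D(2) by simp
  moreover have "A * 1 \<le> A * (2 * log_weight a)"
    using log_weight_ge[OF a] D(2) by (intro mult_left_mono) auto
  moreover have "norm (f a) \<le> norm (f a - f 0) + norm (f 0)"
    using norm_triangle_ineq[of "f a - f 0" "f 0"] by simp
  ultimately show ?thesis using D(3) by simp
qed

text \<open>
  The logarithmic gain in the hypothesis makes the last integral in this estimate converge, so that
  the Carleson embedding theorem for Hardy spaces is not needed.
\<close>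

lemma log_Carleson_embedding:
  assumes f: "bmoa_bound f A" and \<psi> [measurable]: "\<psi> \<in> borel_measurable disc_measure" and \<Lambda>: "0 \<le> \<Lambda>"
    and test: "\<And>w. norm w < 1 \<Longrightarrow> (\<integral>\<^sup>+z. ennreal (kern w z) * \<psi> z \<partial>disc_measure) \<le> ennreal (\<Lambda> / log_weight w)"
    and a: "norm a < 1"
  shows "(\<integral>\<^sup>+z. ennreal (norm (f z) * kern a z) * \<psi> z \<partial>disc_measure) \<le> ennreal (12 * \<Lambda> * A)"
proof -
  note D = bmoa_boundD[OF f]
  note [measurable] = measurable_disc_deriv[OF D(1)] measurable_disc_holomorphic[OF D(1)]
  have A: "0 < A" by (rule D)
  have [measurable]: "(\<lambda>w. 1 - (norm w)\<^sup>2) \<in> borel_measurable disc_measure" "kern b \<in> borel_measurable disc_measure"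
     "(\<lambda>z. ennreal (kern a z / ((1 - (norm z)\<^sup>2) * (log_weight z)\<^sup>2))) \<in> borel_measurable disc_measure" for b
    unfolding log_weight_def by (rule measurable_disc_borel, measurable)+
  have [measurable]: "(\<lambda>p. kern (snd p) (fst p)) \<in> borel_measurable (disc_measure \<Otimes>\<^sub>M disc_measure)"
    "(\<lambda>p. kern (fst p) (snd p)) \<in> borel_measurable (disc_measure \<Otimes>\<^sub>M disc_measure)"
    unfolding kern_def by (rule measurable_disc_pair_borel, measurable)+
  have K: "0 \<le> kern b z" if "norm b < 1" for b z using that by (intro kern_nonneg) simp
  interpret P: pair_sigma_finite disc_measure disc_measure
    by (intro pair_sigma_finite.intro disc.sigma_finite_measure_axioms)
  let ?J = "\<lambda>z. \<integral>\<^sup>+w. ennreal (3 * norm (deriv f w) * kern a w * kern w z) \<partial>disc_measure"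
  have Jm [measurable]: "?J \<in> borel_measurable disc_measure"
  proof (rule disc.borel_measurable_nn_integral)
    have "(\<lambda>p. ennreal (3 * norm (deriv f (snd p)) * kern a (snd p) * kern (snd p) (fst p))) \<in> borel_measurable (disc_measure \<Otimes>\<^sub>M disc_measure)"
      by measurable
    then show "(\<lambda>(z, w). ennreal (3 * norm (deriv f w) * kern a w * kern w z)) \<in> borel_measurable (disc_measure \<Otimes>\<^sub>M disc_measure)"
      by (simp add: split_beta')
  qed
  have L: "0 < log_weight w" if "norm w < 1" for w using log_weight_ge[OF that] by simp
  have split: "(\<integral>\<^sup>+z. ennreal (norm (f z) * kern a z) * \<psi> z \<partial>disc_measure)
     \<le> (\<integral>\<^sup>+z. ennreal (norm (f a)) * (ennreal (kern a z) * \<psi> z) + ?J z * \<psi> z \<partial>disc_measure)"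
  proof (rule nn_integral_mono)
    fix z assume "z \<in> space disc_measure"
    then have z: "norm z < 1" by simp
    have "norm (f z) * kern a z \<le> (norm (f a) + norm (f z - f a)) * kern a z"
      using norm_triangle_ineq[of "f a" "f z - f a"] K[OF a] by (intro mult_right_mono) auto
    then have "ennreal (norm (f z) * kern a z) \<le> ennreal (norm (f a) * kern a z + norm (f z - f a) * kern a z)"
      by (intro ennreal_leI) (simp add: distrib_right)
    also have "\<dots> = ennreal (norm (f a)) * ennreal (kern a z) + ennreal (norm (f z - f a) * kern a z)"
      using K[OF a, of z] by (simp add: ennreal_mult')
    also have "\<dots> \<le> ennreal (norm (f a)) * ennreal (kern a z) + ?J z"
      by (intro add_left_mono increment_kern_le D(1) a z bmoa_bound_integrable[OF f])
    finally have "ennreal (norm (f z) * kern a z) * \<psi> z \<le> (ennreal (norm (f a)) * ennreal (kern a z) + ?J z) * \<psi> z"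
      by (rule mult_right_mono) simp
    then show "ennreal (norm (f z) * kern a z) * \<psi> z \<le> ennreal (norm (f a)) * (ennreal (kern a z) * \<psi> z) + ?J z * \<psi> z"
      by (simp add: distrib_right mult.assoc)
  qed
  have sum: "(\<integral>\<^sup>+z. ennreal (norm (f a)) * (ennreal (kern a z) * \<psi> z) + ?J z * \<psi> z \<partial>disc_measure)
      = ennreal (norm (f a)) * (\<integral>\<^sup>+z. ennreal (kern a z) * \<psi> z \<partial>disc_measure) + (\<integral>\<^sup>+z. ?J z * \<psi> z \<partial>disc_measure)"
    by (subst nn_integral_add, measurable) (simp add: nn_integral_cmult)
  have "ennreal (norm (f a)) * (\<integral>\<^sup>+z. ennreal (kern a z) * \<psi> z \<partial>disc_measure) \<le> ennreal (7 * A * log_weight a) * ennreal (\<Lambda> / log_weight a)"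
    using bmoa_bound_growth[OF f a] test[OF a] by (intro mult_mono ennreal_leI) auto
  also have "\<dots> = ennreal (7 * A * \<Lambda>)"
    using L[OF a] A \<Lambda> by (simp flip: ennreal_mult)
  finally have 1: "ennreal (norm (f a)) * (\<integral>\<^sup>+z. ennreal (kern a z) * \<psi> z \<partial>disc_measure) \<le> ennreal (7 * A * \<Lambda>)" .
  have "(\<integral>\<^sup>+z. ?J z * \<psi> z \<partial>disc_measure) = (\<integral>\<^sup>+z. \<integral>\<^sup>+w. ennreal (3 * norm (deriv f w) * kern a w) * (ennreal (kern w z) * \<psi> z) \<partial>disc_measure \<partial>disc_measure)"
  proof (rule nn_integral_cong)
    fix z assume "z \<in> space disc_measure"
    have [measurable]: "(\<lambda>w. kern w z) \<in> borel_measurable disc_measure"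
      unfolding kern_def by (rule measurable_disc_borel) measurable
    have "?J z * \<psi> z = (\<integral>\<^sup>+w. ennreal (3 * norm (deriv f w) * kern a w * kern w z) * \<psi> z \<partial>disc_measure)"
      by (rule nn_integral_multc[symmetric]) measurable
    also have "\<dots> = (\<integral>\<^sup>+w. ennreal (3 * norm (deriv f w) * kern a w) * (ennreal (kern w z) * \<psi> z) \<partial>disc_measure)"
      using K[OF a] by (intro nn_integral_cong) (simp add: ennreal_mult' mult.assoc)
    finally show "?J z * \<psi> z = (\<integral>\<^sup>+w. ennreal (3 * norm (deriv f w) * kern a w) * (ennreal (kern w z) * \<psi> z) \<partial>disc_measure)" .
  qed
  also have "\<dots> = (\<integral>\<^sup>+w. \<integral>\<^sup>+z. ennreal (3 * norm (deriv f w) * kern a w) * (ennreal (kern w z) * \<psi> z) \<partial>disc_measure \<partial>disc_measure)"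
    by (rule P.Fubini') (simp add: split_beta')
  also have "\<dots> \<le> (\<integral>\<^sup>+w. ennreal (3 * \<Lambda> / (2 * A)) * energy_density f a w
      + ennreal (3 * \<Lambda> * A / 2) * ennreal (kern a w / ((1 - (norm w)\<^sup>2) * (log_weight w)\<^sup>2)) \<partial>disc_measure)"
  proof (rule nn_integral_mono)
    fix w assume "w \<in> space disc_measure"
    then have w: "norm w < 1" by simp
    have q: "0 < 1 - (norm w)\<^sup>2" by (rule one_minus_norm_square_pos[OF w])
    define l where "l = log_weight w"
    have l: "0 < l" using L[OF w] by (simp add: l_def)
    define d where "d = norm (deriv f w)"
    define k where "k = kern a w"
    define u where "u = 1 - (norm w)\<^sup>2"
    have nn: "0 \<le> d" "0 \<le> k" "0 < u" using K[OF a] q by (auto simp: d_def k_def u_def)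
    have m: "(\<lambda>z. ennreal (kern w z) * \<psi> z) \<in> borel_measurable disc_measure" by measurable
    have "(\<integral>\<^sup>+z. ennreal (3 * norm (deriv f w) * kern a w) * (ennreal (kern w z) * \<psi> z) \<partial>disc_measure)
      = ennreal (3 * d * k) * (\<integral>\<^sup>+z. ennreal (kern w z) * \<psi> z \<partial>disc_measure)"
      using m by (simp add: nn_integral_cmult d_def k_def)
    also have "\<dots> \<le> ennreal (3 * d * k) * ennreal (\<Lambda> / l)"
      unfolding l_def using test[OF w] by (intro mult_left_mono) auto
    also have "\<dots> = ennreal (3 * d * k * (\<Lambda> / l))"
      using nn by (intro ennreal_mult'[symmetric]) auto
    also have "\<dots> \<le> ennreal (3 * \<Lambda> / (2 * A) * (d\<^sup>2 * u * k) + 3 * \<Lambda> * A / 2 * (k / (u * l\<^sup>2)))"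
    proof (rule ennreal_leI)
      \<comment> \<open>The comparison value A / (u l) balances the two squares: one becomes the
        energy density, the other the weight of \<open>nn_integral_kern_log_weight\<close>, and each
        contributes a multiple of \<Lambda> A.\<close>
      have "2 * d * (A / (u * l)) \<le> d\<^sup>2 + (A / (u * l))\<^sup>2" by (rule sum_squares_bound)
      then have "(3 * \<Lambda> / (2 * A) * u * k) * (2 * d * (A / (u * l))) \<le> (3 * \<Lambda> / (2 * A) * u * k) * (d\<^sup>2 + (A / (u * l))\<^sup>2)"
        using nn A \<Lambda> by (intro mult_left_mono) auto
      moreover have "(3 * \<Lambda> / (2 * A) * u * k) * (2 * d * (A / (u * l))) = 3 * d * k * (\<Lambda> / l)"
        using nn A l by simp
      moreover have "(3 * \<Lambda> / (2 * A) * u * k) * (d\<^sup>2 + (A / (u * l))\<^sup>2) = 3 * \<Lambda> / (2 * A) * (d\<^sup>2 * u * k) + 3 * \<Lambda> * A / 2 * (k / (u * l\<^sup>2))"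
        using nn A l by (simp add: distrib_left power2_eq_square mult_ac add_divide_distrib)
      ultimately show "3 * d * k * (\<Lambda> / l) \<le> 3 * \<Lambda> / (2 * A) * (d\<^sup>2 * u * k) + 3 * \<Lambda> * A / 2 * (k / (u * l\<^sup>2))"
        by simp
    qed
    also have "\<dots> = ennreal (3 * \<Lambda> / (2 * A)) * ennreal (d\<^sup>2 * u * k) + ennreal (3 * \<Lambda> * A / 2) * ennreal (k / (u * l\<^sup>2))"
      using nn A l \<Lambda> by (simp flip: ennreal_mult ennreal_plus)
    finally show "(\<integral>\<^sup>+z. ennreal (3 * norm (deriv f w) * kern a w) * (ennreal (kern w z) * \<psi> z) \<partial>disc_measure)
      \<le> ennreal (3 * \<Lambda> / (2 * A)) * energy_density f a w
      + ennreal (3 * \<Lambda> * A / 2) * ennreal (kern a w / ((1 - (norm w)\<^sup>2) * (log_weight w)\<^sup>2))"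
      by (simp add: d_def k_def u_def l_def)
  qed
  also have "\<dots> = ennreal (3 * \<Lambda> / (2 * A)) * (\<integral>\<^sup>+w. energy_density f a w \<partial>disc_measure)
      + ennreal (3 * \<Lambda> * A / 2) * (\<integral>\<^sup>+w. ennreal (kern a w / ((1 - (norm w)\<^sup>2) * (log_weight w)\<^sup>2)) \<partial>disc_measure)"
    by (subst nn_integral_add, measurable) (simp add: nn_integral_cmult)
  also have "\<dots> \<le> ennreal (3 * \<Lambda> / (2 * A)) * ennreal (A\<^sup>2) + ennreal (3 * \<Lambda> * A / 2) * ennreal 2"
    using nn_integral_kern_log_weight[OF a] D(4)[OF a] by (intro add_mono mult_left_mono) auto
  also have "\<dots> = ennreal (3 * \<Lambda> / (2 * A) * A\<^sup>2 + 3 * \<Lambda> * A / 2 * 2)"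
    using A \<Lambda> by (simp del: ennreal_numeral flip: ennreal_mult ennreal_plus)
  finally have 2: "(\<integral>\<^sup>+z. ?J z * \<psi> z \<partial>disc_measure) \<le> ennreal (3 * \<Lambda> / (2 * A) * A\<^sup>2 + 3 * \<Lambda> * A / 2 * 2)" .
  have "(\<integral>\<^sup>+z. ennreal (norm (f z) * kern a z) * \<psi> z \<partial>disc_measure)
      \<le> ennreal (7 * A * \<Lambda>) + ennreal (3 * \<Lambda> / (2 * A) * A\<^sup>2 + 3 * \<Lambda> * A / 2 * 2)"
    using split unfolding sum by (rule order_trans) (intro add_mono 1 2)
  also have "\<dots> = ennreal (7 * A * \<Lambda> + (3 * \<Lambda> / (2 * A) * A\<^sup>2 + 3 * \<Lambda> * A / 2 * 2))"
    using A \<Lambda> by (intro ennreal_plus[symmetric]) auto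
  \<comment> \<open>7 + 3/2 + 3, rounded up.\<close>
  also have "\<dots> \<le> ennreal (12 * \<Lambda> * A)"
    using A \<Lambda> by (intro ennreal_leI) (simp add: power2_eq_square)
  finally show ?thesis .
qed

section \<open>Carleson squares and tents\<close>

lemma arithmetic_geometric_sum_le: "(\<Sum>k<n. real (k + 2) / 2 ^ k) \<le> 6"
proof -
  have "(\<Sum>k<n. real (k + 2) / 2 ^ k) = 6 - (2 * real n + 6) / 2 ^ n"
  proof (induction n)
    case (Suc n)
    show ?case unfolding sum.lessThan_Suc Suc.IH by (simp add: field_simps)
  qed simp
  then show ?thesis by simp
qed

text \<open>Each of the k + 1 doublings changes the logarithm by ln 2, which is at most ln (2 / t)
  for t = 2^(k+1) \<delta> \<le> 1. The resulting loss k + 2 is later summed against 2^(-k).\<close>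

lemma ln_dyadic_le:
  assumes \<delta>: "0 < \<delta>" and k: "2 ^ Suc k * \<delta> \<le> 1"
  shows "ln (2 / \<delta>) \<le> real (k + 2) * ln (2 / (2 ^ Suc k * \<delta>))" "0 < ln (2 / (2 ^ Suc k * \<delta>))" "0 < ln (2 / \<delta>)"
proof -
  define t where "t = 2 ^ Suc k * \<delta>"
  have t: "0 < t" "t \<le> 1" using assms by (auto simp: t_def)
  have l2: "ln 2 \<le> ln (2 / t)" using t by (subst ln_le_cancel_iff) (auto simp: field_simps)
  moreover have "0 < ln (2::real)" by simp
  ultimately have lp: "0 < ln (2 / t)" by linarith
  have "2 / \<delta> = 2 ^ Suc k * (2 / t)" using \<delta> by (simp add: t_def)
  then have "ln (2 / \<delta>) = ln (2 ^ Suc k) + ln (2 / t)"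
    using t ln_mult[of "2 ^ Suc k" "2 / t"] by (simp only:) simp
  also have "ln ((2::real) ^ Suc k) = real (Suc k) * ln 2" by (simp add: ln_realpow del: power_Suc)
  finally have eq: "ln (2 / \<delta>) = real (Suc k) * ln 2 + ln (2 / t)" .
  moreover have "real (Suc k) * ln 2 \<le> real (Suc k) * ln (2 / t)" using l2 by (intro mult_left_mono) auto
  ultimately have "ln (2 / \<delta>) \<le> real (k + 2) * ln (2 / t)" by (simp add: algebra_simps)
  then show "ln (2 / \<delta>) \<le> real (k + 2) * ln (2 / (2 ^ Suc k * \<delta>))" by (simp add: t_def)
  show "0 < ln (2 / (2 ^ Suc k * \<delta>))" using lp by (simp add: t_def)
  have "0 \<le> real (Suc k) * ln (2::real)" by simp
  then show "0 < ln (2 / \<delta>)" using eq lp by linarith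
qed

text \<open>A nonisotropic ball in the plane, not cut down to the disc: it is open, and
  \<open>w\<close> may also lie on the circle, as the covering argument in
  \<open>deriv_mass_finite\<close> requires.\<close>

definition tent :: "complex \<Rightarrow> real \<Rightarrow> complex set" where
  "tent w t = {z. norm (1 - cnj w * z) < t}"

lemma tent_borel [measurable]: "tent w t \<in> sets borel"
  unfolding tent_def by measurable

text \<open>With x = |1 - conj w z| \<ge> \<delta>, the kernel is at most 2 \<delta> / x^2. Where x
  \<ge> t0 / 2 this gives the constant term; otherwise z lies in a shell 2^k \<delta> \<le> x <
  2^(k+1) \<delta> whose tent has width at most t0, and one summand suffices. The bound
  \<open>n\<close> keeps the index set finite.\<close>

lemma kern_dyadic_le:
  assumes w: "norm w < 1" and z: "norm z < 1" and t0: "0 < t0" "t0 \<le> 1"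
    and n: "t0 < 2 ^ n * (1 - norm w)"
  defines "\<delta> \<equiv> 1 - norm w"
  shows "kern w z \<le> 8 * \<delta> / t0\<^sup>2 + (\<Sum>k | k < n \<and> 2 ^ Suc k * \<delta> \<le> t0. 2 / (4 ^ k * \<delta>) * indicator (tent w (2 ^ Suc k * \<delta>)) z)"
proof -
  have \<delta>: "0 < \<delta>" using w by (simp add: \<delta>_def)
  define x where "x = norm (1 - cnj w * z)"
  have x: "\<delta> \<le> x" using one_minus_cnj_mult_lower[of z w] z by (simp add: x_def \<delta>_def)
  have "1 - (norm w)\<^sup>2 = \<delta> * (1 + norm w)" by (simp add: \<delta>_def power2_eq_square algebra_simps)
  also have "\<dots> \<le> \<delta> * 2" using w \<delta> by (intro mult_left_mono) auto
  finally have kx: "kern w z \<le> 2 * \<delta> / x\<^sup>2"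
    unfolding kern_def x_def by (intro divide_right_mono) auto
  have nn: "0 \<le> (\<Sum>k | k < n \<and> 2 ^ Suc k * \<delta> \<le> t0. 2 / (4 ^ k * \<delta>) * indicator (tent w (2 ^ Suc k * \<delta>)) z)"
    using \<delta> by (intro sum_nonneg) auto
  show ?thesis
  proof (cases "t0 / 2 \<le> x")
    case True
    have "2 * \<delta> / x\<^sup>2 \<le> 2 * \<delta> / (t0 / 2)\<^sup>2"
      using True t0 \<delta> by (intro divide_left_mono power_mono mult_pos_pos) auto
    also have "\<dots> = 8 * \<delta> / t0\<^sup>2" by (simp add: power2_eq_square)
    finally show ?thesis using kx nn by linarith
  next
    case False
    obtain N where "x / \<delta> < 2 ^ Suc N"
      using real_arch_pow[of 2 "x / \<delta>"] by (metis less_trans one_less_numeral_iff power_strict_increasing_iff lessI semiring_norm(76))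
    then have ex: "\<exists>k. x < 2 ^ Suc k * \<delta>" using \<delta> by (auto simp: divide_less_eq)
    define k where "k = (LEAST k. x < 2 ^ Suc k * \<delta>)"
    have k1: "x < 2 ^ Suc k * \<delta>" unfolding k_def by (rule LeastI_ex[OF ex])
    have k2: "2 ^ k * \<delta> \<le> x"
    proof (cases k)
      case 0 then show ?thesis using x by simp
    next
      case (Suc j)
      then have "\<not> x < 2 ^ Suc j * \<delta>" using not_less_Least[of j "\<lambda>k. x < 2 ^ Suc k * \<delta>"] by (simp add: k_def)
      then show ?thesis using Suc by simp
    qed
    have k3: "2 ^ Suc k * \<delta> \<le> t0" using k2 False by simp
    have kn: "k < n"
    proof (rule ccontr)
      assume "\<not> k < n"
      then have "(2::real) ^ n * \<delta> \<le> 2 ^ Suc k * \<delta>" using \<delta> by (intro mult_right_mono power_increasing) auto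
      then show False using n k3 by (simp add: \<delta>_def)
    qed
    have "2 * \<delta> / x\<^sup>2 \<le> 2 * \<delta> / (2 ^ k * \<delta>)\<^sup>2"
      using k2 \<delta> x by (intro divide_left_mono power_mono mult_pos_pos) auto
    also have "\<dots> = 2 / (4 ^ k * \<delta>) * indicator (tent w (2 ^ Suc k * \<delta>)) z"
    proof -
      have "(2 ^ k :: real) * 2 ^ k = 4 ^ k" by (simp flip: power_mult_distrib)
      then show ?thesis using k1 \<delta> by (simp add: tent_def x_def power2_eq_square)
    qed
    also have "\<dots> \<le> (\<Sum>k | k < n \<and> 2 ^ Suc k * \<delta> \<le> t0. 2 / (4 ^ k * \<delta>) * indicator (tent w (2 ^ Suc k * \<delta>)) z)"
      using kn k3 \<delta> by (intro member_le_sum[where f = "\<lambda>k. 2 / (4 ^ k * \<delta>) * indicator (tent w (2 ^ Suc k * \<delta>)) z"]) auto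
    finally show ?thesis using kx \<delta> by (smt (verit) divide_nonneg_nonneg zero_le_power2)
  qed
qed

text \<open>Converts a tent condition into the hypothesis \<open>test\<close> of
  \<open>log_Carleson_embedding\<close>. The k-th tent contributes 4 \<epsilon> (k + 2) / (2^k l),
  which sums to 24 \<epsilon> / l; the far part 8 \<delta> m / t0^2 becomes 16 m / (t0^2 l) because
  \<delta> \<le> 2 / l. Keeping \<epsilon> and m separate lets the lemma serve both the bounded and
  the vanishing condition.\<close>

lemma nn_integral_kern_tent:
  assumes \<psi> [measurable]: "\<psi> \<in> borel_measurable disc_measure" and t0: "0 < t0" "t0 \<le> 1"
    and \<epsilon>: "0 \<le> \<epsilon>" and m: "0 \<le> m"
    and small: "\<And>t. 0 < t \<Longrightarrow> t \<le> t0 \<Longrightarrow>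
      (\<integral>\<^sup>+z. \<psi> z * indicator (tent w t) z \<partial>disc_measure) \<le> ennreal (\<epsilon> * t / ln (2 / t))"
    and total: "(\<integral>\<^sup>+z. \<psi> z \<partial>disc_measure) \<le> ennreal m"
    and w: "norm w < 1"
  shows "(\<integral>\<^sup>+z. ennreal (kern w z) * \<psi> z \<partial>disc_measure) \<le> ennreal ((24 * \<epsilon> + 16 * m / t0\<^sup>2) / log_weight w)"
proof -
  define \<delta> where "\<delta> = 1 - norm w"
  have \<delta>: "0 < \<delta>" "\<delta> \<le> 1" using w by (auto simp: \<delta>_def)
  obtain n where n: "t0 < 2 ^ n * \<delta>"
    using real_arch_pow[of 2 "t0 / \<delta>"] \<delta> by (auto simp: divide_less_eq)
  define S where "S = {k. k < n \<and> 2 ^ Suc k * \<delta> \<le> t0}"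
  define l where "l = ln (2 / \<delta>)"
  have l: "0 < l" unfolding l_def using \<delta> by simp
  have [measurable]: "tent w t \<in> sets borel" for t by simp
  have indm: "(\<lambda>z. indicator (tent w t) z :: ennreal) \<in> borel_measurable disc_measure" for t
    by (rule measurable_disc_borel) measurable
  have "(\<integral>\<^sup>+z. ennreal (kern w z) * \<psi> z \<partial>disc_measure)
    \<le> (\<integral>\<^sup>+z. ennreal (8 * \<delta> / t0\<^sup>2) * \<psi> z + (\<Sum>k\<in>S. ennreal (2 / (4 ^ k * \<delta>)) * (\<psi> z * indicator (tent w (2 ^ Suc k * \<delta>)) z)) \<partial>disc_measure)"
  proof (rule nn_integral_mono)
    fix z assume "z \<in> space disc_measure"
    then have z: "norm z < 1" by simp
    have "ennreal (kern w z) \<le> ennreal (8 * \<delta> / t0\<^sup>2 + (\<Sum>k\<in>S. 2 / (4 ^ k * \<delta>) * indicator (tent w (2 ^ Suc k * \<delta>)) z))"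
      using kern_dyadic_le[OF w z t0 n[unfolded \<delta>_def]] unfolding S_def \<delta>_def by (rule ennreal_leI)
    also have "\<dots> = ennreal (8 * \<delta> / t0\<^sup>2) + (\<Sum>k\<in>S. ennreal (2 / (4 ^ k * \<delta>)) * indicator (tent w (2 ^ Suc k * \<delta>)) z)"
    proof -
      have "ennreal (\<Sum>k\<in>S. 2 / (4 ^ k * \<delta>) * indicator (tent w (2 ^ Suc k * \<delta>)) z)
          = (\<Sum>k\<in>S. ennreal (2 / (4 ^ k * \<delta>) * indicator (tent w (2 ^ Suc k * \<delta>)) z))"
        using \<delta> by (intro sum_ennreal[symmetric]) auto
      also have "\<dots> = (\<Sum>k\<in>S. ennreal (2 / (4 ^ k * \<delta>)) * indicator (tent w (2 ^ Suc k * \<delta>)) z)"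
        by (intro sum.cong refl) (simp add: indicator_def)
      finally show ?thesis using \<delta> by (subst ennreal_plus) (auto intro!: sum_nonneg)
    qed
    finally have "ennreal (kern w z) * \<psi> z \<le> (ennreal (8 * \<delta> / t0\<^sup>2) + (\<Sum>k\<in>S. ennreal (2 / (4 ^ k * \<delta>)) * indicator (tent w (2 ^ Suc k * \<delta>)) z)) * \<psi> z"
      by (rule mult_right_mono) simp
    then show "ennreal (kern w z) * \<psi> z \<le> ennreal (8 * \<delta> / t0\<^sup>2) * \<psi> z + (\<Sum>k\<in>S. ennreal (2 / (4 ^ k * \<delta>)) * (\<psi> z * indicator (tent w (2 ^ Suc k * \<delta>)) z))"
      by (simp add: distrib_left distrib_right sum_distrib_right sum_distrib_left mult_ac)
  qed
  also have "\<dots> = ennreal (8 * \<delta> / t0\<^sup>2) * (\<integral>\<^sup>+z. \<psi> z \<partial>disc_measure)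
      + (\<Sum>k\<in>S. ennreal (2 / (4 ^ k * \<delta>)) * (\<integral>\<^sup>+z. \<psi> z * indicator (tent w (2 ^ Suc k * \<delta>)) z \<partial>disc_measure))"
    using indm by (simp add: nn_integral_add nn_integral_cmult nn_integral_sum)
  also have "\<dots> \<le> ennreal (8 * \<delta> / t0\<^sup>2) * ennreal m + (\<Sum>k\<in>S. ennreal (4 * \<epsilon> / l * (real (k + 2) / 2 ^ k)))"
  proof (intro add_mono mult_left_mono sum_mono total)
    fix k assume "k \<in> S"
    then have k: "2 ^ Suc k * \<delta> \<le> t0" by (simp add: S_def)
    then have k': "2 ^ Suc k * \<delta> \<le> 1" using t0 by linarith
    define L where "L = ln (2 / (2 ^ Suc k * \<delta>))"
    note ln = ln_dyadic_le[OF \<delta>(1) k', folded l_def L_def]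
    have "ennreal (2 / (4 ^ k * \<delta>)) * (\<integral>\<^sup>+z. \<psi> z * indicator (tent w (2 ^ Suc k * \<delta>)) z \<partial>disc_measure)
       \<le> ennreal (2 / (4 ^ k * \<delta>)) * ennreal (\<epsilon> * (2 ^ Suc k * \<delta>) / L)"
      unfolding L_def using \<delta> by (intro mult_left_mono small k) auto
    also have "\<dots> = ennreal (2 / (4 ^ k * \<delta>) * (\<epsilon> * (2 ^ Suc k * \<delta>) / L))"
      using \<delta> by (intro ennreal_mult'[symmetric]) auto
    also have "2 / (4 ^ k * \<delta>) * (\<epsilon> * (2 ^ Suc k * \<delta>) / L) = 4 * \<epsilon> / 2 ^ k * (1 / L)"
    proof -
      have "(4 ^ k :: real) = 2 ^ k * 2 ^ k" by (simp flip: power_mult_distrib)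
      then show ?thesis using \<delta> by simp
    qed
    also have "\<dots> \<le> 4 * \<epsilon> / 2 ^ k * (real (k + 2) / l)"
      using ln l \<epsilon> by (intro mult_left_mono) (simp_all add: field_simps)
    also have "\<dots> = 4 * \<epsilon> / l * (real (k + 2) / 2 ^ k)" by simp
    finally show "ennreal (2 / (4 ^ k * \<delta>)) * (\<integral>\<^sup>+z. \<psi> z * indicator (tent w (2 ^ Suc k * \<delta>)) z \<partial>disc_measure)
      \<le> ennreal (4 * \<epsilon> / l * (real (k + 2) / 2 ^ k))" by (simp add: ennreal_leI)
  qed auto
  also have "\<dots> = ennreal (8 * \<delta> / t0\<^sup>2 * m + (\<Sum>k\<in>S. 4 * \<epsilon> / l * (real (k + 2) / 2 ^ k)))"
  proof -
    have "(\<Sum>k\<in>S. ennreal (4 * \<epsilon> / l * (real (k + 2) / 2 ^ k))) = ennreal (\<Sum>k\<in>S. 4 * \<epsilon> / l * (real (k + 2) / 2 ^ k))"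
      using \<epsilon> l by (intro sum_ennreal) auto
    moreover have "ennreal (8 * \<delta> / t0\<^sup>2) * ennreal m = ennreal (8 * \<delta> / t0\<^sup>2 * m)"
      using \<delta> by (intro ennreal_mult'[symmetric]) auto
    ultimately show ?thesis using \<delta> \<epsilon> l m by (subst ennreal_plus) (auto intro!: sum_nonneg)
  qed
  also have "\<dots> \<le> ennreal ((24 * \<epsilon> + 16 * m / t0\<^sup>2) / log_weight w)"
  proof (rule ennreal_leI)
    have "(\<Sum>k\<in>S. real (k + 2) / 2 ^ k) \<le> (\<Sum>k<n. real (k + 2) / 2 ^ k)"
      by (rule sum_mono2) (auto simp: S_def)
    then have "(\<Sum>k\<in>S. real (k + 2) / 2 ^ k) \<le> 6" using arithmetic_geometric_sum_le[of n] by linarith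
    then have "4 * \<epsilon> / l * (\<Sum>k\<in>S. real (k + 2) / 2 ^ k) \<le> 4 * \<epsilon> / l * 6"
      using \<epsilon> l by (intro mult_left_mono) auto
    moreover have "(\<Sum>k\<in>S. 4 * \<epsilon> / l * (real (k + 2) / 2 ^ k)) = 4 * \<epsilon> / l * (\<Sum>k\<in>S. real (k + 2) / 2 ^ k)"
      by (rule sum_distrib_left[symmetric])
    moreover have "\<delta> \<le> 2 / l"
    proof -
      have "l \<le> 2 / \<delta>" unfolding l_def using ln_le_minus_one[of "2 / \<delta>"] \<delta> by simp
      then show ?thesis using l \<delta> by (simp add: field_simps)
    qed
    then have "8 * m / t0\<^sup>2 * \<delta> \<le> 8 * m / t0\<^sup>2 * (2 / l)"
      using m by (intro mult_left_mono) auto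
    ultimately have "8 * \<delta> / t0\<^sup>2 * m + (\<Sum>k\<in>S. 4 * \<epsilon> / l * (real (k + 2) / 2 ^ k)) \<le> (24 * \<epsilon> + 16 * m / t0\<^sup>2) / l"
      by (simp add: add_divide_distrib mult_ac)
    also have "\<dots> \<le> (24 * \<epsilon> + 16 * m / t0\<^sup>2) / log_weight w"
    proof (rule divide_left_mono)
      have "\<delta> \<le> 1 - (norm w)\<^sup>2" using w by (simp add: \<delta>_def power2_eq_square mult_left_le)
      then have "2 / (1 - (norm w)\<^sup>2) \<le> 2 / \<delta>" using \<delta> by (intro divide_left_mono mult_pos_pos) auto
      then show "log_weight w \<le> l" unfolding log_weight_def l_def
        using one_minus_norm_square_pos[OF w] \<delta> by (subst ln_le_cancel_iff) auto
      show "0 < l * log_weight w" using l log_weight_ge[OF w] by simp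
    qed (use \<epsilon> m in auto)
    finally show "8 * \<delta> / t0\<^sup>2 * m + (\<Sum>k\<in>S. 4 * \<epsilon> / l * (real (k + 2) / 2 ^ k)) \<le> (24 * \<epsilon> + 16 * m / t0\<^sup>2) / log_weight w" .
  qed
  finally show ?thesis .
qed

section \<open>Arc length, and the comparison of Carleson squares with tents\<close>

lemma Jordan_sin_ge:
  assumes "0 \<le> x" "x \<le> pi / 2"
  shows "2 * x / pi \<le> sin x"
proof -
  have conc: "concave_on {0..pi} sin"
  proof (rule f''_le0_imp_concave[where f' = cos and f'' = "\<lambda>x. - sin x"])
    show "- sin x \<le> 0" if "x \<in> {0..pi}" for x using that by (simp add: sin_ge_zero)
  qed (auto intro!: derivative_eq_intros)
  define t where "t = 2 * x / pi"
  have t: "0 \<le> t" "t \<le> 1" using assms by (auto simp: t_def field_simps)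
  have "(1 - t) * sin 0 + t * sin (pi / 2) \<le> sin ((1 - t) *\<^sub>R 0 + t *\<^sub>R (pi / 2))"
    using t by (intro concave_onD[OF conc]) auto
  then show ?thesis by (simp add: t_def)
qed

lemma norm_one_minus_cis_le: "norm (1 - cis t) \<le> \<bar>t\<bar>"
proof -
  have "norm (1 - cis t) = 2 * \<bar>sin (t / 2)\<bar>"
    using dist_exp_i_1[of t] by (simp add: cis_conv_exp norm_minus_commute)
  also have "\<dots> \<le> 2 * \<bar>t / 2\<bar>" by (intro mult_left_mono abs_sin_x_le_abs_x) auto
  finally show ?thesis by simp
qed

text \<open>Arcs may or may not contain their endpoints, so the set of angles is known only up to
  finitely many points; these form a null set whatever \<open>A\<close> is.\<close>

lemma measure_lborel_sandwich:
  fixes A B :: "real set"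
  assumes "B \<subseteq> A" "A \<subseteq> B \<union> F" "finite F" "B \<in> sets borel"
  shows "measure lborel A = measure lborel B"
proof -
  have f: "finite (A - B)" using assms by (auto intro: finite_subset[of _ F])
  then have "A - B \<in> null_sets lborel" by (rule finite_imp_null_set_lborel)
  then have "emeasure lborel (B \<union> (A - B)) = emeasure lborel B"
    using assms(4) by (intro emeasure_Un_null_set) auto
  moreover have "B \<union> (A - B) = A" using assms(1) by auto
  ultimately show ?thesis by (simp add: measure_def)
qed

lemma cis_eq_iff_shift: "cis s = cis t \<longleftrightarrow> (\<exists>n::int. s = t + 2 * pi * n)"
  using sin_cos_eq_iff[of s t] by (auto simp: complex_eq_iff)

text \<open>After subtracting whole turns the arc starts in the base period. The angles counted by
  \<open>arc_length\<close> are then the part below 2 pi and the overflow moved back by one turn,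
  which do not overlap because b \<le> a + 2 pi.\<close>

lemma arc_length_cis:
  assumes ab: "a < b" "b \<le> a + 2 * pi" and J: "{a<..<b} \<subseteq> J" "J \<subseteq> {a..b}"
  shows "arc_length (cis ` J) = (b - a) / (2 * pi)"
proof -
  have main: "arc_length (cis ` J) = (b - a) / (2 * pi)"
    if ab: "a < b" "b \<le> a + 2 * pi" and J: "{a<..<b} \<subseteq> J" "J \<subseteq> {a..b}" and a: "0 \<le> a" "a < 2 * pi" for a b J
  proof -
    define A where "A = {t \<in> {0..<2 * pi}. cis t \<in> cis ` J}"
    have mem: "t \<in> A \<longleftrightarrow> t \<in> {0..<2 * pi} \<and> (t \<in> J \<or> t + 2 * pi \<in> J)" for t
    proof
      assume "t \<in> A"
      then obtain s where s: "s \<in> J" "cis t = cis s" and t: "t \<in> {0..<2 * pi}" by (auto simp: A_def)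
      then obtain n :: int where n: "s = t + 2 * pi * n" using cis_eq_iff_shift[of s t] by metis
      \<comment> \<open>These bounds leave only n = 0 and n = 1: an angle of the base period meets
        \<open>J\<close> directly or one turn later.\<close>
      have "0 \<le> s" "s < 4 * pi" using s J a ab by (auto dest!: subsetD)
      have "- 1 < real_of_int n"
      proof (rule ccontr)
        assume "\<not> - 1 < real_of_int n"
        then have "2 * pi * n \<le> 2 * pi * (- 1)" by (intro mult_left_mono) auto
        then show False using n t \<open>0 \<le> s\<close> by simp
      qed
      moreover have "real_of_int n < 2"
      proof (rule ccontr)
        assume "\<not> real_of_int n < 2"
        then have "2 * pi * 2 \<le> 2 * pi * n" by (intro mult_left_mono) auto
        then show False using n t \<open>s < 4 * pi\<close> unfolding atLeastLessThan_iff by linarith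
      qed
      ultimately have "n = 0 \<or> n = 1" by linarith
      then show "t \<in> {0..<2 * pi} \<and> (t \<in> J \<or> t + 2 * pi \<in> J)" using n s t by auto
    next
      assume R: "t \<in> {0..<2 * pi} \<and> (t \<in> J \<or> t + 2 * pi \<in> J)"
      have "cis t = cis (t + 2 * pi)" by (simp add: cis_mult[symmetric])
      then show "t \<in> A" using R by (auto simp: A_def intro: rev_image_eqI)
    qed
    define B where "B = {t \<in> {0..<2 * pi}. t \<in> {a<..<b} \<or> t + 2 * pi \<in> {a<..<b}}"
    have Beq: "B = {a<..<min b (2 * pi)} \<union> {0..<b - 2 * pi}"
      using a ab by (auto simp: B_def)
    have "measure lborel A = measure lborel B"
    proof (rule measure_lborel_sandwich)
      show "B \<subseteq> A" using J by (auto simp: B_def mem)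
      show "A \<subseteq> B \<union> {a, b, a - 2 * pi, b - 2 * pi}"
        using J by (force simp: B_def mem)
      show "B \<in> sets borel" unfolding Beq by measurable
    qed simp
    also have "\<dots> = b - a"
    proof (cases "b \<le> 2 * pi")
      case True then show ?thesis using ab by (simp add: Beq)
    next
      case False
      then have "measure lborel B = measure lborel {a<..<2 * pi} + measure lborel {0..<b - 2 * pi}"
        unfolding Beq using ab a by (subst measure_Union) (auto simp: min_def)
      then show ?thesis using False a by simp
    qed
    finally show ?thesis by (simp add: arc_length_def A_def)
  qed
  define n where "n = \<lfloor>a / (2 * pi)\<rfloor>"
  define c where "c = 2 * pi * n"
  have c: "0 \<le> a - c" "a - c < 2 * pi"
  proof -
    have "real_of_int n \<le> a / (2 * pi)" "a / (2 * pi) < real_of_int n + 1" by (simp_all add: n_def floor_correct)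
    then show "0 \<le> a - c" "a - c < 2 * pi" by (simp_all add: c_def field_simps)
  qed
  have "cis (t - c) = cis t" for t
    unfolding cis_eq_iff_shift by (rule exI[of _ "- n"]) (simp add: c_def)
  then have "cis ` ((\<lambda>t. t - c) ` J) = cis ` J" by (simp add: image_image)
  moreover have "arc_length (cis ` ((\<lambda>t. t - c) ` J)) = ((b - c) - (a - c)) / (2 * pi)"
  proof (rule main)
    show "{a - c<..<b - c} \<subseteq> (\<lambda>t. t - c) ` J"
    proof
      fix t assume "t \<in> {a - c<..<b - c}"
      then have "t + c \<in> J" using J by auto
      then show "t \<in> (\<lambda>t. t - c) ` J" by (intro rev_image_eqI[of "t + c"]) auto
    qed
    show "(\<lambda>t. t - c) ` J \<subseteq> {a - c..b - c}" using J by auto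
  qed (use ab c in auto)
  ultimately show ?thesis by simp
qed

text \<open>The witness has modulus 1 - t and points to the middle of the arc. The radial gap costs
  at most 2 t, the angular gap at most half the arc, pi t, and 2 + pi \<le> 6.\<close>

lemma circle_arc_subset_tent:
  assumes I: "I \<in> circle_arcs"
  defines "t \<equiv> arc_length I"
  shows "0 < t" "t \<le> 1"
    and "\<exists>w. norm w = 1 - t \<and> (\<forall>z\<in>carleson_square I. norm z < 1 \<and> norm (1 - cnj w * z) \<le> 6 * t)"
proof -
  obtain J a b where J: "I = cis ` J" "a < b" "b \<le> a + 2 * pi" "{a<..<b} \<subseteq> J" "J \<subseteq> {a..b}"
    using I unfolding circle_arcs_def by blast
  have t: "t = (b - a) / (2 * pi)" unfolding t_def J(1) by (rule arc_length_cis) (use J in auto)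
  show t0: "0 < t" and t1: "t \<le> 1" using J by (auto simp: t field_simps)
  define c where "c = (a + b) / 2"
  define w where "w = of_real (1 - t) * cis c"
  have "norm w = 1 - t" using t1 by (simp add: w_def norm_mult del: of_real_diff)
  moreover have "norm z < 1 \<and> norm (1 - cnj w * z) \<le> 6 * t" if z: "z \<in> carleson_square I" for z
  proof -
    obtain r s where rs: "z = of_real r * cis s" "s \<in> J" "1 - t < r" "r < 1"
      using z unfolding carleson_square_def t_def J(1) by auto
    have r: "0 \<le> r" using rs t1 by simp
    define \<rho> where "\<rho> = (1 - t) * r"
    have \<rho>: "0 \<le> \<rho>" "\<rho> \<le> 1" using r rs t0 t1 by (auto simp: \<rho>_def mult_le_one)
    have "(1 - t) * (1 - t) \<le> \<rho>" unfolding \<rho>_def using rs t1 by (intro mult_left_mono) auto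
    moreover have "(1 - t) * (1 - t) = 1 - 2 * t + t * t" by (simp add: algebra_simps)
    ultimately have \<rho>2: "1 - \<rho> \<le> 2 * t" using zero_le_square[of t] by linarith
    have "cnj w * z = of_real \<rho> * cis (s - c)"
    proof -
      have "cis (s - c) = cis s * cis (- c)" by (simp add: cis_mult)
      then show ?thesis by (simp add: w_def rs \<rho>_def cis_cnj mult_ac del: cis_mult)
    qed
    then have "1 - cnj w * z = of_real (1 - \<rho>) + of_real \<rho> * (1 - cis (s - c))"
      by (simp add: algebra_simps)
    then have "norm (1 - cnj w * z) \<le> norm (complex_of_real (1 - \<rho>)) + norm (complex_of_real \<rho> * (1 - cis (s - c)))"
      by (metis norm_triangle_ineq)
    also have "\<dots> = (1 - \<rho>) + \<rho> * norm (1 - cis (s - c))"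
      using \<rho> by (simp only: norm_mult norm_of_real abs_of_nonneg diff_ge_0_iff_ge)
    also have "\<dots> \<le> 2 * t + 1 * \<bar>s - c\<bar>"
      using \<rho> \<rho>2 norm_one_minus_cis_le by (intro add_mono mult_mono) auto
    also have "\<bar>s - c\<bar> \<le> (b - a) / 2" using rs(2) J(5) by (auto simp: c_def abs_le_iff field_simps dest!: subsetD)
    also have "(b - a) / 2 = pi * t" by (simp add: t)
    also have "2 * t + 1 * (pi * t) \<le> 6 * t" using pi_less_4 t0 by simp
    finally show ?thesis using rs r by (simp add: norm_mult)
  qed
  ultimately show "\<exists>w. norm w = 1 - t \<and> (\<forall>z\<in>carleson_square I. norm z < 1 \<and> norm (1 - cnj w * z) \<le> 6 * t)"
    by blast
qed

text \<open>The arc is centred at the argument of \<open>w\<close>. The bound 3/4 keeps |conj w z|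
  above 1/4, so that |1 - conj w z| dominates |sin (\<eta> / 2)| for the angle \<eta> between w and
  z; Jordan's inequality then yields |\<eta>| \<le> pi t, exactly half the arc, without loss of a
  constant.\<close>

lemma tent_subset_carleson_square:
  assumes w: "norm w \<le> 1" and t: "0 < t" "t \<le> 3 / 4"
  shows "\<exists>I\<in>circle_arcs. arc_length I = t \<and> tent w t \<inter> ball 0 1 \<subseteq> carleson_square I"
proof -
  define \<alpha> where "\<alpha> = Arg w"
  define J where "J = {\<alpha> - pi * t..\<alpha> + pi * t}"
  have tp: "pi * t \<le> pi" "0 < pi * t" using t by (simp_all add: mult_left_le)
  have arc: "cis ` J \<in> circle_arcs"
    unfolding circle_arcs_def J_def using tp
    by (intro CollectI exI[of _ J] exI[of _ "\<alpha> - pi * t"] exI[of _ "\<alpha> + pi * t"]) (auto simp: J_def)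
  have len: "arc_length (cis ` J) = t"
    using arc_length_cis[of "\<alpha> - pi * t" "\<alpha> + pi * t" J] tp by (simp add: J_def subset_iff)
  have "z \<in> carleson_square (cis ` J)" if z: "norm (1 - cnj w * z) < t" "norm z < 1" for z
  proof -
    define v where "v = cnj w * z"
    define \<rho> where "\<rho> = norm v"
    define \<eta> where "\<eta> = Arg v"
    define r where "r = norm z"
    have \<rho>r: "\<rho> = norm w * r" by (simp add: \<rho>_def v_def norm_mult r_def)
    have \<rho>t: "1 - t < \<rho>"
      using norm_triangle_ineq2[of 1 v] z by (simp add: \<rho>_def v_def)
    have \<rho>1: "1 / 4 < \<rho>" using \<rho>t t by simp
    have r: "1 - t < r" using \<rho>t w \<rho>r mult_right_mono[of "norm w" 1 r] by (simp add: r_def)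
    have w0: "w \<noteq> 0" using \<rho>1 by (auto simp: \<rho>r)
    have v: "v = of_real \<rho> * cis \<eta>" using rcis_cmod_Arg[of v] by (simp add: \<rho>_def \<eta>_def rcis_def)
    have \<eta>: "\<bar>\<eta>\<bar> \<le> pi" using Arg_bounded[of v] by (auto simp: \<eta>_def)
    have "(norm (1 - v))\<^sup>2 = (1 - \<rho> * cos \<eta>)\<^sup>2 + (\<rho> * sin \<eta>)\<^sup>2"
      by (simp add: v cmod_power2 power2_commute)
    also have "\<dots> = 1 - 2 * \<rho> * cos \<eta> + \<rho>\<^sup>2 * ((cos \<eta>)\<^sup>2 + (sin \<eta>)\<^sup>2)"
      by algebra
    also have "\<dots> = 1 - 2 * \<rho> * cos \<eta> + \<rho>\<^sup>2" by simp
    also have "\<dots> = (1 - \<rho>)\<^sup>2 + 4 * \<rho> * (sin (\<eta> / 2))\<^sup>2"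
    proof -
      have c: "cos \<eta> = 1 - 2 * (sin (\<eta> / 2))\<^sup>2" using cos_double_sin[of "\<eta> / 2"] by simp
      have "1 - 2 * \<rho> * (1 - 2 * S) + \<rho>\<^sup>2 = (1 - \<rho>)\<^sup>2 + 4 * \<rho> * S" for S by algebra
      then show ?thesis using c by simp
    qed
    finally have nv: "(norm (1 - v))\<^sup>2 = (1 - \<rho>)\<^sup>2 + 4 * \<rho> * (sin (\<eta> / 2))\<^sup>2" .
    have "1 * (sin (\<eta> / 2))\<^sup>2 \<le> 4 * \<rho> * (sin (\<eta> / 2))\<^sup>2" using \<rho>1 by (intro mult_right_mono) auto
    then have "(sin (\<eta> / 2))\<^sup>2 \<le> (norm (1 - v))\<^sup>2" using nv zero_le_power2[of "1 - \<rho>"] by linarith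
    then have "\<bar>sin (\<eta> / 2)\<bar> \<le> norm (1 - v)" using abs_le_square_iff[of "sin (\<eta> / 2)" "norm (1 - v)"] by simp
    then have st: "\<bar>sin (\<eta> / 2)\<bar> < t" using z by (simp add: v_def)
    have "2 * (\<bar>\<eta>\<bar> / 2) / pi \<le> sin (\<bar>\<eta>\<bar> / 2)" using \<eta> by (intro Jordan_sin_ge) auto
    also have "sin (\<bar>\<eta>\<bar> / 2) \<le> \<bar>sin (\<eta> / 2)\<bar>" by (auto simp: abs_if)
    finally have "\<bar>\<eta>\<bar> / pi < t" using st by simp
    then have \<eta>t: "\<bar>\<eta>\<bar> \<le> pi * t" by (simp add: field_simps)
    have "z = of_real r * cis (\<alpha> + \<eta>)"
    proof -
      have "w = of_real (norm w) * cis \<alpha>" using rcis_cmod_Arg[of w] by (simp add: \<alpha>_def rcis_def)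
      then have wv: "w * v = of_real (norm w) * of_real \<rho> * cis (\<alpha> + \<eta>)"
        by (subst v) (metis (no_types, lifting) cis_mult mult.assoc mult.commute)
      have "of_real ((norm w)\<^sup>2) * z = w * v" unfolding v_def complex_norm_square by simp
      also note wv
      also have "of_real (norm w) * of_real \<rho> * cis (\<alpha> + \<eta>) = of_real ((norm w)\<^sup>2) * (of_real r * cis (\<alpha> + \<eta>))"
        by (simp add: \<rho>r power2_eq_square mult_ac)
      finally have "of_real ((norm w)\<^sup>2) * z = of_real ((norm w)\<^sup>2) * (of_real r * cis (\<alpha> + \<eta>))" .
      then show ?thesis using w0 by (simp only: mult_cancel_left) simp
    qed
    moreover have "\<alpha> + \<eta> \<in> J" using \<eta>t by (auto simp: J_def)
    ultimately show ?thesis unfolding carleson_square_def len using r z by (auto simp: r_def)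
  qed
  then show ?thesis using arc len by (intro bexI[of _ "cis ` J"]) (auto simp: tent_def)
qed

section \<open>The integral operator and test functions\<close>

lemma one_minus_disc_auto:
  assumes "norm a < 1" "norm z < 1"
  shows "1 - (norm (disc_auto a z))\<^sup>2 = (1 - (norm z)\<^sup>2) * kern a z"
proof -
  have "complex_of_real ((norm (1 - cnj a * z))\<^sup>2 - (norm (a - z))\<^sup>2) = of_real ((1 - (norm z)\<^sup>2) * (1 - (norm a)\<^sup>2))"
    by (simp only: of_real_diff of_real_mult of_real_1 complex_norm_square) (simp add: algebra_simps)
  then have "(norm (1 - cnj a * z))\<^sup>2 - (norm (a - z))\<^sup>2 = (1 - (norm z)\<^sup>2) * (1 - (norm a)\<^sup>2)"
    by (simp only: of_real_eq_iff)
  moreover have "norm (1 - cnj a * z) \<noteq> 0" using one_minus_cnj_mult_nonzero(1)[OF assms] by simp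
  ultimately show ?thesis
    by (simp add: disc_auto_def kern_def norm_divide power_divide divide_simps del: norm_eq_zero)
qed

lemma BMOA_integral_2:
  assumes "norm a < 1"
  shows "BMOA_integral 2 f a = (\<integral>\<^sup>+z. energy_density f a z \<partial>disc_measure)"
  unfolding BMOA_integral_def nn_integral_disc_measure[symmetric]
proof (rule nn_integral_cong)
  fix z assume "z \<in> space disc_measure"
  then have z: "norm z < 1" by simp
  have "(1 - (norm z)\<^sup>2) powr (2 - 2) = 1" using one_minus_norm_square_pos[OF z] by simp
  then show "ennreal (norm (deriv f z) powr 2 * (1 - (norm z)\<^sup>2) powr (2 - 2) * (1 - (norm (disc_auto a z))\<^sup>2))
    = energy_density f a z"
    by (simp add: one_minus_disc_auto[OF assms z] mult.assoc)
qed

text \<open>For exponent 1 the weight is the reciprocal of 1 - |z|^2 and cancels the same factor in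
  1 - |phi_a(z)|^2, leaving the bare kernel.\<close>

lemma BMOA_integral_1:
  assumes "norm a < 1"
  shows "BMOA_integral 1 f a = (\<integral>\<^sup>+z. ennreal (norm (deriv f z) * kern a z) \<partial>disc_measure)"
  unfolding BMOA_integral_def nn_integral_disc_measure[symmetric]
proof (rule nn_integral_cong)
  fix z assume "z \<in> space disc_measure"
  then have z: "norm z < 1" by simp
  note p = one_minus_norm_square_pos[OF z]
  have "(1 - (norm z)\<^sup>2) powr (1 - 2) * ((1 - (norm z)\<^sup>2) * kern a z) = kern a z"
    using p by (simp add: powr_minus)
  then show "ennreal (norm (deriv f z) powr 1 * (1 - (norm z)\<^sup>2) powr (1 - 2) * (1 - (norm (disc_auto a z))\<^sup>2))
    = ennreal (norm (deriv f z) * kern a z)"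
    by (simp only: one_minus_disc_auto[OF assms z] mult.assoc powr_one norm_ge_zero)
qed

lemma BMOA_norm_nonneg: "0 \<le> BMOA_norm p f"
  by (simp add: BMOA_norm_def)

text \<open>The bound is a separate positive \<open>A\<close> because the norm itself may be 0.
  Membership in \<open>BMOA 2\<close> makes the supremum finite, so \<open>enn2real\<close> loses
  nothing.\<close>

lemma BMOA_imp_bmoa_bound:
  assumes f: "f \<in> BMOA 2" and A: "0 < A" "BMOA_norm 2 f \<le> A"
  shows "bmoa_bound f A"
proof -
  define S where "S = (SUP a\<in>ball 0 1. BMOA_integral 2 f a)"
  have hol: "f holomorphic_on ball 0 1" and S: "S < \<infinity>"
    using f by (auto simp: BMOA_def S_def)
  have "sqrt ((norm (f 0))\<^sup>2 + enn2real S) \<le> A"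
    using A(2) by (simp add: BMOA_norm_def S_def[symmetric] powr_half_sqrt)
  then have le: "(norm (f 0))\<^sup>2 + enn2real S \<le> A\<^sup>2"
    using A(1) by (simp add: real_sqrt_le_iff' real_le_lsqrt sqrt_le_D)
  have "(norm (f 0))\<^sup>2 \<le> A\<^sup>2" using le enn2real_nonneg[of S] by linarith
  then have "norm (f 0) \<le> A" using A(1) by (rule power2_le_imp_le[OF _ less_imp_le])
  moreover have "BMOA_integral 2 f a \<le> ennreal (A\<^sup>2)" if "norm a < 1" for a
  proof -
    have "BMOA_integral 2 f a \<le> S" unfolding S_def using that by (intro SUP_upper) simp
    also have "\<dots> = ennreal (enn2real S)" using S by simp
    also have "\<dots> \<le> ennreal (A\<^sup>2)" using le by (intro ennreal_leI) (smt (verit) zero_le_power2)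
    finally show ?thesis .
  qed
  ultimately show ?thesis using hol A(1) by (simp add: bmoa_bound_def BMOA_integral_2)
qed

text \<open>The value at 0 and the supremum each contribute at most A^2; the factor 2 leaves room
  for their sum.\<close>

lemma bmoa_bound_imp_BMOA:
  assumes f: "bmoa_bound f A"
  shows "f \<in> BMOA 2" "BMOA_norm 2 f \<le> 2 * A"
proof -
  note D = bmoa_boundD[OF f]
  define S where "S = (SUP a\<in>ball 0 1. BMOA_integral 2 f a)"
  have S: "S \<le> ennreal (A\<^sup>2)" unfolding S_def
    by (rule SUP_least) (simp add: BMOA_integral_2 D(4))
  then show "f \<in> BMOA 2" using D(1) by (auto simp: BMOA_def S_def intro: le_less_trans)
  have "enn2real S \<le> A\<^sup>2" using S by (simp add: enn2real_leI)
  moreover have "(norm (f 0))\<^sup>2 \<le> A\<^sup>2" using D by (intro power_mono) auto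
  moreover have "0 \<le> A\<^sup>2" "(2 * A)\<^sup>2 = 4 * A\<^sup>2" by simp_all
  ultimately have "(norm (f 0))\<^sup>2 + enn2real S \<le> (2 * A)\<^sup>2" by linarith
  then have "sqrt ((norm (f 0))\<^sup>2 + enn2real S) \<le> 2 * A" using D(2) by (intro real_le_lsqrt) auto
  then show "BMOA_norm 2 f \<le> 2 * A" by (simp add: BMOA_norm_def S_def[symmetric] powr_half_sqrt)
qed

lemma T_op_0 [simp]: "T_op g f 0 = 0"
  by (simp add: T_op_def)

lemma T_op_has_field_derivative:
  assumes f: "f holomorphic_on ball 0 1" and g: "g holomorphic_on ball 0 1" and z: "norm z < 1"
  shows "(T_op g f has_field_derivative f z * deriv g z) (at z)"
proof -
  have hol: "(\<lambda>z. f z * deriv g z) holomorphic_on ball 0 1"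
    by (intro holomorphic_intros f holomorphic_deriv[OF g open_ball])
  obtain F where F: "\<And>z. z \<in> ball 0 1 \<Longrightarrow> (F has_field_derivative f z * deriv g z) (at z within ball 0 1)"
    using holomorphic_convex_primitive'[OF convex_ball open_ball hol] by blast
  have eq: "T_op g f w = F w - F 0" if "w \<in> ball 0 1" for w
  proof -
    have "((\<lambda>z. f z * deriv g z) has_contour_integral (F (pathfinish (linepath 0 w)) - F (pathstart (linepath 0 w)))) (linepath 0 w)"
      using that closed_segment_subset[of 0 "ball (0::complex) 1" w] by (intro contour_integral_primitive[OF F]) auto
    then show ?thesis unfolding T_op_def by (simp add: contour_integral_unique)
  qed
  have "(F has_field_derivative f z * deriv g z) (at z)"
    using F[of z] z by (simp add: at_within_open[OF _ open_ball])
  then have "((\<lambda>w. F w - F 0) has_field_derivative f z * deriv g z) (at z)"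
    by (auto intro!: derivative_eq_intros)
  then show ?thesis
    by (rule has_field_derivative_transform_within_open[where S = "ball 0 1"]) (use z eq in auto)
qed

lemma deriv_T_op:
  assumes "f holomorphic_on ball 0 1" "g holomorphic_on ball 0 1" "norm z < 1"
  shows "deriv (T_op g f) z = f z * deriv g z"
  by (rule DERIV_imp_deriv[OF T_op_has_field_derivative[OF assms]])

lemma T_op_holomorphic:
  assumes "f holomorphic_on ball 0 1" "g holomorphic_on ball 0 1"
  shows "T_op g f holomorphic_on ball 0 1"
  unfolding holomorphic_on_open[OF open_ball] using T_op_has_field_derivative[OF assms] by (metis mem_ball_0)

lemma BMOA_integral_T_op:
  assumes f: "f holomorphic_on ball 0 1" and g: "g holomorphic_on ball 0 1" and a: "norm a < 1"
  shows "BMOA_integral 1 (T_op g f) a = (\<integral>\<^sup>+z. ennreal (norm (f z) * kern a z) * ennreal (norm (deriv g z)) \<partial>disc_measure)"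
  unfolding BMOA_integral_1[OF a]
  using a by (intro nn_integral_cong)
    (simp add: deriv_T_op[OF f g] norm_mult kern_nonneg ennreal_mult mult_ac)

section \<open>Test functions\<close>

text \<open>
  On the Carleson square below \<open>w\<close> this is as large as the logarithm itself, but it tends to 0 locally
  uniformly as \<open>|w| \<rightarrow> 1\<close>.
\<close>

definition test_fun :: "complex \<Rightarrow> complex \<Rightarrow> complex" where
  "test_fun w z = (Ln (12 / (1 - cnj w * z)))\<^sup>2 / of_real (ln (12 / (1 - norm w)))"

text \<open>The argument of \<open>Ln\<close> stays in the right half plane with modulus at least 6,
  so the principal branch is holomorphic and the real part of its logarithm is positive. The 4
  bounds the imaginary part, at most pi, and L \<ge> 2 absorbs it into 3 L.\<close>

lemma test_fun_basic:
  assumes w: "norm w < 1" and z: "norm z < 1"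
  defines "x \<equiv> norm (1 - cnj w * z)" and "L \<equiv> ln (12 / (1 - norm w))"
  shows "0 < Re (12 / (1 - cnj w * z))" "2 \<le> L"
    "norm (Ln (12 / (1 - cnj w * z))) \<le> ln (12 / x) + 4"
    "\<bar>ln (12 / x)\<bar> \<le> norm (Ln (12 / (1 - cnj w * z)))"
    "norm (Ln (12 / (1 - cnj w * z))) \<le> 3 * L"
proof -
  have "norm (cnj w * z) < 1" using mult_strict_mono[of "norm w" 1 "norm z" 1] w z by (simp add: norm_mult)
  then have "Re (cnj w * z) < 1" using complex_Re_le_cmod[of "cnj w * z"] by linarith
  then have re: "0 < Re (1 - cnj w * z)" by simp
  have ne: "1 - cnj w * z \<noteq> 0" by (rule one_minus_cnj_mult_nonzero(1)[OF w z])
  have "Re (12 / (1 - cnj w * z)) = 12 * Re (1 - cnj w * z) / (cmod (1 - cnj w * z))\<^sup>2"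
    by (simp add: Re_divide cmod_power2)
  then show "0 < Re (12 / (1 - cnj w * z))" using re ne by simp
  have ln12: "2 \<le> ln (12::real)"
  proof -
    have "2 \<le> 3 * ln (2::real)" using ln2_ge_two_thirds by simp
    also have "\<dots> = ln (2 ^ 3)" by (subst ln_realpow) simp_all
    also have "\<dots> \<le> ln 12" by (subst ln_le_cancel_iff) auto
    finally show ?thesis .
  qed
  have "ln 12 \<le> L" unfolding L_def using w by (subst ln_le_cancel_iff) (auto simp: field_simps)
  with ln12 show L2: "2 \<le> L" by linarith
  have x: "0 < x" "x \<le> 2" using ne one_minus_cnj_mult_upper[of z w] w z by (auto simp: x_def)
  have nz: "12 / (1 - cnj w * z) \<noteq> 0" using ne by simp
  have nm: "norm (12 / (1 - cnj w * z)) = 12 / x" by (simp add: norm_divide x_def)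
  have re: "Re (Ln (12 / (1 - cnj w * z))) = ln (12 / x)" using Re_Ln[OF nz] nm by simp
  then show "\<bar>ln (12 / x)\<bar> \<le> norm (Ln (12 / (1 - cnj w * z)))" by (metis abs_Re_le_cmod)
  have "0 \<le> ln (12 / x)" using x by simp
  moreover have "norm (Ln (12 / (1 - cnj w * z))) \<le> \<bar>Re (Ln (12 / (1 - cnj w * z)))\<bar> + \<bar>Im (Ln (12 / (1 - cnj w * z)))\<bar>"
    by (rule cmod_le)
  moreover have "\<bar>Im (Ln (12 / (1 - cnj w * z)))\<bar> \<le> 4"
    using mpi_less_Im_Ln[OF nz] Im_Ln_le_pi[OF nz] pi_less_4 by linarith
  ultimately show le: "norm (Ln (12 / (1 - cnj w * z))) \<le> ln (12 / x) + 4" using re by linarith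
  have "1 - norm w \<le> x" using one_minus_cnj_mult_lower[of z w] z by (simp add: x_def)
  then have "ln (12 / x) \<le> L" unfolding L_def using w x
    by (subst ln_le_cancel_iff) (auto intro!: divide_left_mono)
  then show "norm (Ln (12 / (1 - cnj w * z))) \<le> 3 * L" using le L2 by linarith
qed

lemma test_fun_deriv:
  assumes w: "norm w < 1" and z: "norm z < 1"
  shows "(test_fun w has_field_derivative
    2 * Ln (12 / (1 - cnj w * z)) * (cnj w / (1 - cnj w * z)) / of_real (ln (12 / (1 - norm w)))) (at z)"
proof -
  note B = test_fun_basic[OF w z]
  have ne: "1 - cnj w * z \<noteq> 0" using one_minus_cnj_mult_nonzero(1)[OF w z] .
  have notin: "12 / (1 - cnj w * z) \<notin> \<real>\<^sub>\<le>\<^sub>0"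
    using B(1) by (auto simp: complex_nonpos_Reals_iff)
  have "((\<lambda>z. 1 - cnj w * z) has_field_derivative - cnj w) (at z)"
    by (auto intro!: derivative_eq_intros)
  from DERIV_divide[OF DERIV_const[of 12] this ne]
  have "((\<lambda>z. 12 / (1 - cnj w * z)) has_field_derivative 12 * cnj w / ((1 - cnj w * z) * (1 - cnj w * z))) (at z)"
    by simp
  from DERIV_chain2[OF has_field_derivative_Ln[OF notin] this]
  have "((\<lambda>z. Ln (12 / (1 - cnj w * z))) has_field_derivative cnj w / (1 - cnj w * z)) (at z)"
  proof (rule DERIV_cong)
    have "inverse (12 / u) * (12 * c / (u * u)) = c / u" if "u \<noteq> 0" for u c :: complex
      using that by simp
    from this[OF ne] show "inverse (12 / (1 - cnj w * z)) * (12 * cnj w / ((1 - cnj w * z) * (1 - cnj w * z))) = cnj w / (1 - cnj w * z)" .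
  qed
  from DERIV_cdivide[OF DERIV_power[OF this, of 2], of "of_real (ln (12 / (1 - norm w)))"]
  show ?thesis by (simp add: test_fun_def[abs_def] mult_ac)
qed

lemma test_fun_holomorphic: "norm w < 1 \<Longrightarrow> test_fun w holomorphic_on ball 0 1"
  unfolding holomorphic_on_open[OF open_ball] using test_fun_deriv by (metis mem_ball_0)

text \<open>Two ways to spend the squared logarithm N^2: bounding one factor by 3 L removes L and
  gives an estimate uniform in w; bounding N through the position of z retains 1 / L and gives decay
  on compact sets.\<close>

lemma norm_deriv_test_fun:
  assumes w: "norm w < 1" and z: "norm z < 1"
  shows "norm (deriv (test_fun w) z) \<le> 6 / norm (1 - cnj w * z)"
    and "norm (deriv (test_fun w) z) \<le> 2 * (ln (12 / (1 - norm z)) + 4) / (1 - norm z) / ln (12 / (1 - norm w))"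
    and "norm (test_fun w z) \<le> (ln (12 / (1 - norm z)) + 4)\<^sup>2 / ln (12 / (1 - norm w))"
proof -
  note B = test_fun_basic[OF w z]
  define x where "x = norm (1 - cnj w * z)"
  define L where "L = ln (12 / (1 - norm w))"
  define N where "N = norm (Ln (12 / (1 - cnj w * z)))"
  have L: "2 \<le> L" using B(2) by (simp add: L_def)
  have x: "0 < x" using one_minus_cnj_mult_nonzero(1)[OF w z] by (simp add: x_def)
  have d: "norm (deriv (test_fun w) z) = 2 * N * (norm w / x) / L"
    using L by (simp add: DERIV_imp_deriv[OF test_fun_deriv[OF w z]] norm_mult norm_divide N_def x_def L_def)
  have N: "0 \<le> N" "N \<le> 3 * L" using B(5) by (auto simp: N_def L_def)
  have "2 * N * (norm w / x) / L \<le> 2 * (3 * L) * (1 / x) / L"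
    using N x L w by (intro divide_right_mono mult_mono) auto
  then show "norm (deriv (test_fun w) z) \<le> 6 / norm (1 - cnj w * z)"
    using d L by (simp add: x_def)
  have xz: "1 - norm z \<le> x" using one_minus_cnj_mult_lower[of w z] w
    by (metis less_eq_real_def norm_one_minus_cnj_swap mult.commute x_def)
  have "ln (12 / x) \<le> ln (12 / (1 - norm z))"
    using x xz z by (subst ln_le_cancel_iff) (auto intro!: divide_left_mono)
  then have Nz: "N \<le> ln (12 / (1 - norm z)) + 4" using B(3) by (simp add: N_def x_def)
  have "2 * N * (norm w / x) / L \<le> 2 * (ln (12 / (1 - norm z)) + 4) * (1 / (1 - norm z)) / L"
    using N Nz x xz z L w by (intro divide_right_mono mult_mono frac_le) auto
  then show "norm (deriv (test_fun w) z) \<le> 2 * (ln (12 / (1 - norm z)) + 4) / (1 - norm z) / ln (12 / (1 - norm w))"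
    using d by (simp add: L_def)
  have "norm (test_fun w z) = N\<^sup>2 / L" using L by (simp add: test_fun_def norm_divide norm_power N_def L_def)
  also have "\<dots> \<le> (ln (12 / (1 - norm z)) + 4)\<^sup>2 / L"
    using N Nz L by (intro divide_right_mono power_mono) auto
  finally show "norm (test_fun w z) \<le> (ln (12 / (1 - norm z)) + 4)\<^sup>2 / ln (12 / (1 - norm w))"
    by (simp add: L_def)
qed

text \<open>The uniform bound 6 / |1 - conj w z| on the derivative reduces the energy to
  \<open>nn_integral_two_kernels\<close>, and 36 * 4 = 12^2.\<close>

lemma bmoa_bound_test_fun:
  assumes w: "norm w < 1"
  shows "bmoa_bound (test_fun w) 12"
  unfolding bmoa_bound_def
proof (intro conjI allI impI)
  show "test_fun w holomorphic_on ball 0 1" by (rule test_fun_holomorphic[OF w])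
  have L: "ln 12 \<le> ln (12 / (1 - norm w))" using w by (subst ln_le_cancel_iff) (auto simp: field_simps)
  have l12: "0 < ln (12::real)" by simp
  have "norm (test_fun w 0) = ln 12 * (ln 12 / ln (12 / (1 - norm w)))"
  proof -
    have "Ln 12 = complex_of_real (ln 12)" using Ln_of_real[of 12] by simp
    moreover have "0 < ln (12 / (1 - norm w))" using L l12 by linarith
    ultimately show ?thesis
      using l12 by (simp add: test_fun_def norm_divide norm_mult power2_eq_square)
  qed
  also have "\<dots> \<le> ln 12 * 1"
    using L l12 order.strict_trans2[OF l12 L] by (intro mult_left_mono) (simp_all only: divide_le_eq_1_pos less_imp_le)
  also have "\<dots> \<le> 12" using ln_le_minus_one[of "12::real"] by simp
  finally show "norm (test_fun w 0) \<le> 12" .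
  fix a :: complex assume a: "norm a < 1"
  have "(\<integral>\<^sup>+z. energy_density (test_fun w) a z \<partial>disc_measure)
     \<le> (\<integral>\<^sup>+z. ennreal 36 * ennreal ((1 - (norm z)\<^sup>2) * kern a z / (norm (1 - cnj w * z))\<^sup>2) \<partial>disc_measure)"
  proof (rule nn_integral_mono)
    fix z assume "z \<in> space disc_measure"
    then have z: "norm z < 1" by simp
    note p = one_minus_norm_square_pos[OF z]
    have k: "0 \<le> kern a z" using a by (intro kern_nonneg) simp
    have "(norm (deriv (test_fun w) z))\<^sup>2 \<le> (6 / norm (1 - cnj w * z))\<^sup>2"
      by (intro power_mono norm_deriv_test_fun(1) w z) auto
    then have "(norm (deriv (test_fun w) z))\<^sup>2 * ((1 - (norm z)\<^sup>2) * kern a z) \<le> (6 / norm (1 - cnj w * z))\<^sup>2 * ((1 - (norm z)\<^sup>2) * kern a z)"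
      using k less_imp_le[OF p] by (intro mult_right_mono mult_nonneg_nonneg) auto
    then have "energy_density (test_fun w) a z \<le> ennreal (36 * ((1 - (norm z)\<^sup>2) * kern a z / (norm (1 - cnj w * z))\<^sup>2))"
      by (intro ennreal_leI) (simp add: power_divide mult.assoc)
    then show "energy_density (test_fun w) a z \<le> ennreal 36 * ennreal ((1 - (norm z)\<^sup>2) * kern a z / (norm (1 - cnj w * z))\<^sup>2)"
      by (subst (asm) ennreal_mult') auto
  qed
  also have "\<dots> = ennreal 36 * (\<integral>\<^sup>+z. ennreal ((1 - (norm z)\<^sup>2) * kern a z / (norm (1 - cnj w * z))\<^sup>2) \<partial>disc_measure)"
    by (rule nn_integral_cmult, rule measurable_disc_borel) measurable
  also have "\<dots> \<le> ennreal 36 * ennreal 4"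
    using nn_integral_two_kernels[OF w a] by (intro mult_left_mono) auto
  also have "\<dots> = ennreal (12\<^sup>2)" by (subst ennreal_mult[symmetric]) auto
  finally show "(\<integral>\<^sup>+z. energy_density (test_fun w) a z \<partial>disc_measure) \<le> ennreal (12\<^sup>2)" .
qed simp

text \<open>Here the 12 of the test function is fixed: 12 / (6 t) = 2 / t, so its logarithm has size
  at least ln (2 / t). The normalization costs the factor 4, since ln (12 / t) = ln 6 + ln (2 / t)
  and ln 6 \<le> 3 ln 2 \<le> 3 ln (2 / t).\<close>

lemma norm_test_fun_ge:
  assumes w: "norm w = 1 - t" and t: "0 < t" "t \<le> 1" and z: "norm z < 1" and x: "norm (1 - cnj w * z) \<le> 6 * t"
  shows "ln (2 / t) / 4 \<le> norm (test_fun w z)"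
proof -
  have w1: "norm w < 1" using w t by simp
  define X where "X = norm (1 - cnj w * z)"
  have X: "0 < X" "X \<le> 6 * t" using one_minus_cnj_mult_nonzero(1)[OF w1 z] x by (auto simp: X_def)
  define l where "l = ln (2 / t)"
  have "ln 2 \<le> l" unfolding l_def using t by (subst ln_le_cancel_iff) (auto simp: field_simps)
  moreover have l2: "0 < ln (2::real)" by simp
  ultimately have l: "0 < l" by linarith
  have "ln (12 / t) = ln 6 + l"
  proof -
    have "12 / t = 6 * (2 / t)" by simp
    then show ?thesis unfolding l_def using t ln_mult[of 6 "2 / t"] by (simp only:) simp
  qed
  moreover have "ln (6::real) \<le> 3 * ln 2"
  proof -
    have "ln (6::real) \<le> ln (2 ^ 3)" by (subst ln_le_cancel_iff) auto
    also have "ln ((2::real) ^ 3) = 3 * ln 2" by (subst ln_realpow) simp_all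
    finally show ?thesis .
  qed
  ultimately have L: "ln (12 / t) \<le> 4 * l" "0 < ln (12 / t)" using \<open>ln 2 \<le> l\<close> l
    by (auto simp: add_pos_pos)
  have "l \<le> ln (12 / X)" unfolding l_def using X t by (subst ln_le_cancel_iff) (auto simp: field_simps)
  then have "l \<le> norm (Ln (12 / (1 - cnj w * z)))"
    using test_fun_basic(4)[OF w1 z] by (simp add: X_def)
  then have "l\<^sup>2 / ln (12 / t) \<le> (norm (Ln (12 / (1 - cnj w * z))))\<^sup>2 / ln (12 / t)"
    using l L by (intro divide_right_mono power_mono) auto
  also have "\<dots> = norm (test_fun w z)" using L(2) by (simp add: test_fun_def norm_divide norm_power w)
  finally have "l\<^sup>2 / ln (12 / t) \<le> norm (test_fun w z)" .
  moreover have "l / 4 \<le> l\<^sup>2 / ln (12 / t)"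
    using L l by (simp add: field_simps power2_eq_square)
  ultimately show ?thesis unfolding l_def by (rule order_trans[rotated])
qed

lemma carleson_square_measure_le:
  assumes "carleson_square I \<subseteq> A \<inter> ball 0 1"
  shows "(\<integral>\<^sup>+z\<in>carleson_square I. F z \<partial>disc_area) \<le> (\<integral>\<^sup>+z. F z * indicator A z \<partial>disc_measure)"
  unfolding nn_integral_disc_measure
  using assms by (intro nn_integral_mono) (auto simp: indicator_def)

text \<open>On the square the test function is at least ln (2 / t) / 4 and the kernel at w at least
  1 / (36 t); hence 4 * 36 = 144. The same point \<open>w\<close> serves as parameter of the test
  function and as base point.\<close>

lemma log_carleson_quotient_le_test:
  assumes g: "g holomorphic_on ball 0 1" and I: "I \<in> circle_arcs"
  shows "\<exists>w. norm w = 1 - arc_length I \<and> norm w < 1 \<and>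
    log_carleson_quotient g I \<le> ennreal 144 * BMOA_integral 1 (T_op g (test_fun w)) w"
proof -
  define t where "t = arc_length I"
  note arc = circle_arc_subset_tent[OF I, folded t_def]
  obtain w where w: "norm w = 1 - t" and sub: "\<And>z. z \<in> carleson_square I \<Longrightarrow> norm z < 1 \<and> norm (1 - cnj w * z) \<le> 6 * t"
    using arc(3) by blast
  have w1: "norm w < 1" using w arc by simp
  note [measurable] = measurable_disc_deriv[OF g] measurable_disc_holomorphic[OF test_fun_holomorphic[OF w1]]
  define A where "A = {z. norm (1 - cnj w * z) \<le> 6 * t}"
  have [measurable]: "(\<lambda>z. indicator A z :: ennreal) \<in> borel_measurable disc_measure" "kern w \<in> borel_measurable disc_measure"
    unfolding A_def by (rule measurable_disc_borel, measurable)+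
  have "log_carleson_quotient g I \<le> ennreal (ln (2 / t) / t) * (\<integral>\<^sup>+z. ennreal (norm (deriv g z)) * indicator A z \<partial>disc_measure)"
    unfolding log_carleson_quotient_def t_def[symmetric]
    using sub by (intro mult_left_mono carleson_square_measure_le) (auto simp: A_def)
  also have "\<dots> = (\<integral>\<^sup>+z. ennreal (ln (2 / t) / t) * (ennreal (norm (deriv g z)) * indicator A z) \<partial>disc_measure)"
    by (rule nn_integral_cmult[symmetric]) measurable
  also have "\<dots> \<le> (\<integral>\<^sup>+z. ennreal 144 * (ennreal (norm (test_fun w z) * kern w z) * ennreal (norm (deriv g z))) \<partial>disc_measure)"
  proof (rule nn_integral_mono)
    fix z assume "z \<in> space disc_measure"
    then have z: "norm z < 1" by simp
    show "ennreal (ln (2 / t) / t) * (ennreal (norm (deriv g z)) * indicator A z)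
      \<le> ennreal 144 * (ennreal (norm (test_fun w z) * kern w z) * ennreal (norm (deriv g z)))"
    proof (cases "z \<in> A")
      case True
      then have x: "norm (1 - cnj w * z) \<le> 6 * t" by (simp add: A_def)
      have X: "0 < norm (1 - cnj w * z)" using one_minus_cnj_mult_nonzero(1)[OF w1 z] by simp
      have "1 / (36 * t) = t / (6 * t)\<^sup>2" using arc by (simp add: power2_eq_square)
      also have "\<dots> \<le> (1 - (norm w)\<^sup>2) / (norm (1 - cnj w * z))\<^sup>2"
      proof (rule frac_le)
        have "t * t \<le> t" using arc by (intro mult_left_le) auto
        then show "t \<le> 1 - (norm w)\<^sup>2" by (simp add: w power2_eq_square algebra_simps)
        show "(norm (1 - cnj w * z))\<^sup>2 \<le> (6 * t)\<^sup>2" using x by (intro power_mono) auto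
      qed (use X arc w1 in \<open>auto simp: power_le_one\<close>)
      finally have k: "1 / (36 * t) \<le> kern w z" by (simp add: kern_def)
      have "ln (2 / t) / 4 * (1 / (36 * t)) \<le> norm (test_fun w z) * kern w z"
        using norm_test_fun_ge[OF w arc(1,2) z x] k arc by (intro mult_mono) auto
      then have le: "ln (2 / t) / t \<le> 144 * (norm (test_fun w z) * kern w z)" using arc by (simp add: field_simps)
      have "ennreal (ln (2 / t) / t) * ennreal (norm (deriv g z)) \<le> ennreal (144 * (norm (test_fun w z) * kern w z)) * ennreal (norm (deriv g z))"
        by (intro mult_right_mono ennreal_leI le) auto
      then show ?thesis using True by (simp add: ennreal_mult' mult.assoc)
    qed simp
  qed
  also have "\<dots> = ennreal 144 * BMOA_integral 1 (T_op g (test_fun w)) w"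
    unfolding BMOA_integral_T_op[OF test_fun_holomorphic[OF w1] g w1]
    by (rule nn_integral_cmult) measurable
  finally show ?thesis using w w1 by (auto simp: t_def)
qed

section \<open>Boundedness\<close>

abbreviation deriv_density :: "(complex \<Rightarrow> complex) \<Rightarrow> complex \<Rightarrow> ennreal" where
  "deriv_density g z \<equiv> ennreal (norm (deriv g z))"

lemma measurable_deriv_density:
  "g holomorphic_on ball 0 1 \<Longrightarrow> deriv_density g \<in> borel_measurable disc_measure"
  using measurable_disc_deriv[of g] by measurable

lemma ennreal_tendsto_0I:
  assumes "\<And>e::real. 0 < e \<Longrightarrow> eventually (\<lambda>x. f x \<le> ennreal e) F"
  shows "(f \<longlongrightarrow> (0::ennreal)) F"
proof (rule order_tendstoI)
  fix a :: ennreal assume "0 < a"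
  then obtain y where y: "0 < y" "y < a" using dense by blast
  then have "y < top" using less_le_trans top_greatest by blast
  then obtain r where r: "y = ennreal r" "0 \<le> r" by (cases y) auto
  then have "0 < r" using y by (simp add: ennreal_less_zero_iff)
  from assms[OF this] show "eventually (\<lambda>x. f x < a) F"
    by eventually_elim (use r y in auto)
qed simp

lemma ennreal_tendsto_0D:
  assumes "(f \<longlongrightarrow> (0::ennreal)) F" and "0 < e"
  shows "eventually (\<lambda>x. f x < ennreal e) F"
  using order_tendstoD(2)[OF assms(1), of "ennreal e"] assms(2) by simp

text \<open>A tent of width t fits into the square over an arc of length exactly t. Arcs are
  restricted to length at most \<open>t0\<close> so that the bounded and the vanishing condition can
  share this estimate.\<close>

lemma tent_mass_le:
  assumes arcs: "\<And>I. I \<in> circle_arcs \<Longrightarrow> arc_length I \<le> t0 \<Longrightarrow> log_carleson_quotient g I \<le> ennreal \<epsilon>"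
    and \<epsilon>: "0 \<le> \<epsilon>" and t: "0 < t" "t \<le> t0" "t0 \<le> 3 / 4" and w: "norm w \<le> 1"
  shows "(\<integral>\<^sup>+z. deriv_density g z * indicator (tent w t) z \<partial>disc_measure) \<le> ennreal (\<epsilon> * t / ln (2 / t))"
proof -
  obtain I where I: "I \<in> circle_arcs" "arc_length I = t" "tent w t \<inter> ball 0 1 \<subseteq> carleson_square I"
    using tent_subset_carleson_square[OF w t(1)] t by force
  define X where "X = (\<integral>\<^sup>+z\<in>carleson_square I. deriv_density g z \<partial>disc_area)"
  define c where "c = ln (2 / t) / t"
  have c: "0 < c" using t by (simp add: c_def)
  have le: "ennreal c * X \<le> ennreal \<epsilon>"
    using arcs[OF I(1)] t I(2) by (simp add: log_carleson_quotient_def X_def c_def)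
  have "(\<integral>\<^sup>+z. deriv_density g z * indicator (tent w t) z \<partial>disc_measure) \<le> X"
    unfolding nn_integral_disc_measure X_def using I(3)
    by (intro nn_integral_mono) (auto simp: indicator_def)
  also have "X = ennreal (1 / c) * (ennreal c * X)"
    using c by (simp add: mult.assoc[symmetric] flip: ennreal_mult)
  also have "\<dots> \<le> ennreal (1 / c) * ennreal \<epsilon>" by (intro mult_left_mono le) simp
  also have "\<dots> = ennreal (1 / c * \<epsilon>)" using c by (intro ennreal_mult'[symmetric]) simp
  also have "1 / c * \<epsilon> = \<epsilon> * t / ln (2 / t)" by (simp add: c_def)
  finally show ?thesis .
qed

text \<open>By compactness finitely many tents centred on the circle cover it; each has finite mass,
  and what they leave of the closed disc is a compact subset of the open disc, on which g' is
  bounded.\<close>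

lemma deriv_mass_finite:
  assumes g: "g holomorphic_on ball 0 1"
    and arcs: "\<And>I. I \<in> circle_arcs \<Longrightarrow> arc_length I \<le> t0 \<Longrightarrow> log_carleson_quotient g I \<le> ennreal \<epsilon>"
    and \<epsilon>: "0 \<le> \<epsilon>" and t: "0 < t0" "t0 \<le> 3 / 4"
  shows "(\<integral>\<^sup>+z. deriv_density g z \<partial>disc_measure) < \<infinity>"
proof -
  note [measurable] = measurable_deriv_density[OF g]
  have op: "open (tent \<zeta> t0)" for \<zeta>
    unfolding tent_def by (intro open_Collect_less continuous_intros)
  have "compact (sphere (0::complex) 1)" by simp
  moreover have "sphere 0 1 \<subseteq> (\<Union>\<zeta>\<in>sphere 0 1. tent \<zeta> t0)"
  proof
    fix \<zeta> :: complex assume \<zeta>: "\<zeta> \<in> sphere 0 1"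
    then have "1 - cnj \<zeta> * \<zeta> = 0" using complex_norm_square[of \<zeta>] by (simp add: mult.commute)
    then show "\<zeta> \<in> (\<Union>\<zeta>\<in>sphere 0 1. tent \<zeta> t0)" using \<zeta> t by (intro UN_I[of \<zeta>]) (auto simp: tent_def)
  qed
  ultimately obtain F where F: "F \<subseteq> sphere 0 1" "finite F" "sphere 0 1 \<subseteq> (\<Union>\<zeta>\<in>F. tent \<zeta> t0)"
    using op by (metis compactE_image)
  define K where "K = cball 0 1 - (\<Union>\<zeta>\<in>F. tent \<zeta> t0)"
  have "compact K" unfolding K_def using op by (intro compact_diff) auto
  moreover have K: "K \<subseteq> ball 0 1"
  proof
    fix z assume "z \<in> K"
    then show "z \<in> ball 0 1" using F(3) by (cases "norm z = 1") (auto simp: K_def)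
  qed
  ultimately have "bounded (deriv g ` K)"
    by (intro compact_imp_bounded compact_continuous_image holomorphic_on_imp_continuous_on
        holomorphic_on_subset[OF holomorphic_deriv[OF g open_ball]])
  then obtain M where M: "\<And>z. z \<in> K \<Longrightarrow> norm (deriv g z) \<le> M" by (auto simp: bounded_iff)
  have indm: "(\<lambda>z. indicator (tent \<zeta> t0) z :: ennreal) \<in> borel_measurable disc_measure" for \<zeta>
    by (rule measurable_disc_borel) measurable
  have "(\<integral>\<^sup>+z. deriv_density g z \<partial>disc_measure)
    \<le> (\<integral>\<^sup>+z. ennreal M + (\<Sum>\<zeta>\<in>F. deriv_density g z * indicator (tent \<zeta> t0) z) \<partial>disc_measure)"
  proof (rule nn_integral_mono)
    fix z assume "z \<in> space disc_measure"
    then have z: "norm z < 1" by simp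
    show "deriv_density g z \<le> ennreal M + (\<Sum>\<zeta>\<in>F. deriv_density g z * indicator (tent \<zeta> t0) z)"
    proof (cases "z \<in> K")
      case True
      then show ?thesis using M by (intro add_increasing2 ennreal_leI) auto
    next
      case False
      then obtain \<zeta> where \<zeta>: "\<zeta> \<in> F" "z \<in> tent \<zeta> t0" using z by (auto simp: K_def)
      then have "deriv_density g z = deriv_density g z * indicator (tent \<zeta> t0) z" by simp
      also have "\<dots> \<le> (\<Sum>\<zeta>\<in>F. deriv_density g z * indicator (tent \<zeta> t0) z)"
        using \<zeta> F(2) by (intro member_le_sum[where f = "\<lambda>\<zeta>. deriv_density g z * indicator (tent \<zeta> t0) z"]) auto
      finally show ?thesis by (intro add_increasing) auto
    qed
  qed
  also have "\<dots> = ennreal M + (\<Sum>\<zeta>\<in>F. \<integral>\<^sup>+z. deriv_density g z * indicator (tent \<zeta> t0) z \<partial>disc_measure)"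
    using indm by (simp add: nn_integral_add nn_integral_sum)
  also have "\<dots> < \<infinity>"
  proof -
    have "(\<integral>\<^sup>+z. deriv_density g z * indicator (tent \<zeta> t0) z \<partial>disc_measure) < top" if "\<zeta> \<in> F" for \<zeta>
    proof -
      have "norm \<zeta> \<le> 1" using that F(1) by auto
      from tent_mass_le[OF arcs \<epsilon> t(1) order_refl t(2) this] show ?thesis
        by (rule le_less_trans) auto
    qed
    then show ?thesis by (simp add: ennreal_add_less_top F(2))
  qed
  finally show ?thesis .
qed

lemma deriv_mass_tail:
  assumes g: "g holomorphic_on ball 0 1" and fin: "(\<integral>\<^sup>+z. deriv_density g z \<partial>disc_measure) < \<infinity>" and e: "0 < e"
  shows "\<exists>\<rho>. 0 \<le> \<rho> \<and> \<rho> < 1 \<and> (\<integral>\<^sup>+z. deriv_density g z * indicator {z. \<rho> < norm z} z \<partial>disc_measure) \<le> ennreal e"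
proof -
  note [measurable] = measurable_deriv_density[OF g]
  define \<rho> where "\<rho> n = 1 - 1 / (real n + 1)" for n
  have \<rho>: "0 \<le> \<rho> n" "\<rho> n < 1" for n by (auto simp: \<rho>_def field_simps)
  have \<rho>1: "\<rho> \<longlonglongrightarrow> 1"
    unfolding \<rho>_def using LIMSEQ_inverse_real_of_nat_add_minus[of 1] by (simp add: inverse_eq_divide add.commute)
  have [measurable]: "(\<lambda>z. indicator {z. \<rho> n < norm z} z :: ennreal) \<in> borel_measurable disc_measure" for n
    by (rule measurable_disc_borel) measurable
  have "(\<lambda>n. \<integral>\<^sup>+z. deriv_density g z * indicator {z. \<rho> n < norm z} z \<partial>disc_measure)
    \<longlonglongrightarrow> (\<integral>\<^sup>+z. 0 \<partial>disc_measure)"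
  proof (rule nn_integral_dominated_convergence[where w = "deriv_density g"])
    show "AE z in disc_measure. (\<lambda>n. deriv_density g z * indicator {z. \<rho> n < norm z} z) \<longlonglongrightarrow> 0"
    proof (rule AE_I2)
      fix z assume "z \<in> space disc_measure"
      then have "norm z < 1" by simp
      from order_tendstoD(1)[OF \<rho>1 this]
      have "eventually (\<lambda>n. deriv_density g z * indicator {z. \<rho> n < norm z} z = 0) sequentially"
        by eventually_elim auto
      then show "(\<lambda>n. deriv_density g z * indicator {z. \<rho> n < norm z} z) \<longlonglongrightarrow> 0"
        by (rule tendsto_eventually)
    qed
    show "AE z in disc_measure. deriv_density g z * indicator {z. \<rho> n < norm z} z \<le> deriv_density g z" for n
      by (rule AE_I2) (simp add: indicator_def)
    show "(\<integral>\<^sup>+z. deriv_density g z \<partial>disc_measure) < \<infinity>" by (rule fin)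
  qed measurable
  then have "(\<lambda>n. \<integral>\<^sup>+z. deriv_density g z * indicator {z. \<rho> n < norm z} z \<partial>disc_measure) \<longlonglongrightarrow> 0" by simp
  from ennreal_tendsto_0D[OF this e] obtain n
    where "(\<integral>\<^sup>+z. deriv_density g z * indicator {z. \<rho> n < norm z} z \<partial>disc_measure) < ennreal e"
    by (auto simp: eventually_sequentially)
  then show ?thesis using \<rho>[of n] by (intro exI[of _ "\<rho> n"]) auto
qed

lemma kern_le_inner:
  assumes "norm a < 1" "norm z \<le> \<rho>" "\<rho> < 1"
  shows "kern a z \<le> (1 - (norm a)\<^sup>2) / (1 - \<rho>)\<^sup>2"
proof -
  have "1 - \<rho> \<le> norm (1 - cnj a * z)"
    using one_minus_cnj_mult_lower[of a z] assms norm_one_minus_cnj_swap[of z a] by (simp add: mult.commute)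
  then show ?thesis unfolding kern_def using assms one_minus_norm_square_pos[of a]
    by (intro divide_left_mono power_mono mult_pos_pos zero_less_power) auto
qed

text \<open>Two possible sources of smallness are kept visible: \<open>B\<close> for functions that
  are small on the inner disc, and 1 - |a|^2 for base points near the circle.\<close>

lemma kern_inner_integral_le:
  assumes g: "g holomorphic_on ball 0 1" and f: "f \<in> borel_measurable disc_measure"
    and \<rho>: "\<rho> < 1" and B: "\<And>z. norm z \<le> \<rho> \<Longrightarrow> norm (f z) \<le> B" "0 \<le> B" and a: "norm a < 1"
    and m: "(\<integral>\<^sup>+z. deriv_density g z \<partial>disc_measure) \<le> ennreal m" "0 \<le> m"
  shows "(\<integral>\<^sup>+z. ennreal (norm (f z) * kern a z) * (deriv_density g z * indicator {z. norm z \<le> \<rho>} z) \<partial>disc_measure)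
    \<le> ennreal (B * ((1 - (norm a)\<^sup>2) / (1 - \<rho>)\<^sup>2) * m)"
proof -
  note [measurable] = measurable_deriv_density[OF g]
  have k: "0 \<le> (1 - (norm a)\<^sup>2) / (1 - \<rho>)\<^sup>2" using one_minus_norm_square_pos[OF a] by simp
  have "(\<integral>\<^sup>+z. ennreal (norm (f z) * kern a z) * (deriv_density g z * indicator {z. norm z \<le> \<rho>} z) \<partial>disc_measure)
    \<le> (\<integral>\<^sup>+z. ennreal (B * ((1 - (norm a)\<^sup>2) / (1 - \<rho>)\<^sup>2)) * deriv_density g z \<partial>disc_measure)"
  proof (rule nn_integral_mono)
    fix z
    show "ennreal (norm (f z) * kern a z) * (deriv_density g z * indicator {z. norm z \<le> \<rho>} z)
      \<le> ennreal (B * ((1 - (norm a)\<^sup>2) / (1 - \<rho>)\<^sup>2)) * deriv_density g z"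
    proof (cases "norm z \<le> \<rho>")
      case True
      have "norm (f z) * kern a z \<le> B * ((1 - (norm a)\<^sup>2) / (1 - \<rho>)\<^sup>2)"
        using B True kern_le_inner[OF a True \<rho>] kern_nonneg[of a z] a by (intro mult_mono) auto
      then show ?thesis using True by (auto intro!: mult_right_mono ennreal_leI)
    qed simp
  qed
  also have "\<dots> = ennreal (B * ((1 - (norm a)\<^sup>2) / (1 - \<rho>)\<^sup>2)) * (\<integral>\<^sup>+z. deriv_density g z \<partial>disc_measure)"
    by (rule nn_integral_cmult) measurable
  also have "\<dots> \<le> ennreal (B * ((1 - (norm a)\<^sup>2) / (1 - \<rho>)\<^sup>2)) * ennreal m"
    by (intro mult_left_mono m) simp
  also have "\<dots> = ennreal (B * ((1 - (norm a)\<^sup>2) / (1 - \<rho>)\<^sup>2) * m)"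
    using B(2) k m(2) by (intro ennreal_mult'[symmetric] mult_nonneg_nonneg)
  finally show ?thesis .
qed

lemma BMOA_norm_1: "BMOA_norm 1 h = norm (h 0) + enn2real (SUP a\<in>ball 0 1. BMOA_integral 1 h a)"
  by (simp add: BMOA_norm_def)

lemma BMOA_1_I:
  assumes "h holomorphic_on ball 0 1" "\<And>a. norm a < 1 \<Longrightarrow> BMOA_integral 1 h a \<le> ennreal B" "0 \<le> B"
  shows "h \<in> BMOA 1" "BMOA_norm 1 h \<le> norm (h 0) + B"
proof -
  have S: "(SUP a\<in>ball 0 1. BMOA_integral 1 h a) \<le> ennreal B"
    by (rule SUP_least) (use assms in auto)
  then show "h \<in> BMOA 1" using assms(1) by (auto simp: BMOA_def intro: le_less_trans)
  show "BMOA_norm 1 h \<le> norm (h 0) + B"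
    using S assms(3) by (simp add: BMOA_norm_1 enn2real_leI)
qed

lemma BMOA_1_integral_le:
  assumes "h \<in> BMOA 1" "norm a < 1"
  shows "BMOA_integral 1 h a \<le> ennreal (BMOA_norm 1 h)"
proof -
  define S where "S = (SUP a\<in>ball 0 1. BMOA_integral 1 h a)"
  have S: "S < \<infinity>" using assms(1) by (auto simp: BMOA_def S_def)
  have "BMOA_integral 1 h a \<le> S" unfolding S_def using assms(2) by (intro SUP_upper) simp
  also have "\<dots> = ennreal (enn2real S)" using S by simp
  also have "\<dots> \<le> ennreal (BMOA_norm 1 h)" by (intro ennreal_leI) (simp add: BMOA_norm_1 S_def)
  finally show ?thesis .
qed

lemma T_op_bound:
  assumes g: "g holomorphic_on ball 0 1" and f: "bmoa_bound f A" and \<Lambda>: "0 \<le> \<Lambda>"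
    and test: "\<And>w. norm w < 1 \<Longrightarrow> (\<integral>\<^sup>+z. ennreal (kern w z) * deriv_density g z \<partial>disc_measure) \<le> ennreal (\<Lambda> / log_weight w)"
    and a: "norm a < 1"
  shows "BMOA_integral 1 (T_op g f) a \<le> ennreal (12 * \<Lambda> * A)"
  unfolding BMOA_integral_T_op[OF bmoa_boundD(1)[OF f] g a]
  by (rule log_Carleson_embedding[OF f measurable_deriv_density[OF g] \<Lambda> test a])

lemma T_op_bounded_iff:
  assumes g: "g holomorphic_on ball 0 1"
  shows "BMOA_bounded 2 1 (T_op g) \<longleftrightarrow> (SUP I\<in>circle_arcs. log_carleson_quotient g I) < \<infinity>"
proof
  assume bdd: "BMOA_bounded 2 1 (T_op g)"
  then obtain C where T: "T_op g ` BMOA 2 \<subseteq> BMOA 1" and C: "\<And>f. f \<in> BMOA 2 \<Longrightarrow> BMOA_norm 1 (T_op g f) \<le> C * BMOA_norm 2 f"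
    by (auto simp: BMOA_bounded_def)
  have "log_carleson_quotient g I \<le> ennreal (144 * (\<bar>C\<bar> * 24))" if I: "I \<in> circle_arcs" for I
  proof -
    obtain w where w: "norm w < 1" and le: "log_carleson_quotient g I \<le> ennreal 144 * BMOA_integral 1 (T_op g (test_fun w)) w"
      using log_carleson_quotient_le_test[OF g I] by blast
    note F = bmoa_bound_imp_BMOA[OF bmoa_bound_test_fun[OF w]]
    have "BMOA_norm 1 (T_op g (test_fun w)) \<le> C * BMOA_norm 2 (test_fun w)" by (rule C[OF F(1)])
    also have "\<dots> \<le> \<bar>C\<bar> * 24" using F(2) BMOA_norm_nonneg by (intro mult_mono) auto
    finally have n: "BMOA_norm 1 (T_op g (test_fun w)) \<le> \<bar>C\<bar> * 24" .
    note le
    also have "ennreal 144 * BMOA_integral 1 (T_op g (test_fun w)) w \<le> ennreal 144 * ennreal (BMOA_norm 1 (T_op g (test_fun w)))"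
      using T F(1) w by (intro mult_left_mono BMOA_1_integral_le) auto
    also have "\<dots> \<le> ennreal 144 * ennreal (\<bar>C\<bar> * 24)" by (intro mult_left_mono ennreal_leI n) simp
    also have "\<dots> = ennreal (144 * (\<bar>C\<bar> * 24))" by (intro ennreal_mult'[symmetric]) simp
    finally show ?thesis .
  qed
  then have "(SUP I\<in>circle_arcs. log_carleson_quotient g I) \<le> ennreal (144 * (\<bar>C\<bar> * 24))"
    by (rule SUP_least)
  then show "(SUP I\<in>circle_arcs. log_carleson_quotient g I) < \<infinity>"
    by (auto intro: le_less_trans)
next
  assume fin: "(SUP I\<in>circle_arcs. log_carleson_quotient g I) < \<infinity>"
  define N where "N = enn2real (SUP I\<in>circle_arcs. log_carleson_quotient g I)"
  have N: "0 \<le> N" "(SUP I\<in>circle_arcs. log_carleson_quotient g I) = ennreal N"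
    using fin by (auto simp: N_def)
  have arcs: "log_carleson_quotient g I \<le> ennreal N" if "I \<in> circle_arcs" for I
    unfolding N(2)[symmetric] using that by (rule SUP_upper)
  define m where "m = enn2real (\<integral>\<^sup>+z. deriv_density g z \<partial>disc_measure)"
  have "(\<integral>\<^sup>+z. deriv_density g z \<partial>disc_measure) < \<infinity>"
    by (rule deriv_mass_finite[OF g arcs N(1), of "3 / 4"]) auto
  then have m: "0 \<le> m" "(\<integral>\<^sup>+z. deriv_density g z \<partial>disc_measure) \<le> ennreal m" by (auto simp: m_def)
  \<comment> \<open>The constant of \<open>nn_integral_kern_tent\<close> at scale 3/4, the largest
    one for which tents are known to fit into Carleson squares.\<close>
  define \<Lambda> where "\<Lambda> = 24 * N + 16 * m / (3 / 4)\<^sup>2"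
  have \<Lambda>: "0 \<le> \<Lambda>" using N m by (simp add: \<Lambda>_def)
  have test: "(\<integral>\<^sup>+z. ennreal (kern w z) * deriv_density g z \<partial>disc_measure) \<le> ennreal (\<Lambda> / log_weight w)" if "norm w < 1" for w
    unfolding \<Lambda>_def
    by (rule nn_integral_kern_tent[OF measurable_deriv_density[OF g] _ _ N(1) m(1) _ m(2) that], simp, simp)
       (rule tent_mass_le[OF arcs N(1)], use that in auto)
  have bound: "T_op g f \<in> BMOA 1" "BMOA_norm 1 (T_op g f) \<le> 12 * \<Lambda> * A"
    if f: "f \<in> BMOA 2" and A: "0 < A" "BMOA_norm 2 f \<le> A" for f A
  proof -
    note bb = BMOA_imp_bmoa_bound[OF f A]
    have "0 \<le> 12 * \<Lambda> * A" using \<Lambda> A by simp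
    note I = BMOA_1_I[OF T_op_holomorphic[OF bmoa_boundD(1)[OF bb] g] T_op_bound[OF g bb \<Lambda> test] this]
    show "T_op g f \<in> BMOA 1" "BMOA_norm 1 (T_op g f) \<le> 12 * \<Lambda> * A" using I by auto
  qed
  have "BMOA_norm 1 (T_op g f) \<le> 12 * \<Lambda> * BMOA_norm 2 f" if f: "f \<in> BMOA 2" for f
  \<comment> \<open>The bound is available only for positive A above the norm, which may be 0; hence
    the passage through norm + d.\<close>
  proof (rule field_le_epsilon)
    fix e :: real assume e: "0 < e"
    define d where "d = e / (12 * \<Lambda> + 1)"
    have d: "0 < d" using e \<Lambda> by (simp add: d_def)
    have "BMOA_norm 1 (T_op g f) \<le> 12 * \<Lambda> * (BMOA_norm 2 f + d)"
      using d BMOA_norm_nonneg[of 2 f] by (intro bound(2)[OF f]) auto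
    also have "12 * \<Lambda> * d \<le> e" using e \<Lambda> by (simp add: d_def field_simps)
    then have "12 * \<Lambda> * (BMOA_norm 2 f + d) \<le> 12 * \<Lambda> * BMOA_norm 2 f + e" by (simp add: distrib_left)
    finally show "BMOA_norm 1 (T_op g f) \<le> 12 * \<Lambda> * BMOA_norm 2 f + e" .
  qed
  moreover have "T_op g ` BMOA 2 \<subseteq> BMOA 1"
  proof (rule image_subsetI)
    fix f assume "f \<in> BMOA 2"
    then show "T_op g f \<in> BMOA 1"
      using bound(1)[of f "BMOA_norm 2 f + 1"] BMOA_norm_nonneg[of 2 f] by simp
  qed
  ultimately show "BMOA_bounded 2 1 (T_op g)" unfolding BMOA_bounded_def by blast
qed

section \<open>Consequences of the vanishing condition\<close>

lemma eventually_small_arcs: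
  "eventually P small_arcs \<longleftrightarrow> (\<exists>d>0. \<forall>I\<in>circle_arcs. arc_length I < d \<longrightarrow> P I)"
proof -
  have pos: "0 < arc_length I" if "I \<in> circle_arcs" for I by (rule circle_arc_subset_tent(1)[OF that])
  show ?thesis
    unfolding small_arcs_def eventually_inf_principal eventually_filtercomap eventually_at_right_field
    using pos by (auto 4 4)
qed

definition vanishing_log_carleson :: "(complex \<Rightarrow> complex) \<Rightarrow> bool" where
  "vanishing_log_carleson g \<longleftrightarrow> (log_carleson_quotient g \<longlongrightarrow> 0) small_arcs"

lemma vanishing_log_carlesonD:
  assumes "vanishing_log_carleson g" and e: "0 < e"
  shows "\<exists>t0>0. t0 \<le> 3 / 4 \<and> (\<forall>I\<in>circle_arcs. arc_length I \<le> t0 \<longrightarrow> log_carleson_quotient g I \<le> ennreal e)"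
proof -
  from ennreal_tendsto_0D[OF assms(1)[unfolded vanishing_log_carleson_def] e]
  obtain d where d: "0 < d" "\<And>I. I \<in> circle_arcs \<Longrightarrow> arc_length I < d \<Longrightarrow> log_carleson_quotient g I < ennreal e"
    by (auto simp: eventually_small_arcs)
  then show ?thesis by (intro exI[of _ "min (3 / 4) (d / 2)"]) (auto simp: less_imp_le)
qed

text \<open>Half of \<Lambda> comes from the short tents, 24 * \<Lambda> / 48, and half from the far
  part, where the total mass enters. The scale \<open>t0\<close> is fixed first; then the truncation
  radius is chosen so close to 1 that the remaining mass is small compared with t0^2.\<close>

lemma vanishing_tail_test:
  assumes g: "g holomorphic_on ball 0 1" and v: "vanishing_log_carleson g"
  shows "(\<integral>\<^sup>+z. deriv_density g z \<partial>disc_measure) < \<infinity>"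
    and "0 < \<Lambda> \<Longrightarrow> \<exists>\<rho>. 0 \<le> \<rho> \<and> \<rho> < 1 \<and> (\<forall>w. norm w < 1 \<longrightarrow>
      (\<integral>\<^sup>+z. ennreal (kern w z) * (deriv_density g z * indicator {z. \<rho> < norm z} z) \<partial>disc_measure) \<le> ennreal (\<Lambda> / log_weight w))"
proof -
  show fin: "(\<integral>\<^sup>+z. deriv_density g z \<partial>disc_measure) < \<infinity>"
    using vanishing_log_carlesonD[OF v, of 1] deriv_mass_finite[OF g, of _ 1] by auto
  assume \<Lambda>: "0 < \<Lambda>"
  then obtain t0 where t0: "0 < t0" "t0 \<le> 3 / 4"
    and arcs: "\<And>I. I \<in> circle_arcs \<Longrightarrow> arc_length I \<le> t0 \<Longrightarrow> log_carleson_quotient g I \<le> ennreal (\<Lambda> / 48)"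
    using vanishing_log_carlesonD[OF v, of "\<Lambda> / 48"] by auto
  have e: "0 < \<Lambda> * t0\<^sup>2 / 32" using \<Lambda> t0 by simp
  from deriv_mass_tail[OF g fin this] obtain \<rho> where \<rho>: "0 \<le> \<rho>" "\<rho> < 1"
    and tail: "(\<integral>\<^sup>+z. deriv_density g z * indicator {z. \<rho> < norm z} z \<partial>disc_measure) \<le> ennreal (\<Lambda> * t0\<^sup>2 / 32)" by blast
  have "(\<lambda>z. indicator {z. \<rho> < norm z} z :: ennreal) \<in> borel_measurable disc_measure"
    by (rule measurable_disc_borel) measurable
  then have m: "(\<lambda>z. deriv_density g z * indicator {z. \<rho> < norm z} z) \<in> borel_measurable disc_measure"
    using measurable_deriv_density[OF g] by measurable
  have "(\<integral>\<^sup>+z. ennreal (kern w z) * (deriv_density g z * indicator {z. \<rho> < norm z} z) \<partial>disc_measure) \<le> ennreal (\<Lambda> / log_weight w)"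
    if w: "norm w < 1" for w
  proof -
    have "(\<integral>\<^sup>+z. ennreal (kern w z) * (deriv_density g z * indicator {z. \<rho> < norm z} z) \<partial>disc_measure)
      \<le> ennreal ((24 * (\<Lambda> / 48) + 16 * (\<Lambda> * t0\<^sup>2 / 32) / t0\<^sup>2) / log_weight w)"
    proof (rule nn_integral_kern_tent[OF m t0(1) _ _ less_imp_le[OF e] _ tail w])
      fix t assume t: "0 < t" "t \<le> t0"
      have "(\<integral>\<^sup>+z. deriv_density g z * indicator {z. \<rho> < norm z} z * indicator (tent w t) z \<partial>disc_measure)
        \<le> (\<integral>\<^sup>+z. deriv_density g z * indicator (tent w t) z \<partial>disc_measure)"
        by (intro nn_integral_mono) (auto simp: indicator_def)
      also have "\<dots> \<le> ennreal (\<Lambda> / 48 * t / ln (2 / t))"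
        using \<Lambda> t t0 w by (intro tent_mass_le[OF arcs]) auto
      finally show "(\<integral>\<^sup>+z. deriv_density g z * indicator {z. \<rho> < norm z} z * indicator (tent w t) z \<partial>disc_measure)
        \<le> ennreal (\<Lambda> / 48 * t / ln (2 / t))" .
    qed (use t0 \<Lambda> in auto)
    also have "24 * (\<Lambda> / 48) + 16 * (\<Lambda> * t0\<^sup>2 / 32) / t0\<^sup>2 = \<Lambda>" using t0 by simp
    finally show ?thesis .
  qed
  then show "\<exists>\<rho>. 0 \<le> \<rho> \<and> \<rho> < 1 \<and> (\<forall>w. norm w < 1 \<longrightarrow>
      (\<integral>\<^sup>+z. ennreal (kern w z) * (deriv_density g z * indicator {z. \<rho> < norm z} z) \<partial>disc_measure) \<le> ennreal (\<Lambda> / log_weight w))"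
    using \<rho> by blast
qed

text \<open>\<rho> and M depend only on A and e, not on f, a or B. This uniformity lets one estimate
  give both the boundary limit (f fixed, |a| tending to 1) and compactness (B tending to 0).\<close>

lemma T_op_split_bound:
  assumes g: "g holomorphic_on ball 0 1" and v: "vanishing_log_carleson g" and A: "0 < A" and e: "0 < e"
  shows "\<exists>\<rho> M. 0 \<le> \<rho> \<and> \<rho> < 1 \<and> 0 \<le> M \<and> (\<forall>f a B. bmoa_bound f A \<longrightarrow> norm a < 1 \<longrightarrow> 0 \<le> B \<longrightarrow>
    (\<forall>z. norm z \<le> \<rho> \<longrightarrow> norm (f z) \<le> B) \<longrightarrow>
    BMOA_integral 1 (T_op g f) a \<le> ennreal (e + B * (1 - (norm a)\<^sup>2) * M))"
proof -
  define \<Lambda> where "\<Lambda> = e / (12 * A)"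
  have \<Lambda>: "0 < \<Lambda>" using A e by (simp add: \<Lambda>_def)
  from vanishing_tail_test(2)[OF g v \<Lambda>] obtain \<rho> where \<rho>: "0 \<le> \<rho>" "\<rho> < 1" and
    test: "\<And>w. norm w < 1 \<Longrightarrow> (\<integral>\<^sup>+z. ennreal (kern w z) * (deriv_density g z * indicator {z. \<rho> < norm z} z) \<partial>disc_measure) \<le> ennreal (\<Lambda> / log_weight w)"
    by blast
  define m where "m = enn2real (\<integral>\<^sup>+z. deriv_density g z \<partial>disc_measure)"
  have m: "(\<integral>\<^sup>+z. deriv_density g z \<partial>disc_measure) \<le> ennreal m" "0 \<le> m"
    using vanishing_tail_test(1)[OF g v] by (auto simp: m_def)
  note [measurable] = measurable_deriv_density[OF g]
  have [measurable]: "(\<lambda>z. indicator {z. \<rho> < norm z} z :: ennreal) \<in> borel_measurable disc_measure"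
    "(\<lambda>z. indicator {z. norm z \<le> \<rho>} z :: ennreal) \<in> borel_measurable disc_measure"
    "kern a \<in> borel_measurable disc_measure" for a
    by (rule measurable_disc_borel, measurable)+
  define M where "M = m / (1 - \<rho>)\<^sup>2"
  have "BMOA_integral 1 (T_op g f) a \<le> ennreal (e + B * (1 - (norm a)\<^sup>2) * M)"
    if f: "bmoa_bound f A" and a: "norm a < 1" and B: "0 \<le> B" "\<And>z. norm z \<le> \<rho> \<Longrightarrow> norm (f z) \<le> B" for f a B
  proof -
    note D = bmoa_boundD[OF f]
    note [measurable] = measurable_disc_holomorphic[OF D(1)]
    have "BMOA_integral 1 (T_op g f) a
      = (\<integral>\<^sup>+z. ennreal (norm (f z) * kern a z) * (deriv_density g z * indicator {z. \<rho> < norm z} z)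
          + ennreal (norm (f z) * kern a z) * (deriv_density g z * indicator {z. norm z \<le> \<rho>} z) \<partial>disc_measure)"
      unfolding BMOA_integral_T_op[OF D(1) g a] by (intro nn_integral_cong) (auto simp: indicator_def)
    also have "\<dots> = (\<integral>\<^sup>+z. ennreal (norm (f z) * kern a z) * (deriv_density g z * indicator {z. \<rho> < norm z} z) \<partial>disc_measure)
          + (\<integral>\<^sup>+z. ennreal (norm (f z) * kern a z) * (deriv_density g z * indicator {z. norm z \<le> \<rho>} z) \<partial>disc_measure)"
      by (rule nn_integral_add) measurable
    also have "\<dots> \<le> ennreal (12 * \<Lambda> * A) + ennreal (B * ((1 - (norm a)\<^sup>2) / (1 - \<rho>)\<^sup>2) * m)"
      by (intro add_mono log_Carleson_embedding[OF f _ less_imp_le[OF \<Lambda>] test a] kern_inner_integral_le[OF g _ \<rho>(2) B(2,1) a m]) measurable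
    also have "\<dots> = ennreal (e + B * (1 - (norm a)\<^sup>2) * M)"
    proof -
      have "12 * \<Lambda> * A = e" using A by (simp add: \<Lambda>_def)
      moreover have "B * ((1 - (norm a)\<^sup>2) / (1 - \<rho>)\<^sup>2) * m = B * (1 - (norm a)\<^sup>2) * M" by (simp add: M_def)
      moreover have "0 \<le> B * (1 - (norm a)\<^sup>2) * M"
        using B m one_minus_norm_square_pos[OF a] by (simp add: M_def)
      ultimately show ?thesis using e by (simp only: ennreal_plus less_imp_le)
    qed
    finally show ?thesis .
  qed
  moreover have "0 \<le> M" using m by (simp add: M_def)
  ultimately show ?thesis using \<rho> by blast
qed

lemma holomorphic_bounded_on_cball:
  assumes f: "f holomorphic_on ball 0 1" and "\<rho> < 1"
  shows "\<exists>B\<ge>0. \<forall>z. norm z \<le> \<rho> \<longrightarrow> norm (f z) \<le> B"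
proof -
  have "cball (0::complex) \<rho> \<subseteq> ball 0 1" using assms by auto
  then have "bounded (f ` cball 0 \<rho>)"
    by (intro compact_imp_bounded compact_continuous_image holomorphic_on_imp_continuous_on holomorphic_on_subset[OF f]) auto
  then obtain B where "\<forall>y\<in>f ` cball 0 \<rho>. norm y \<le> B" by (auto simp: bounded_iff)
  then show ?thesis by (intro exI[of _ "max B 0"]) (auto simp: le_max_iff_disj)
qed

lemma tendsto_boundary_filter:
  "eventually P (filtercomap norm (at_left 1)) \<longleftrightarrow> (\<exists>r<1. \<forall>a::complex. r < norm a \<longrightarrow> norm a < 1 \<longrightarrow> P a)"
proof
  assume "eventually P (filtercomap norm (at_left 1))"
  then obtain Q where "eventually Q (at_left (1::real))" and Q: "\<And>a::complex. Q (norm a) \<Longrightarrow> P a"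
    by (auto simp: eventually_filtercomap)
  then obtain r where "r < 1" "\<And>x. r < x \<Longrightarrow> x < 1 \<Longrightarrow> Q x"
    by (auto simp: eventually_at_left_field)
  with Q show "\<exists>r<1. \<forall>a::complex. r < norm a \<longrightarrow> norm a < 1 \<longrightarrow> P a" by blast
next
  assume "\<exists>r<1. \<forall>a::complex. r < norm a \<longrightarrow> norm a < 1 \<longrightarrow> P a"
  then obtain r where r: "r < 1" "\<And>a::complex. r < norm a \<Longrightarrow> norm a < 1 \<Longrightarrow> P a" by blast
  then have "eventually (\<lambda>x. r < x \<and> x < 1) (at_left (1::real))"
    by (auto simp: eventually_at_left_field)
  with r(2) show "eventually P (filtercomap norm (at_left 1))"
    unfolding eventually_filtercomap by blast
qed

text \<open>For a fixed f the inner part carries the factor 1 - |a|^2 with a constant. The split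
  with e = 1 already yields membership in \<open>BMOA 1\<close>; arbitrary e yields the
  limit.\<close>

lemma vanishing_imp_VMOA:
  assumes g: "g holomorphic_on ball 0 1" and v: "vanishing_log_carleson g" and f: "f \<in> BMOA 2"
  shows "T_op g f \<in> VMOA 1"
proof -
  define A where "A = BMOA_norm 2 f + 1"
  have A: "0 < A" "BMOA_norm 2 f \<le> A" using BMOA_norm_nonneg[of 2 f] by (auto simp: A_def)
  note bb = BMOA_imp_bmoa_bound[OF f A]
  have ev: "\<exists>M\<ge>0. \<forall>a. norm a < 1 \<longrightarrow> BMOA_integral 1 (T_op g f) a \<le> ennreal (e + (1 - (norm a)\<^sup>2) * M)" if "0 < e" for e
  proof -
    from T_op_split_bound[OF g v A(1) that] obtain \<rho> M where \<rho>: "0 \<le> \<rho>" "\<rho> < 1" "0 \<le> M"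
      and le: "\<And>f a B. bmoa_bound f A \<Longrightarrow> norm a < 1 \<Longrightarrow> 0 \<le> B \<Longrightarrow> (\<forall>z. norm z \<le> \<rho> \<longrightarrow> norm (f z) \<le> B) \<Longrightarrow>
        BMOA_integral 1 (T_op g f) a \<le> ennreal (e + B * (1 - (norm a)\<^sup>2) * M)" by blast
    obtain B where B: "0 \<le> B" "\<forall>z. norm z \<le> \<rho> \<longrightarrow> norm (f z) \<le> B"
      using holomorphic_bounded_on_cball[OF bmoa_boundD(1)[OF bb] \<rho>(2)] by blast
    show ?thesis using le[OF bb _ B] \<rho>(3) B(1) by (intro exI[of _ "B * M"]) (auto simp: mult_ac)
  qed
  have "T_op g f \<in> BMOA 1"
  proof -
    obtain M where M: "0 \<le> M" "\<And>a. norm a < 1 \<Longrightarrow> BMOA_integral 1 (T_op g f) a \<le> ennreal (1 + (1 - (norm a)\<^sup>2) * M)"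
      using ev[of 1] by auto
    have "BMOA_integral 1 (T_op g f) a \<le> ennreal (1 + M)" if "norm a < 1" for a
    proof (rule order_trans[OF M(2)[OF that]], rule ennreal_leI)
      have "(1 - (norm a)\<^sup>2) * M \<le> 1 * M" using M(1) by (intro mult_right_mono) auto
      then show "1 + (1 - (norm a)\<^sup>2) * M \<le> 1 + M" by simp
    qed
    then show ?thesis
      using M(1) by (intro BMOA_1_I(1)[OF T_op_holomorphic[OF bmoa_boundD(1)[OF bb] g], of "1 + M"]) auto
  qed
  moreover have "(BMOA_integral 1 (T_op g f) \<longlongrightarrow> 0) (filtercomap norm (at_left 1))"
  proof (rule ennreal_tendsto_0I)
    fix e :: real assume e: "0 < e"
    then obtain M where M: "0 \<le> M" "\<And>a. norm a < 1 \<Longrightarrow> BMOA_integral 1 (T_op g f) a \<le> ennreal (e / 2 + (1 - (norm a)\<^sup>2) * M)"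
      using ev[of "e / 2"] by auto
    define d where "d = e / (4 * (M + 1))"
    have d: "0 < d" using e M by (simp add: d_def)
    have "BMOA_integral 1 (T_op g f) a \<le> ennreal e" if a: "1 - d < norm a" "norm a < 1" for a
    proof -
      have "1 - (norm a)\<^sup>2 = (1 - norm a) * (1 + norm a)" by (simp add: power2_eq_square algebra_simps)
      also have "\<dots> \<le> d * 2" using a d by (intro mult_mono) auto
      finally have "(1 - (norm a)\<^sup>2) * M \<le> d * 2 * M" using M by (intro mult_right_mono) auto
      also have "\<dots> \<le> d * 2 * (M + 1)" using d M by (intro mult_left_mono) auto
      also have "\<dots> = e / 2" using M by (simp add: d_def field_simps)
      finally show ?thesis using M(2)[OF a(2)] by (elim order_trans) (auto intro!: ennreal_leI)
    qed
    then show "eventually (\<lambda>a. BMOA_integral 1 (T_op g f) a \<le> ennreal e) (filtercomap norm (at_left 1))"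
      unfolding tendsto_boundary_filter using d by (intro exI[of _ "1 - d"]) auto
  qed
  ultimately show ?thesis by (simp add: VMOA_def)
qed

section \<open>Compactness\<close>

lemma continuous_on_log_weight: "continuous_on (ball 0 1) log_weight"
  unfolding log_weight_def
proof (intro continuous_intros ballI)
  fix z :: complex assume "z \<in> ball 0 1"
  then have "0 < 1 - (norm z)\<^sup>2" using one_minus_norm_square_pos[of z] by simp
  then show "1 - (norm z)\<^sup>2 \<noteq> 0" "2 / (1 - (norm z)\<^sup>2) \<noteq> 0" by auto
qed

text \<open>Locally uniform convergence forces the derivatives to converge pointwise, and Fatou's
  lemma passes the energy bound to the limit.\<close>

lemma bmoa_bound_limit:
  assumes F: "\<And>n. bmoa_bound (F n) A" and h: "h holomorphic_on ball 0 1"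
    and lim: "\<And>K. compact K \<Longrightarrow> K \<subseteq> ball 0 1 \<Longrightarrow> uniform_limit K F h sequentially"
  shows "bmoa_bound h A"
  unfolding bmoa_bound_def
proof (intro conjI allI impI)
  note D = bmoa_boundD[OF F]
  show "h holomorphic_on ball 0 1" by (rule h)
  show "0 < A" by (rule D(2))
  have "(\<lambda>n. F n 0) \<longlonglongrightarrow> h 0"
    using tendsto_uniform_limitI[OF lim[of "{0}"]] by auto
  then have "(\<lambda>n. norm (F n 0)) \<longlonglongrightarrow> norm (h 0)" by (rule tendsto_norm)
  then show "norm (h 0) \<le> A" using D(3) by (intro LIMSEQ_le_const2) auto
  fix a :: complex assume a: "norm a < 1"
  have d: "(\<lambda>n. deriv (F n) z) \<longlonglongrightarrow> deriv h z" if z: "norm z < 1" for z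
  proof -
    obtain r where r: "norm z < r" "r < 1" using dense[OF z] by blast
    show ?thesis
    proof (rule deriv_complex_uniform_limit)
      have "cball (0::complex) r \<subseteq> ball 0 1" using r by auto
      then have "uniform_limit (cball 0 r) F h sequentially" by (intro lim) auto
      then show "uniform_limit (ball 0 r) F h sequentially" by (rule uniform_limit_on_subset) auto
      show "eventually (\<lambda>n. F n holomorphic_on ball 0 r) sequentially"
        using r by (intro always_eventually allI holomorphic_on_subset[OF D(1)]) auto
    qed (use r in auto)
  qed
  have "(\<integral>\<^sup>+z. energy_density h a z \<partial>disc_measure) = (\<integral>\<^sup>+z. liminf (\<lambda>n. energy_density (F n) a z) \<partial>disc_measure)"
  proof (rule nn_integral_cong)
    fix z assume "z \<in> space disc_measure"
    then have "norm z < 1" by simp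
    then have "(\<lambda>n. energy_density (F n) a z) \<longlonglongrightarrow> energy_density h a z" by (intro tendsto_intros tendsto_ennrealI d)
    then show "energy_density h a z = liminf (\<lambda>n. energy_density (F n) a z)" by (intro lim_imp_Liminf[symmetric]) auto
  qed
  also have "\<dots> \<le> liminf (\<lambda>n. \<integral>\<^sup>+z. energy_density (F n) a z \<partial>disc_measure)"
    by (rule nn_integral_liminf) (rule measurable_energy_density[OF D(1)])
  also have "\<dots> \<le> liminf (\<lambda>n. ennreal (A\<^sup>2))"
    by (intro Liminf_mono always_eventually allI D(4) a)
  also have "\<dots> = ennreal (A\<^sup>2)" by (simp add: Liminf_const)
  finally show "(\<integral>\<^sup>+z. energy_density h a z \<partial>disc_measure) \<le> ennreal (A\<^sup>2)" .
qed

text \<open>The growth estimate makes the family locally bounded, so Montel's theorem applies; the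
  limit stays in the same ball. This replaces norm compactness, which fails in BMOA.\<close>

lemma bmoa_bound_Montel:
  assumes F: "\<And>n. bmoa_bound (F n) A"
  obtains h r where "bmoa_bound h A" "strict_mono (r :: nat \<Rightarrow> nat)"
    "\<And>K. compact K \<Longrightarrow> K \<subseteq> ball 0 1 \<Longrightarrow> uniform_limit K (\<lambda>n. F (r n)) h sequentially"
proof -
  have A: "0 < A" by (rule bmoa_boundD(2)[OF F])
  obtain h r where h: "h holomorphic_on ball 0 1" and r: "strict_mono (r :: nat \<Rightarrow> nat)"
    and lim: "\<And>K. compact K \<Longrightarrow> K \<subseteq> ball 0 1 \<Longrightarrow> uniform_limit K (F \<circ> r) h sequentially"
  proof (rule Montel[of "ball 0 1" "{f. bmoa_bound f A}" F])
    show "f holomorphic_on ball 0 1" if "f \<in> {f. bmoa_bound f A}" for f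
      using that bmoa_boundD(1) by auto
    show "\<exists>B. \<forall>f\<in>{f. bmoa_bound f A}. \<forall>z\<in>K. norm (f z) \<le> B" if K: "compact K" "K \<subseteq> ball 0 1" for K
    proof -
      have "bounded (log_weight ` K)"
        using K by (intro compact_imp_bounded compact_continuous_image continuous_on_subset[OF continuous_on_log_weight])
      then obtain C where C: "\<forall>y\<in>log_weight ` K. norm y \<le> C" by (auto simp: bounded_iff)
      have "norm (f z) \<le> 7 * A * C" if f: "bmoa_bound f A" and z: "z \<in> K" for f z
      proof -
        have "norm z < 1" using z K by auto
        from bmoa_bound_growth[OF f this] have "norm (f z) \<le> 7 * A * log_weight z" .
        also have "\<dots> \<le> 7 * A * C" using C z A by (intro mult_left_mono) auto
        finally show ?thesis .
      qed
      then show ?thesis by blast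
    qed
  qed (use F in auto)
  have lim': "uniform_limit K (\<lambda>n. F (r n)) h sequentially" if "compact K" "K \<subseteq> ball 0 1" for K
    using lim[OF that] by (simp add: o_def)
  have "bmoa_bound h A" by (rule bmoa_bound_limit[OF F h lim'])
  then show thesis using that r lim' by blast
qed

lemma bmoa_bound_diff:
  assumes f: "bmoa_bound f A" and h: "bmoa_bound h A"
  shows "bmoa_bound (\<lambda>z. f z - h z) (2 * A)"
  unfolding bmoa_bound_def
proof (intro conjI allI impI)
  note D = bmoa_boundD[OF f] and E = bmoa_boundD[OF h]
  show "(\<lambda>z. f z - h z) holomorphic_on ball 0 1" by (intro holomorphic_intros D E)
  show "0 < 2 * A" using D(2) by simp
  show "norm (f 0 - h 0) \<le> 2 * A" using norm_triangle_ineq4[of "f 0" "h 0"] D(3) E(3) by simp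
  fix a :: complex assume a: "norm a < 1"
  note [measurable] = measurable_energy_density[OF D(1)] measurable_energy_density[OF E(1)]
  have "(\<integral>\<^sup>+z. energy_density (\<lambda>z. f z - h z) a z \<partial>disc_measure) \<le> (\<integral>\<^sup>+z. ennreal 2 * energy_density f a z + ennreal 2 * energy_density h a z \<partial>disc_measure)"
  proof (rule nn_integral_mono)
    fix z assume "z \<in> space disc_measure"
    then have z: "norm z < 1" by simp
    have "f field_differentiable at z" "h field_differentiable at z"
      using D(1) E(1) z by (auto intro: holomorphic_on_imp_differentiable_at)
    then have d: "deriv (\<lambda>z. f z - h z) z = deriv f z - deriv h z" by (rule deriv_diff)
    define c where "c = (1 - (norm z)\<^sup>2) * kern a z"
    have c: "0 \<le> c" using one_minus_norm_square_pos[OF z] kern_nonneg[of a z] a by (simp add: c_def)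
    have "(norm (deriv f z - deriv h z))\<^sup>2 \<le> (norm (deriv f z) + norm (deriv h z))\<^sup>2"
      by (intro power_mono norm_triangle_ineq4) auto
    also have "\<dots> \<le> 2 * (norm (deriv f z))\<^sup>2 + 2 * (norm (deriv h z))\<^sup>2"
      using sum_squares_bound[of "norm (deriv f z)" "norm (deriv h z)"] by (simp add: power2_sum)
    finally have "(norm (deriv f z - deriv h z))\<^sup>2 * c \<le> (2 * (norm (deriv f z))\<^sup>2 + 2 * (norm (deriv h z))\<^sup>2) * c"
      using c by (rule mult_right_mono)
    then have "ennreal ((norm (deriv f z - deriv h z))\<^sup>2 * c) \<le> ennreal (2 * ((norm (deriv f z))\<^sup>2 * c) + 2 * ((norm (deriv h z))\<^sup>2 * c))"
      by (intro ennreal_leI) (simp add: distrib_right mult.assoc)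
    also have "\<dots> = ennreal 2 * ennreal ((norm (deriv f z))\<^sup>2 * c) + ennreal 2 * ennreal ((norm (deriv h z))\<^sup>2 * c)"
      using c by (subst ennreal_plus) (auto simp: ennreal_mult' simp del: ennreal_numeral)
    finally show "energy_density (\<lambda>z. f z - h z) a z \<le> ennreal 2 * energy_density f a z + ennreal 2 * energy_density h a z"
      by (simp only: d c_def mult.assoc)
  qed
  also have "\<dots> = ennreal 2 * (\<integral>\<^sup>+z. energy_density f a z \<partial>disc_measure) + ennreal 2 * (\<integral>\<^sup>+z. energy_density h a z \<partial>disc_measure)"
    by (subst nn_integral_add, measurable) (simp add: nn_integral_cmult)
  also have "\<dots> \<le> ennreal 2 * ennreal (A\<^sup>2) + ennreal 2 * ennreal (A\<^sup>2)"
    by (intro add_mono mult_left_mono D(4) E(4) a) auto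
  also have "\<dots> = ennreal ((2 * A)\<^sup>2)"
    by (simp add: power2_eq_square del: ennreal_numeral flip: ennreal_mult' ennreal_plus)
  finally show "(\<integral>\<^sup>+z. energy_density (\<lambda>z. f z - h z) a z \<partial>disc_measure) \<le> ennreal ((2 * A)\<^sup>2)" .
qed

text \<open>Allows linearity of \<open>T_op\<close> to be used at the level of derivatives
  only.\<close>

lemma BMOA_integral_1_cong:
  assumes "\<And>z. norm z < 1 \<Longrightarrow> deriv u z = deriv v z" "norm a < 1"
  shows "BMOA_integral 1 u a = BMOA_integral 1 v a"
  unfolding BMOA_integral_1[OF assms(2)] using assms(1) by (intro nn_integral_cong) auto

lemma deriv_diff_disc:
  assumes "f holomorphic_on ball 0 1" "h holomorphic_on ball 0 1" "norm z < 1"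
  shows "deriv (\<lambda>z. f z - h z) z = deriv f z - deriv h z"
  using assms by (intro deriv_diff) (auto intro: holomorphic_on_imp_differentiable_at)

lemma BMOA_integral_1_triangle:
  assumes f: "f holomorphic_on ball 0 1" and h: "h holomorphic_on ball 0 1" and a: "norm a < 1"
  shows "BMOA_integral 1 (\<lambda>z. f z - h z) a \<le> BMOA_integral 1 f a + BMOA_integral 1 h a"
    and "BMOA_integral 1 f a \<le> BMOA_integral 1 (\<lambda>z. f z - h z) a + BMOA_integral 1 h a"
proof -
  have fh: "(\<lambda>z. f z - h z) holomorphic_on ball 0 1" by (intro holomorphic_intros f h)
  note [measurable] = measurable_disc_deriv[OF f] measurable_disc_deriv[OF h] measurable_disc_deriv[OF fh]
  have [measurable]: "kern a \<in> borel_measurable disc_measure" by (rule measurable_disc_borel) measurable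
  have k: "0 \<le> kern a z" for z using a by (intro kern_nonneg) simp
  have main: "(\<integral>\<^sup>+z. ennreal (norm (deriv u z) * kern a z) \<partial>disc_measure)
    \<le> (\<integral>\<^sup>+z. ennreal (norm (deriv v z) * kern a z) \<partial>disc_measure) + (\<integral>\<^sup>+z. ennreal (norm (deriv h z) * kern a z) \<partial>disc_measure)"
    if [measurable]: "deriv v \<in> borel_measurable disc_measure"
      and le: "\<And>z. norm z < 1 \<Longrightarrow> norm (deriv u z) \<le> norm (deriv v z) + norm (deriv h z)" for u v
  proof -
    have "(\<integral>\<^sup>+z. ennreal (norm (deriv u z) * kern a z) \<partial>disc_measure)
      \<le> (\<integral>\<^sup>+z. ennreal (norm (deriv v z) * kern a z) + ennreal (norm (deriv h z) * kern a z) \<partial>disc_measure)"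
    proof (rule nn_integral_mono)
      fix z assume "z \<in> space disc_measure"
      then have "norm (deriv u z) * kern a z \<le> (norm (deriv v z) + norm (deriv h z)) * kern a z"
        using le k by (intro mult_right_mono) auto
      then show "ennreal (norm (deriv u z) * kern a z) \<le> ennreal (norm (deriv v z) * kern a z) + ennreal (norm (deriv h z) * kern a z)"
        using k by (simp add: distrib_right flip: ennreal_plus)
    qed
    also have "\<dots> = (\<integral>\<^sup>+z. ennreal (norm (deriv v z) * kern a z) \<partial>disc_measure) + (\<integral>\<^sup>+z. ennreal (norm (deriv h z) * kern a z) \<partial>disc_measure)"
      by (rule nn_integral_add) measurable
    finally show ?thesis .
  qed
  show "BMOA_integral 1 (\<lambda>z. f z - h z) a \<le> BMOA_integral 1 f a + BMOA_integral 1 h a"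
    unfolding BMOA_integral_1[OF a]
    by (rule main) (simp_all add: deriv_diff_disc[OF f h] norm_triangle_ineq4)
  show "BMOA_integral 1 f a \<le> BMOA_integral 1 (\<lambda>z. f z - h z) a + BMOA_integral 1 h a"
    unfolding BMOA_integral_1[OF a]
  proof (rule main)
    fix z :: complex assume "norm z < 1"
    then show "norm (deriv f z) \<le> norm (deriv (\<lambda>z. f z - h z) z) + norm (deriv h z)"
      using norm_triangle_ineq[of "deriv f z - deriv h z" "deriv h z"] by (simp add: deriv_diff_disc[OF f h])
  qed measurable
qed

lemma BMOA_1_diff:
  assumes "f \<in> BMOA 1" "h \<in> BMOA 1"
  shows "(\<lambda>z. f z - h z) \<in> BMOA 1"
proof -
  have hol: "f holomorphic_on ball 0 1" "h holomorphic_on ball 0 1" using assms by (auto simp: BMOA_def)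
  show ?thesis
  proof (rule BMOA_1_I(1))
    show "(\<lambda>z. f z - h z) holomorphic_on ball 0 1" by (intro holomorphic_intros hol)
    fix a :: complex assume a: "norm a < 1"
    have "BMOA_integral 1 (\<lambda>z. f z - h z) a \<le> ennreal (BMOA_norm 1 f) + ennreal (BMOA_norm 1 h)"
      by (rule order_trans[OF BMOA_integral_1_triangle(1)[OF hol a]]) (intro add_mono BMOA_1_integral_le assms a)
    then show "BMOA_integral 1 (\<lambda>z. f z - h z) a \<le> ennreal (BMOA_norm 1 f + BMOA_norm 1 h)"
      by (simp add: BMOA_norm_nonneg)
  qed (simp add: BMOA_norm_nonneg)
qed

text \<open>A subsequence converges locally uniformly to some h in the same ball. The differences
  stay in a ball of radius 2 A and become small on the inner disc of
  \<open>T_op_split_bound\<close>, so their images tend to 0 in norm.\<close>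

lemma vanishing_imp_compact:
  assumes g: "g holomorphic_on ball 0 1" and v: "vanishing_log_carleson g"
  shows "BMOA_compact 2 1 (T_op g)"
  unfolding BMOA_compact_def
proof (intro conjI allI impI)
  show T: "T_op g ` BMOA 2 \<subseteq> BMOA 1"
    using vanishing_imp_VMOA[OF g v] by (auto simp: VMOA_def)
  fix f :: "nat \<Rightarrow> complex \<Rightarrow> complex"
  assume f: "range f \<subseteq> BMOA 2 \<and> bounded (range (\<lambda>n. BMOA_norm 2 (f n)))"
  then obtain C where C: "\<And>n. norm (BMOA_norm 2 (f n)) \<le> C" by (auto simp: bounded_iff)
  define A where "A = \<bar>C\<bar> + 1"
  have A: "0 < A" "BMOA_norm 2 (f n) \<le> A" for n using C[of n] by (auto simp: A_def)
  have bb: "bmoa_bound (f n) A" for n using f by (intro BMOA_imp_bmoa_bound A) auto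
  obtain h r where h: "bmoa_bound h A" and r: "strict_mono (r :: nat \<Rightarrow> nat)"
    and lim: "\<And>K. compact K \<Longrightarrow> K \<subseteq> ball 0 1 \<Longrightarrow> uniform_limit K (\<lambda>n. f (r n)) h sequentially"
    using bmoa_bound_Montel[of f A, OF bb] by blast
  note hol = bmoa_boundD(1)[OF h] bmoa_boundD(1)[OF bb]
  have "(\<lambda>n. BMOA_norm 1 (\<lambda>z. T_op g (f (r n)) z - T_op g h z)) \<longlonglongrightarrow> 0"
  proof (rule LIMSEQ_I)
    fix e :: real assume e: "0 < e"
    have e4: "0 < e / 4" using e by simp
    have A2: "0 < 2 * A" using A by simp
    from T_op_split_bound[OF g v A2 e4] obtain \<rho> M where \<rho>: "0 \<le> \<rho>" "\<rho> < 1" "0 \<le> M"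
      and le: "\<And>f a B. bmoa_bound f (2 * A) \<Longrightarrow> norm a < 1 \<Longrightarrow> 0 \<le> B \<Longrightarrow> (\<forall>z. norm z \<le> \<rho> \<longrightarrow> norm (f z) \<le> B) \<Longrightarrow>
        BMOA_integral 1 (T_op g f) a \<le> ennreal (e / 4 + B * (1 - (norm a)\<^sup>2) * M)" by blast
    \<comment> \<open>Keeps the inner part below e / 4; the added 1 allows M = 0.\<close>
    define B where "B = e / (4 * (M + 1))"
    have B: "0 < B" using e \<rho> by (simp add: B_def)
    have "cball (0::complex) \<rho> \<subseteq> ball 0 1" using \<rho> by auto
    then have "uniform_limit (cball 0 \<rho>) (\<lambda>n. f (r n)) h sequentially" by (intro lim) auto
    from uniform_limitD[OF this B] obtain N where "\<forall>n\<ge>N. \<forall>z\<in>cball 0 \<rho>. dist (f (r n) z) (h z) < B"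
      by (auto simp: eventually_sequentially)
    then have N: "\<And>n z. N \<le> n \<Longrightarrow> norm z \<le> \<rho> \<Longrightarrow> norm (f (r n) z - h z) < B"
      by (simp add: dist_norm)
    have "norm (BMOA_norm 1 (\<lambda>z. T_op g (f (r n)) z - T_op g h z) - 0) < e" if n: "N \<le> n" for n
    proof -
      note d = bmoa_bound_diff[OF bb[of "r n"] h]
      let ?D = "\<lambda>z. T_op g (f (r n)) z - T_op g h z"
      have Th: "T_op g (f (r n)) holomorphic_on ball 0 1" "T_op g h holomorphic_on ball 0 1"
        by (intro T_op_holomorphic hol g)+
      have "BMOA_integral 1 ?D a \<le> ennreal (e / 2)" if a: "norm a < 1" for a
      proof -
        have "BMOA_integral 1 ?D a = BMOA_integral 1 (T_op g (\<lambda>z. f (r n) z - h z)) a"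
          by (rule BMOA_integral_1_cong[OF _ a])
             (simp add: deriv_diff_disc[OF Th] deriv_T_op[OF hol(2) g] deriv_T_op[OF hol(1) g] deriv_T_op[OF bmoa_boundD(1)[OF d] g] left_diff_distrib)
        also have "\<dots> \<le> ennreal (e / 4 + B * (1 - (norm a)\<^sup>2) * M)"
          using N[OF n] B by (intro le[OF d a]) (auto intro: less_imp_le)
        also have "\<dots> \<le> ennreal (e / 2)"
        proof (rule ennreal_leI)
          have "B * (1 - (norm a)\<^sup>2) * M \<le> B * 1 * (M + 1)"
            using B \<rho> a by (intro mult_mono) (auto simp: power_le_one)
          also have "\<dots> = e / 4"
          proof -
            have "e / (4 * x) * 1 * x = e / 4" if "0 < x" for x :: real using that by simp
            from this[of "M + 1"] show ?thesis unfolding B_def using \<rho>(3) by (simp only: add_nonneg_pos zero_less_one)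
          qed
          finally show "e / 4 + B * (1 - (norm a)\<^sup>2) * M \<le> e / 2" by simp
        qed
        finally show ?thesis .
      qed
      then have "BMOA_norm 1 ?D \<le> norm (?D 0) + e / 2"
        using e by (intro BMOA_1_I(2) holomorphic_intros Th) auto
      then show ?thesis using e BMOA_norm_nonneg[of 1 ?D] by simp
    qed
    then show "\<exists>N. \<forall>n\<ge>N. norm (BMOA_norm 1 (\<lambda>z. T_op g (f (r n)) z - T_op g h z) - 0) < e" by blast
  qed
  moreover have "T_op g h \<in> BMOA 1" using T bmoa_bound_imp_BMOA(1)[OF h] by auto
  ultimately show "\<exists>h\<in>BMOA 1. \<exists>r. strict_mono r \<and> (\<lambda>n. BMOA_norm 1 (\<lambda>z. T_op g (f (r n)) z - h z)) \<longlonglongrightarrow> 0"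
    using r by blast
qed

section \<open>Failure of the vanishing condition, and necessity for compactness\<close>

text \<open>Failure provides bad arcs of length below 1 / (n + 1) for every n. Their associated
  points have modulus 1 - |I|, and the factor 144 of the comparison goes into \<epsilon>.\<close>

lemma not_vanishing_sequence:
  assumes g: "g holomorphic_on ball 0 1" and nv: "\<not> vanishing_log_carleson g"
  obtains \<epsilon> w where "0 < \<epsilon>" "\<And>n::nat. norm (w n) < 1" "(\<lambda>n. norm (w n)) \<longlonglongrightarrow> 1"
    "\<And>n. ennreal \<epsilon> < BMOA_integral 1 (T_op g (test_fun (w n))) (w n)"
proof -
  obtain e where e: "0 < e" "\<not> eventually (\<lambda>I. log_carleson_quotient g I \<le> ennreal e) small_arcs"
    using nv ennreal_tendsto_0I unfolding vanishing_log_carleson_def by blast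
  have "\<exists>w. norm w < 1 \<and> 1 - 1 / (real n + 1) < norm w \<and> ennreal (e / 144) < BMOA_integral 1 (T_op g (test_fun w)) w" for n
  proof -
    have "0 < 1 / (real n + 1)" by simp
    with e(2) obtain I where I: "I \<in> circle_arcs" "arc_length I < 1 / (real n + 1)" "\<not> log_carleson_quotient g I \<le> ennreal e"
      unfolding eventually_small_arcs by blast
    from log_carleson_quotient_le_test[OF g I(1)] obtain w where w: "norm w = 1 - arc_length I" "norm w < 1"
      and le: "log_carleson_quotient g I \<le> ennreal 144 * BMOA_integral 1 (T_op g (test_fun w)) w" by blast
    have "ennreal (e / 144) < BMOA_integral 1 (T_op g (test_fun w)) w"
    proof (rule ccontr)
      assume "\<not> ennreal (e / 144) < BMOA_integral 1 (T_op g (test_fun w)) w"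
      then have "ennreal 144 * BMOA_integral 1 (T_op g (test_fun w)) w \<le> ennreal 144 * ennreal (e / 144)"
        by (intro mult_left_mono) auto
      also have "\<dots> = ennreal e" by (subst ennreal_mult'[symmetric]) auto
      finally show False using le I(3) by (meson order_trans)
    qed
    then show ?thesis using w I(2) by (intro exI[of _ w]) simp
  qed
  then obtain w where w: "\<And>n. norm (w n) < 1" "\<And>n. 1 - 1 / (real n + 1) < norm (w n)"
      "\<And>n. ennreal (e / 144) < BMOA_integral 1 (T_op g (test_fun (w n))) (w n)" by metis
  have "(\<lambda>n. norm (w n)) \<longlonglongrightarrow> 1"
  proof (rule tendsto_sandwich)
    show "(\<lambda>n. 1 - 1 / (real n + 1)) \<longlonglongrightarrow> 1"
      using LIMSEQ_inverse_real_of_nat_add_minus[of 1] by (simp add: inverse_eq_divide add.commute)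
  qed (use w in \<open>auto intro!: always_eventually less_imp_le\<close>)
  then show thesis using that[of "e / 144" w] e(1) w by simp
qed

lemma test_fun_small:
  assumes w: "\<And>n::nat. norm (w n) < 1" "(\<lambda>n. norm (w n)) \<longlonglongrightarrow> 1" and \<rho>: "0 \<le> \<rho>" "\<rho> < 1" and \<delta>: "0 < \<delta>"
  shows "eventually (\<lambda>n. \<forall>z. norm z \<le> \<rho> \<longrightarrow> norm (test_fun (w n) z) \<le> \<delta> \<and> norm (deriv (test_fun (w n)) z) \<le> \<delta>) sequentially"
proof -
  define c where "c = ln (12 / (1 - \<rho>)) + 4"
  define C where "C = c\<^sup>2 + 2 * c / (1 - \<rho>)"
  have "0 \<le> ln (12 / (1 - \<rho>))" using \<rho> by simp
  then have c: "0 < c" by (simp add: c_def)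
  have C: "0 < C" "c\<^sup>2 \<le> C" "2 * c / (1 - \<rho>) \<le> C" using c \<rho> by (auto simp: C_def add_pos_pos)
  \<comment> \<open>The threshold solves ln (12 / (1 - |w n|)) \<ge> C / \<delta> for |w n|, where C
    dominates both numerators.\<close>
  have "1 - 12 * exp (- (C / \<delta>)) < 1" by simp
  from order_tendstoD(1)[OF w(2) this] show ?thesis
  proof eventually_elim
    case (elim n)
    define L where "L = ln (12 / (1 - norm (w n)))"
    have "exp (C / \<delta>) * (1 - norm (w n)) \<le> exp (C / \<delta>) * (12 * exp (- (C / \<delta>)))"
      using elim by (intro mult_left_mono) auto
    also have "\<dots> = 12" by (simp add: exp_minus)
    finally have "exp (C / \<delta>) \<le> 12 / (1 - norm (w n))" using w(1)[of n] by (simp add: field_simps)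
    then have "ln (exp (C / \<delta>)) \<le> L" unfolding L_def using w(1)[of n] by (subst ln_le_cancel_iff) auto
    then have L: "C / \<delta> \<le> L" by simp
    have Lp: "0 < L" using L C \<delta> by (meson divide_pos_pos less_le_trans)
    have CL: "C / L \<le> \<delta>" using L Lp \<delta> by (simp add: field_simps)
    show ?case
    proof (intro allI impI)
      fix z :: complex assume z: "norm z \<le> \<rho>"
      then have z1: "norm z < 1" using \<rho> by simp
      have "ln (12 / (1 - norm z)) \<le> ln (12 / (1 - \<rho>))"
        using z \<rho> by (subst ln_le_cancel_iff) (auto intro!: divide_left_mono)
      moreover have "0 \<le> ln (12 / (1 - norm z))" 
      proof (rule ln_ge_zero)
        show "1 \<le> 12 / (1 - norm z)" using z1 norm_ge_zero[of z] by (subst le_divide_eq_1_pos) linarith+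
      qed
      ultimately have b: "0 \<le> ln (12 / (1 - norm z)) + 4" "ln (12 / (1 - norm z)) + 4 \<le> c" by (auto simp: c_def)
      have "norm (test_fun (w n) z) \<le> (ln (12 / (1 - norm z)) + 4)\<^sup>2 / L"
        unfolding L_def by (rule norm_deriv_test_fun(3)[OF w(1) z1])
      also have "\<dots> \<le> C / L" using b Lp C by (intro divide_right_mono order_trans[OF power_mono[OF b(2,1)]]) auto
      finally have 1: "norm (test_fun (w n) z) \<le> \<delta>" using CL by simp
      have "norm (deriv (test_fun (w n)) z) \<le> 2 * (ln (12 / (1 - norm z)) + 4) / (1 - norm z) / L"
        unfolding L_def by (rule norm_deriv_test_fun(2)[OF w(1) z1])
      also have "2 * (ln (12 / (1 - norm z)) + 4) / (1 - norm z) \<le> 2 * c / (1 - \<rho>)"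
        using b z \<rho> c by (intro frac_le) auto
      then have "2 * (ln (12 / (1 - norm z)) + 4) / (1 - norm z) / L \<le> C / L"
        using C Lp by (intro divide_right_mono) auto
      finally have 2: "norm (deriv (test_fun (w n)) z) \<le> \<delta>" using CL by simp
      show "norm (test_fun (w n) z) \<le> \<delta> \<and> norm (deriv (test_fun (w n)) z) \<le> \<delta>" using 1 2 by simp
    qed
  qed
qed

lemma test_fun_tendsto_0:
  assumes w: "\<And>n::nat. norm (w n) < 1" "(\<lambda>n. norm (w n)) \<longlonglongrightarrow> 1" and z: "norm z < 1"
  shows "(\<lambda>n. test_fun (w n) z) \<longlonglongrightarrow> 0"
proof (rule tendstoI)
  fix e :: real assume "0 < e"
  then have "0 < e / 2" by simp
  from test_fun_small[OF w norm_ge_zero z this]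
  show "eventually (\<lambda>n. dist (test_fun (w n) z) 0 < e) sequentially"
    by eventually_elim (use \<open>0 < e\<close> in \<open>auto intro: le_less_trans\<close>)
qed

text \<open>The test functions tend to 0 pointwise, so a norm limit h of their images must have zero
  derivative almost everywhere, by Fatou at base point 0. Hence h contributes nothing to any
  integral, and norm convergence to it contradicts the lower bound \<epsilon>.\<close>

lemma compact_imp_vanishing:
  assumes g: "g holomorphic_on ball 0 1" and comp: "BMOA_compact 2 1 (T_op g)"
  shows "vanishing_log_carleson g"
proof (rule ccontr)
  assume "\<not> vanishing_log_carleson g"
  then obtain \<epsilon> w where \<epsilon>: "0 < \<epsilon>" and w: "\<And>n::nat. norm (w n) < 1" "(\<lambda>n. norm (w n)) \<longlonglongrightarrow> 1"
    and big: "\<And>n. ennreal \<epsilon> < BMOA_integral 1 (T_op g (test_fun (w n))) (w n)"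
    using not_vanishing_sequence[OF g] by blast
  define F where "F n = test_fun (w n)" for n
  note bb = bmoa_bound_test_fun[OF w(1)]
  have FB: "F n \<in> BMOA 2" "BMOA_norm 2 (F n) \<le> 24" for n
    using bmoa_bound_imp_BMOA[OF bb[of n]] by (auto simp: F_def)
  have T: "T_op g ` BMOA 2 \<subseteq> BMOA 1" using comp by (simp add: BMOA_compact_def)
  have "range F \<subseteq> BMOA 2 \<and> bounded (range (\<lambda>n. BMOA_norm 2 (F n)))"
    using FB BMOA_norm_nonneg by (auto intro!: boundedI[of _ 24])
  then obtain h r where h: "h \<in> BMOA 1" and r: "strict_mono (r :: nat \<Rightarrow> nat)"
    and lim: "(\<lambda>n. BMOA_norm 1 (\<lambda>z. T_op g (F (r n)) z - h z)) \<longlonglongrightarrow> 0"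
    using comp unfolding BMOA_compact_def by blast
  have hh: "h holomorphic_on ball 0 1" using h by (simp add: BMOA_def)
  have Fh: "F n holomorphic_on ball 0 1" for n unfolding F_def by (rule test_fun_holomorphic[OF w(1)])
  have TB: "T_op g (F n) \<in> BMOA 1" for n using T FB by auto
  have Th: "T_op g (F n) holomorphic_on ball 0 1" for n by (rule T_op_holomorphic[OF Fh g])
  define D where "D n = (\<lambda>z. T_op g (F (r n)) z - h z)" for n
  have DB: "D n \<in> BMOA 1" for n unfolding D_def by (intro BMOA_1_diff TB h)
  have Dh: "D n holomorphic_on ball 0 1" for n unfolding D_def by (intro holomorphic_intros Th hh)
  have dD: "deriv (D n) z = F (r n) z * deriv g z - deriv h z" if "norm z < 1" for n z
    unfolding D_def using that by (simp add: deriv_diff_disc[OF Th hh] deriv_T_op[OF Fh g])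
  note [measurable] = measurable_disc_deriv[OF hh] measurable_disc_deriv[OF Dh]
  have "(\<integral>\<^sup>+z. ennreal (norm (deriv h z)) \<partial>disc_measure) = (\<integral>\<^sup>+z. liminf (\<lambda>n. ennreal (norm (deriv (D n) z))) \<partial>disc_measure)"
  proof (rule nn_integral_cong)
    fix z assume "z \<in> space disc_measure"
    then have z: "norm z < 1" by simp
    have "(\<lambda>n. F (r n) z) \<longlonglongrightarrow> 0"
      using LIMSEQ_subseq_LIMSEQ[OF test_fun_tendsto_0[OF w z] r] by (simp add: F_def o_def)
    then have "(\<lambda>n. ennreal (norm (F (r n) z * deriv g z - deriv h z))) \<longlonglongrightarrow> ennreal (norm (0 * deriv g z - deriv h z))"
      by (intro tendsto_intros tendsto_ennrealI)
    then have "(\<lambda>n. ennreal (norm (deriv (D n) z))) \<longlonglongrightarrow> ennreal (norm (deriv h z))"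
      by (simp add: dD[OF z])
    then show "ennreal (norm (deriv h z)) = liminf (\<lambda>n. ennreal (norm (deriv (D n) z)))"
      by (intro lim_imp_Liminf[symmetric]) auto
  qed
  also have "\<dots> \<le> liminf (\<lambda>n. \<integral>\<^sup>+z. ennreal (norm (deriv (D n) z)) \<partial>disc_measure)"
    by (rule nn_integral_liminf) measurable
  also have "\<dots> \<le> liminf (\<lambda>n. ennreal (BMOA_norm 1 (D n)))"
    using BMOA_1_integral_le[OF DB, of 0] by (intro Liminf_mono always_eventually allI) (simp add: BMOA_integral_1)
  also have "\<dots> = 0"
    using tendsto_ennrealI[OF lim] by (intro lim_imp_Liminf) (auto simp: D_def)
  finally have "(\<integral>\<^sup>+z. ennreal (norm (deriv h z)) \<partial>disc_measure) = 0" by simp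
  then have ae: "AE z in disc_measure. ennreal (norm (deriv h z)) = 0"
    by (subst (asm) nn_integral_0_iff_AE) auto
  have h0: "BMOA_integral 1 h a = 0" if a: "norm a < 1" for a
  proof -
    have "(\<integral>\<^sup>+z. ennreal (norm (deriv h z) * kern a z) \<partial>disc_measure) = (\<integral>\<^sup>+z. 0 \<partial>disc_measure)"
      using ae by (intro nn_integral_cong_AE) (auto elim!: eventually_mono)
    then show ?thesis by (simp add: BMOA_integral_1[OF a])
  qed
  from LIMSEQ_D[OF lim \<epsilon>] obtain N where N: "norm (BMOA_norm 1 (D N)) < \<epsilon>" by (auto simp: D_def)
  have "ennreal \<epsilon> < BMOA_integral 1 (T_op g (F (r N))) (w (r N))" using big by (simp add: F_def)
  also have "\<dots> \<le> BMOA_integral 1 (D N) (w (r N)) + BMOA_integral 1 h (w (r N))"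
    unfolding D_def by (rule BMOA_integral_1_triangle(2)[OF Th hh w(1)])
  also have "\<dots> \<le> ennreal (BMOA_norm 1 (D N))" using BMOA_1_integral_le[OF DB w(1)] by (simp add: h0 w(1))
  also have "\<dots> \<le> ennreal \<epsilon>" using N by (intro ennreal_leI) auto
  finally show False by simp
qed

section \<open>Gliding humps\<close>

text \<open>Uniform in w: the circle mean 1 / (1 - |w|^2 s) is at most 1 / (1 - s), which the weight
  cancels, so only the length of the interval from R^2 to 1 remains.\<close>

lemma nn_integral_outer_kernel:
  assumes w: "norm w < 1" and R: "0 \<le> R" "R < 1"
  shows "(\<integral>\<^sup>+z. ennreal ((1 - (norm z)\<^sup>2) / (norm (1 - cnj w * z))\<^sup>2) * indicator {z. R < norm z} z \<partial>disc_measure) \<le> ennreal (1 - R\<^sup>2)"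
proof -
  define \<omega> where "\<omega> s = (1 - s) * indicator {R\<^sup>2<..} s" for s :: real
  have R2: "R\<^sup>2 < 1" using R by (simp add: power_less_one_iff)
  have "R\<^sup>2 < (norm z)\<^sup>2 \<longleftrightarrow> R < norm z" for z :: complex
    using R power_mono_iff[of "norm z" R 2] by (metis norm_ge_zero not_le zero_less_numeral)
  then have "(\<integral>\<^sup>+z. ennreal ((1 - (norm z)\<^sup>2) / (norm (1 - cnj w * z))\<^sup>2) * indicator {z. R < norm z} z \<partial>disc_measure)
    = (\<integral>\<^sup>+z. ennreal (\<omega> ((norm z)\<^sup>2) / (norm (1 - cnj w * z))\<^sup>2) \<partial>disc_measure)"
    by (intro nn_integral_cong) (simp add: \<omega>_def indicator_def)
  also have "\<dots> = (\<integral>\<^sup>+s. ennreal (\<omega> s / (1 - (norm w)\<^sup>2 * s)) \<partial>unit_measure)"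
    unfolding \<omega>_def using w by (intro nn_integral_radial_kernel) auto
  also have "\<dots> \<le> (\<integral>\<^sup>+s. indicator {R\<^sup>2<..} s \<partial>unit_measure)"
  proof (rule nn_integral_mono)
    fix s assume "s \<in> space unit_measure"
    then have "0 < s" "s < 1" by auto
    note ws = square_norm_mult_le[OF w this]
    then have "(1 - s) / (1 - (norm w)\<^sup>2 * s) \<le> 1" by simp
    then show "ennreal (\<omega> s / (1 - (norm w)\<^sup>2 * s)) \<le> indicator {R\<^sup>2<..} s"
      by (auto simp: \<omega>_def indicator_def intro: ennreal_leI[of _ 1, simplified])
  qed
  also have "\<dots> = (\<integral>\<^sup>+s. indicator {R\<^sup>2<..<1} s \<partial>lborel)"
    unfolding nn_integral_unit_measure using R
    by (intro nn_integral_cong) (auto simp: indicator_def intro: le_less_trans[OF zero_le_power2])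
  also have "\<dots> = ennreal (1 - R\<^sup>2)" using R2 by simp
  finally show ?thesis .
qed

text \<open>A single test function has a bounded derivative, so its energy at \<open>a\<close> is
  O(1 - |a|^2). The radius obtained depends on w; this is the half of the hump property that handles
  base points near the circle.\<close>

lemma test_fun_integral_boundary:
  assumes w: "norm w < 1" and \<delta>: "0 < \<delta>"
  shows "\<exists>\<rho><1. \<forall>a. \<rho> \<le> norm a \<longrightarrow> norm a < 1 \<longrightarrow> BMOA_integral 2 (test_fun w) a \<le> ennreal \<delta>"
proof -
  define c where "c = (6 / (1 - norm w))\<^sup>2"
  have c: "0 < c" using w by (simp add: c_def)
  have le: "BMOA_integral 2 (test_fun w) a \<le> ennreal (c * (1 - (norm a)\<^sup>2))" if a: "norm a < 1" for a
  proof -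
    have "BMOA_integral 2 (test_fun w) a \<le> (\<integral>\<^sup>+z. ennreal c * ennreal ((1 - (norm z)\<^sup>2) * kern a z) \<partial>disc_measure)"
      unfolding BMOA_integral_2[OF a]
    proof (rule nn_integral_mono)
      fix z assume "z \<in> space disc_measure"
      then have z: "norm z < 1" by simp
      have "norm (deriv (test_fun w) z) \<le> 6 / norm (1 - cnj w * z)" by (rule norm_deriv_test_fun(1)[OF w z])
      also have "\<dots> \<le> 6 / (1 - norm w)"
        using one_minus_cnj_mult_lower[of z w] z w by (intro divide_left_mono mult_pos_pos) auto
      finally have "(norm (deriv (test_fun w) z))\<^sup>2 \<le> c" unfolding c_def by (intro power_mono) auto
      moreover have "0 \<le> (1 - (norm z)\<^sup>2) * kern a z"
        using one_minus_norm_square_pos[OF z] kern_nonneg[of a z] a by simp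
      ultimately have "(norm (deriv (test_fun w) z))\<^sup>2 * ((1 - (norm z)\<^sup>2) * kern a z) \<le> c * ((1 - (norm z)\<^sup>2) * kern a z)"
        by (rule mult_right_mono)
      then show "energy_density (test_fun w) a z \<le> ennreal c * ennreal ((1 - (norm z)\<^sup>2) * kern a z)"
        using c by (subst ennreal_mult'[symmetric]) (auto simp: mult.assoc intro!: ennreal_leI)
    qed
    also have "\<dots> = ennreal c * (\<integral>\<^sup>+z. ennreal ((1 - (norm z)\<^sup>2) * kern a z) \<partial>disc_measure)"
      by (rule nn_integral_cmult, rule measurable_disc_borel) measurable
    also have "\<dots> \<le> ennreal c * ennreal (1 - (norm a)\<^sup>2)"
      by (intro mult_left_mono nn_integral_one_minus_norm_kern a) simp
    also have "\<dots> = ennreal (c * (1 - (norm a)\<^sup>2))" using c by (intro ennreal_mult'[symmetric]) simp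
    finally show ?thesis .
  qed
  define d where "d = \<delta> / (2 * c)"
  have d: "0 < d" using c \<delta> by (simp add: d_def)
  have "BMOA_integral 2 (test_fun w) a \<le> ennreal \<delta>" if a: "1 - d \<le> norm a" "norm a < 1" for a
  proof -
    have "1 - (norm a)\<^sup>2 = (1 - norm a) * (1 + norm a)" by (simp add: power2_eq_square algebra_simps)
    also have "\<dots> \<le> d * 2" using a d by (intro mult_mono) auto
    finally have "c * (1 - (norm a)\<^sup>2) \<le> c * (d * 2)" using c by (intro mult_left_mono) auto
    also have "\<dots> = \<delta>" using c by (simp add: d_def)
    finally show ?thesis using le[OF a(2)] by (meson ennreal_leI order_trans)
  qed
  then show ?thesis using d by (intro exI[of _ "1 - d"]) auto
qed

text \<open>The other half of the hump property: for base points in a fixed disc the kernel is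
  bounded. The derivatives are uniformly small inside radius R, and outside it the uniform bound 6 /
  |1 - conj w z| meets a thin annulus.\<close>

lemma test_fun_integral_small:
  assumes w: "\<And>n::nat. norm (w n) < 1" "(\<lambda>n. norm (w n)) \<longlonglongrightarrow> 1" and \<rho>: "\<rho> < 1" and \<delta>: "0 < \<delta>"
  shows "eventually (\<lambda>n. \<forall>a. norm a \<le> \<rho> \<longrightarrow> BMOA_integral 2 (test_fun (w n)) a \<le> ennreal \<delta>) sequentially"
proof -
  define \<kappa> where "\<kappa> = 1 / (1 - \<rho>)\<^sup>2"
  have \<kappa>: "0 < \<kappa>" using \<rho> by (simp add: \<kappa>_def)
  \<comment> \<open>The inner and the outer part are each allowed \<kappa> d, half of
    \<delta>.\<close>
  define d where "d = \<delta> / (2 * \<kappa>)"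
  have d: "0 < d" using \<delta> \<kappa> by (simp add: d_def)
  \<comment> \<open>Chosen so that 36 (1 - R^2) \<le> d, with 36 from the squared derivative bound;
    the minimum with 1/2 keeps the radicand positive.\<close>
  define R where "R = sqrt (1 - min (1/2) (d / 36))"
  have R: "0 \<le> R" "R < 1" using d by (auto simp: R_def)
  have "R\<^sup>2 = 1 - min (1/2) (d / 36)" using d by (simp add: R_def)
  then have R36: "36 * (1 - R\<^sup>2) \<le> d" using d by simp
  have sd: "0 < sqrt d" using d by simp
  from test_fun_small[OF w R sd] show ?thesis
  proof eventually_elim
    case (elim n)
    note w1 = w(1)[of n]
    show ?case
    proof (intro allI impI)
      fix a :: complex assume a: "norm a \<le> \<rho>"
      then have a1: "norm a < 1" using \<rho> by simp
      have "BMOA_integral 2 (test_fun (w n)) a \<le> (\<integral>\<^sup>+z. ennreal (\<kappa> * d) + ennreal (36 * \<kappa>) *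
          (ennreal ((1 - (norm z)\<^sup>2) / (norm (1 - cnj (w n) * z))\<^sup>2) * indicator {z. R < norm z} z) \<partial>disc_measure)"
        unfolding BMOA_integral_2[OF a1]
      proof (rule nn_integral_mono)
        fix z assume "z \<in> space disc_measure"
        then have z: "norm z < 1" by simp
        define D where "D = norm (deriv (test_fun (w n)) z)"
        define u where "u = 1 - (norm z)\<^sup>2"
        have u: "0 \<le> u" "u \<le> 1" using one_minus_norm_square_pos[OF z] by (auto simp: u_def)
        have "kern a z \<le> (1 - (norm a)\<^sup>2) / (1 - \<rho>)\<^sup>2"
          unfolding kern_def using one_minus_cnj_mult_lower[of z a] z a \<rho> a1
          by (intro divide_left_mono power_mono mult_pos_pos zero_less_power) (auto simp: power_le_one)
        also have "\<dots> \<le> \<kappa>" unfolding \<kappa>_def by (intro divide_right_mono) auto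
        finally have k: "kern a z \<le> \<kappa>" .
        have kn: "0 \<le> kern a z" using a1 by (intro kern_nonneg) simp
        show "ennreal ((norm (deriv (test_fun (w n)) z))\<^sup>2 * (1 - (norm z)\<^sup>2) * kern a z)
          \<le> ennreal (\<kappa> * d) + ennreal (36 * \<kappa>) * (ennreal ((1 - (norm z)\<^sup>2) / (norm (1 - cnj (w n) * z))\<^sup>2) * indicator {z. R < norm z} z)"
        proof (cases "R < norm z")
          case False
          then have "D \<le> sqrt d" using elim by (simp add: D_def)
          then have "D\<^sup>2 \<le> (sqrt d)\<^sup>2" by (intro power_mono) (auto simp: D_def)
          then have "D\<^sup>2 * u * kern a z \<le> d * 1 * \<kappa>" using d u k kn by (intro mult_mono) auto
          then have "ennreal (D\<^sup>2 * u * kern a z) \<le> ennreal (\<kappa> * d)" by (intro ennreal_leI) (simp add: mult.commute)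
          then show ?thesis using False by (simp add: D_def u_def)
        next
          case True
          have "D\<^sup>2 \<le> (6 / norm (1 - cnj (w n) * z))\<^sup>2"
            unfolding D_def by (intro power_mono norm_deriv_test_fun(1)[OF w1 z]) auto
          then have "D\<^sup>2 * u * kern a z \<le> (6 / norm (1 - cnj (w n) * z))\<^sup>2 * u * \<kappa>"
            using u k kn by (intro mult_mono) auto
          also have "\<dots> = 36 * \<kappa> * (u / (norm (1 - cnj (w n) * z))\<^sup>2)" by (simp add: power_divide)
          finally have "ennreal (D\<^sup>2 * u * kern a z) \<le> ennreal (36 * \<kappa>) * ennreal (u / (norm (1 - cnj (w n) * z))\<^sup>2)"
            using \<kappa> by (subst ennreal_mult'[symmetric]) (auto intro: ennreal_leI)
          then show ?thesis using True by (auto simp: D_def u_def intro: add_increasing)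
        qed
      qed
      also have "\<dots> = ennreal (\<kappa> * d) + ennreal (36 * \<kappa>) * (\<integral>\<^sup>+z. ennreal ((1 - (norm z)\<^sup>2) / (norm (1 - cnj (w n) * z))\<^sup>2) * indicator {z. R < norm z} z \<partial>disc_measure)"
      proof -
        have [measurable]: "(\<lambda>z. ennreal ((1 - (norm z)\<^sup>2) / (norm (1 - cnj (w n) * z))\<^sup>2) * indicator {z. R < norm z} z) \<in> borel_measurable disc_measure"
          by (rule measurable_disc_borel) measurable
        show ?thesis by (subst nn_integral_add, measurable) (simp add: nn_integral_cmult)
      qed
      also have "\<dots> \<le> ennreal (\<kappa> * d) + ennreal (36 * \<kappa>) * ennreal (1 - R\<^sup>2)"
        by (intro add_mono mult_left_mono nn_integral_outer_kernel[OF w1 R] order_refl) simp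
      also have "\<dots> = ennreal (\<kappa> * d + 36 * \<kappa> * (1 - R\<^sup>2))"
      proof -
        have "0 \<le> 1 - R\<^sup>2" using R by (simp add: power_le_one)
        then show ?thesis using \<kappa> d by (subst ennreal_plus) (auto simp: ennreal_mult')
      qed
      also have "\<dots> \<le> ennreal \<delta>"
      proof (rule ennreal_leI)
        have "\<kappa> * (36 * (1 - R\<^sup>2)) \<le> \<kappa> * d" using \<kappa> R36 by (intro mult_left_mono) auto
        moreover have "\<kappa> * d + \<kappa> * d = \<delta>" using \<kappa> by (simp add: d_def)
        ultimately show "\<kappa> * d + 36 * \<kappa> * (1 - R\<^sup>2) \<le> \<delta>" by (simp add: mult_ac)
      qed
      finally show "BMOA_integral 2 (test_fun (w n)) a \<le> ennreal \<delta>" .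
    qed
  qed
qed

lemma sum_half_power_le: "(\<Sum>i<n. (1/2::real) ^ i) \<le> 2"
proof -
  have "(\<Sum>i<n. (1/2::real) ^ i) = 2 - 2 * (1/2) ^ n" by (induction n) auto
  then show ?thesis by simp
qed

text \<open>Cauchy-Schwarz with weight 1 at the distinguished index and 2^i elsewhere; the
  reciprocals sum to at most 1 + 2. The large term is thus not amplified with n, and the weights 2^i
  are beaten by a decay (1/4)^i of the others.\<close>

lemma weighted_square_sum_le:
  fixes x :: "nat \<Rightarrow> real"
  defines "c \<equiv> \<lambda>j i. if i = j then 1 else 2 ^ i"
  shows "(\<Sum>i<n. x i)\<^sup>2 \<le> 3 * (\<Sum>i<n. c j i * (x i)\<^sup>2)"
proof -
  have cp: "0 < c j i" for i by (simp add: c_def)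
  have "(\<Sum>i<n. x i)\<^sup>2 = (\<Sum>i<n. (1 / sqrt (c j i)) * (sqrt (c j i) * x i))\<^sup>2"
    using cp by (intro arg_cong[where f = "\<lambda>x. x\<^sup>2"] sum.cong refl) (simp add: less_imp_neq[symmetric])
  also have "\<dots> \<le> (\<Sum>i<n. (1 / sqrt (c j i))\<^sup>2) * (\<Sum>i<n. (sqrt (c j i) * x i)\<^sup>2)"
    by (rule Cauchy_Schwarz_ineq_sum)
  also have "\<dots> = (\<Sum>i<n. 1 / c j i) * (\<Sum>i<n. c j i * (x i)\<^sup>2)"
    using less_imp_le[OF cp] by (simp add: power_mult_distrib power_divide)
  also have "\<dots> \<le> 3 * (\<Sum>i<n. c j i * (x i)\<^sup>2)"
  proof (rule mult_right_mono)
    have "(\<Sum>i<n. 1 / c j i) \<le> (\<Sum>i<n. (1/2) ^ i + (if i = j then 1 else 0))"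
      by (intro sum_mono) (auto simp: c_def power_one_over)
    also have "\<dots> = (\<Sum>i<n. (1/2) ^ i) + (if j < n then 1 else 0)" by (simp add: sum.distrib)
    also have "\<dots> \<le> 3" using sum_half_power_le[of n] by auto
    finally show "(\<Sum>i<n. 1 / c j i) \<le> 3" .
    show "0 \<le> (\<Sum>i<n. c j i * (x i)\<^sup>2)" using cp by (intro sum_nonneg) (auto simp: less_imp_le)
  qed
  finally show ?thesis .
qed

text \<open>
  At each base point at most one of the functions has a large integral, so the partial sums stay
  bounded although the individual norms do not decay.
\<close>

lemma bmoa_bound_hump_sum:
  assumes F: "\<And>i. bmoa_bound (F i) 12"
    and at0: "\<And>i. 0 < i \<Longrightarrow> norm (F i 0) \<le> (1/2) ^ i"
    and hump: "\<And>a. norm a < 1 \<Longrightarrow> \<exists>j. \<forall>i. i \<noteq> j \<longrightarrow> BMOA_integral 2 (F i) a \<le> ennreal ((1/4) ^ i)"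
  shows "bmoa_bound (\<lambda>z. \<Sum>i<n. F i z) 21"
  unfolding bmoa_bound_def
proof (intro conjI allI impI)
  note D = bmoa_boundD[OF F]
  show "(\<lambda>z. \<Sum>i<n. F i z) holomorphic_on ball 0 1" by (intro holomorphic_intros D)
  \<comment> \<open>The term with index 0 is bounded only by 12, written as 1 + 11 to fit the
    geometric series.\<close>
  have "norm (F i 0) \<le> (1/2) ^ i + (if i = 0 then 11 else 0)" for i
    using at0[of i] D(3)[of i] by auto
  then have "norm (\<Sum>i<n. F i 0) \<le> (\<Sum>i<n. (1/2) ^ i + (if i = 0 then 11 else 0))" by (intro sum_norm_le)
  also have "\<dots> = (\<Sum>i<n. (1/2) ^ i) + (if 0 < n then 11 else 0)" by (simp add: sum.distrib)
  also have "\<dots> \<le> 21" using sum_half_power_le[of n] by auto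
  finally show "norm (\<Sum>i<n. F i 0) \<le> 21" .
  fix a :: complex assume a: "norm a < 1"
  then obtain j where j: "\<And>i. i \<noteq> j \<Longrightarrow> BMOA_integral 2 (F i) a \<le> ennreal ((1/4) ^ i)" using hump by blast
  define c where "c i = (if i = j then 1 else 2 ^ i :: real)" for i
  have c: "0 \<le> c i" for i by (simp add: c_def)
  note um = measurable_energy_density[OF D(1)]
  have "(\<integral>\<^sup>+z. energy_density (\<lambda>z. \<Sum>i<n. F i z) a z \<partial>disc_measure) \<le> (\<integral>\<^sup>+z. (\<Sum>i<n. ennreal (3 * c i) * energy_density (F i) a z) \<partial>disc_measure)"
  proof (rule nn_integral_mono)
    fix z assume "z \<in> space disc_measure"
    then have z: "norm z < 1" by simp
    have d: "deriv (\<lambda>z. \<Sum>i<n. F i z) z = (\<Sum>i<n. deriv (F i) z)"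
      using D(1) z by (intro DERIV_imp_deriv DERIV_sum holomorphic_derivI[OF D(1) open_ball]) auto
    define v where "v = (1 - (norm z)\<^sup>2) * kern a z"
    have v: "0 \<le> v" using one_minus_norm_square_pos[OF z] kern_nonneg[of a z] a by (simp add: v_def)
    have "(norm (\<Sum>i<n. deriv (F i) z))\<^sup>2 \<le> (\<Sum>i<n. norm (deriv (F i) z))\<^sup>2"
      by (intro power_mono norm_sum) auto
    also have "\<dots> \<le> 3 * (\<Sum>i<n. c i * (norm (deriv (F i) z))\<^sup>2)"
      unfolding c_def by (rule weighted_square_sum_le)
    finally have "(norm (\<Sum>i<n. deriv (F i) z))\<^sup>2 * v \<le> 3 * (\<Sum>i<n. c i * (norm (deriv (F i) z))\<^sup>2) * v"
      using v by (rule mult_right_mono)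
    also have "\<dots> = (\<Sum>i<n. 3 * c i * ((norm (deriv (F i) z))\<^sup>2 * v))"
      by (simp add: sum_distrib_left sum_distrib_right mult_ac)
    finally have "ennreal ((norm (\<Sum>i<n. deriv (F i) z))\<^sup>2 * v) \<le> ennreal (\<Sum>i<n. 3 * c i * ((norm (deriv (F i) z))\<^sup>2 * v))"
      by (rule ennreal_leI)
    also have "\<dots> = (\<Sum>i<n. ennreal (3 * c i * ((norm (deriv (F i) z))\<^sup>2 * v)))"
      using c v by (intro sum_ennreal[symmetric]) auto
    also have "\<dots> = (\<Sum>i<n. ennreal (3 * c i) * ennreal ((norm (deriv (F i) z))\<^sup>2 * v))"
      using c by (intro sum.cong refl ennreal_mult') auto
    finally show "energy_density (\<lambda>z. \<Sum>i<n. F i z) a z \<le> (\<Sum>i<n. ennreal (3 * c i) * energy_density (F i) a z)"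
      by (simp only: d v_def mult.assoc)
  qed
  also have "\<dots> = (\<Sum>i<n. ennreal (3 * c i) * (\<integral>\<^sup>+z. energy_density (F i) a z \<partial>disc_measure))"
    using um by (subst nn_integral_sum) (auto simp: nn_integral_cmult)
  also have "\<dots> \<le> (\<Sum>i<n. ennreal (3 * ((1/2) ^ i + (if i = j then 144 else 0))))"
  proof (rule sum_mono)
    fix i
    show "ennreal (3 * c i) * (\<integral>\<^sup>+z. energy_density (F i) a z \<partial>disc_measure) \<le> ennreal (3 * ((1/2) ^ i + (if i = j then 144 else 0)))"
    proof (cases "i = j")
      case True
      have "ennreal (3 * c i) * (\<integral>\<^sup>+z. energy_density (F i) a z \<partial>disc_measure) \<le> ennreal 3 * ennreal (12\<^sup>2)"
        using True by (intro mult_mono D(4) a) (auto simp: c_def)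
      also have "\<dots> = ennreal (3 * 144)" by (subst ennreal_mult'[symmetric]) auto
      also have "\<dots> \<le> ennreal (3 * ((1/2) ^ i + 144))" by (intro ennreal_leI) simp
      finally show ?thesis using True by simp
    next
      case False
      have "ennreal (3 * c i) * (\<integral>\<^sup>+z. energy_density (F i) a z \<partial>disc_measure) \<le> ennreal (3 * 2 ^ i) * ennreal ((1/4) ^ i)"
        using False j[OF False] by (intro mult_mono) (auto simp: c_def BMOA_integral_2[OF a])
      also have "\<dots> = ennreal (3 * 2 ^ i * (1/4) ^ i)" by (intro ennreal_mult'[symmetric]) simp
      also have "3 * 2 ^ i * (1/4) ^ i = 3 * (1/2 :: real) ^ i"
        by (simp add: mult.assoc flip: power_mult_distrib)
      finally show ?thesis using False by simp
    qed
  qed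
  also have "\<dots> = ennreal (\<Sum>i<n. 3 * ((1/2) ^ i + (if i = j then 144 else 0)))"
    by (rule sum_ennreal) auto
  also have "\<dots> \<le> ennreal (21\<^sup>2)"
  proof (rule ennreal_leI)
    have "(\<Sum>i<n. 3 * ((1/2::real) ^ i + (if i = j then 144 else 0))) = 3 * ((\<Sum>i<n. (1/2) ^ i) + (if j < n then 144 else 0))"
      by (simp add: sum.distrib flip: sum_distrib_left)
    \<comment> \<open>3 * (2 + 144) = 438, just below 441; this fixes the constant 21.\<close>
    also have "\<dots> \<le> 21\<^sup>2" using sum_half_power_le[of n] by auto
    finally show "(\<Sum>i<n. 3 * ((1/2::real) ^ i + (if i = j then 144 else 0))) \<le> 21\<^sup>2" .
  qed
  finally show "(\<integral>\<^sup>+z. energy_density (\<lambda>z. \<Sum>i<n. F i z) a z \<partial>disc_measure) \<le> ennreal (21\<^sup>2)" .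
qed simp

definition truncated_integral :: "(complex \<Rightarrow> complex) \<Rightarrow> (complex \<Rightarrow> complex) \<Rightarrow> complex \<Rightarrow> real \<Rightarrow> ennreal" where
  "truncated_integral g f a R =
     (\<integral>\<^sup>+z. ennreal (norm (f z) * kern a z) * (deriv_density g z * indicator {z. norm z \<le> R} z) \<partial>disc_measure)"

lemma measurable_truncated:
  assumes "g holomorphic_on ball 0 1" "f holomorphic_on ball 0 1"
  shows "(\<lambda>z. ennreal (norm (f z) * kern a z) * (deriv_density g z * indicator {z. norm z \<le> R} z)) \<in> borel_measurable disc_measure"
proof -
  note [measurable] = measurable_deriv_density[OF assms(1)] measurable_disc_holomorphic[OF assms(2)]
  have [measurable]: "kern a \<in> borel_measurable disc_measure" "(\<lambda>z. indicator {z. norm z \<le> R} z :: ennreal) \<in> borel_measurable disc_measure"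
    by (rule measurable_disc_borel, measurable)+
  show ?thesis by measurable
qed

lemma truncated_integral_le:
  assumes "f holomorphic_on ball 0 1" "g holomorphic_on ball 0 1" "norm a < 1"
  shows "truncated_integral g f a R \<le> BMOA_integral 1 (T_op g f) a"
  unfolding truncated_integral_def BMOA_integral_T_op[OF assms]
  by (intro nn_integral_mono) (auto simp: indicator_def)

lemma truncated_integral_exhausts:
  assumes f: "f holomorphic_on ball 0 1" and g: "g holomorphic_on ball 0 1" and a: "norm a < 1"
    and less: "c < BMOA_integral 1 (T_op g f) a"
  shows "\<exists>R. 0 \<le> R \<and> R < 1 \<and> c < truncated_integral g f a R"
proof -
  define \<rho> where "\<rho> k = 1 - 1 / (real k + 1)" for k
  have \<rho>: "0 \<le> \<rho> k" "\<rho> k < 1" for k by (auto simp: \<rho>_def field_simps)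
  have mono: "\<rho> k \<le> \<rho> l" if "k \<le> l" for k l using that by (simp add: \<rho>_def frac_le)
  have ex: "\<exists>k. x \<le> \<rho> k" if "x < 1" for x
  proof -
    obtain n where "1 / (1 - x) < real n" using reals_Archimedean2 by blast
    then have "1 / (real n + 1) \<le> 1 - x" using that by (simp add: field_simps)
    then show ?thesis by (auto simp: \<rho>_def intro!: exI[of _ n])
  qed
  let ?u = "\<lambda>k z. ennreal (norm (f z) * kern a z) * (deriv_density g z * indicator {z. norm z \<le> \<rho> k} z)"
  have "BMOA_integral 1 (T_op g f) a \<le> (\<integral>\<^sup>+z. (SUP k. ?u k z) \<partial>disc_measure)"
    unfolding BMOA_integral_T_op[OF f g a]
  proof (rule nn_integral_mono)
    fix z assume "z \<in> space disc_measure"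
    then obtain k where "norm z \<le> \<rho> k" using ex[of "norm z"] by auto
    then show "ennreal (norm (f z) * kern a z) * deriv_density g z \<le> (SUP k. ?u k z)"
      by (intro SUP_upper2[of k]) auto
  qed
  also have "\<dots> = (SUP k. \<integral>\<^sup>+z. ?u k z \<partial>disc_measure)"
  proof (rule nn_integral_monotone_convergence_SUP)
    show "incseq ?u"
      using mono by (auto simp: incseq_def le_fun_def indicator_def intro: order_trans)
  qed (rule measurable_truncated[OF g f])
  finally have "c < (SUP k. \<integral>\<^sup>+z. ?u k z \<partial>disc_measure)" using less by (rule less_le_trans[rotated])
  then show ?thesis using \<rho> by (auto simp: less_SUP_iff truncated_integral_def)
qed

lemma bmoa_bound_const_1: "bmoa_bound (\<lambda>_. 1) 1"
  by (simp add: bmoa_bound_def)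

text \<open>The constant function 1 at base point 0, where the kernel is 1, gives exactly this
  mass.\<close>

lemma deriv_mass_finite_of_T_op:
  assumes g: "g holomorphic_on ball 0 1" and T: "T_op g ` BMOA 2 \<subseteq> BMOA 1"
  shows "(\<integral>\<^sup>+z. deriv_density g z \<partial>disc_measure) < \<infinity>"
proof -
  have "T_op g (\<lambda>_. 1) \<in> BMOA 1" using T bmoa_bound_imp_BMOA(1)[OF bmoa_bound_const_1] by auto
  then have "BMOA_integral 1 (T_op g (\<lambda>_. 1)) 0 \<le> ennreal (BMOA_norm 1 (T_op g (\<lambda>_. 1)))"
    by (rule BMOA_1_integral_le) simp
  moreover have "BMOA_integral 1 (T_op g (\<lambda>_. 1)) 0 = (\<integral>\<^sup>+z. deriv_density g z \<partial>disc_measure)"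
    by (subst BMOA_integral_T_op[OF _ g]) simp_all
  ultimately have "(\<integral>\<^sup>+z. deriv_density g z \<partial>disc_measure) \<le> ennreal (BMOA_norm 1 (T_op g (\<lambda>_. 1)))"
    by simp
  then show ?thesis by (rule le_less_trans) auto
qed

lemma eventually_boundary_sequence:
  assumes "eventually P (filtercomap norm (at_left 1))" and w: "\<And>n::nat. norm (w n) < 1" "(\<lambda>n. norm (w n)) \<longlonglongrightarrow> 1"
  shows "eventually (\<lambda>n. P (w n :: complex)) sequentially"
proof -
  obtain r where r: "r < 1" "\<And>a. r < norm a \<Longrightarrow> norm a < 1 \<Longrightarrow> P a"
    using assms(1) unfolding tendsto_boundary_filter by blast
  from order_tendstoD(1)[OF w(2) r(1)] show ?thesis
    by eventually_elim (use r(2) w(1) in blast)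
qed

text \<open>
  If the condition fails along \<open>w\<^sub>n\<close>, a sparse sum \<open>f\<close> of the test functions \<open>F\<^sub>n\<close> is still in BMOA,
  and at each selected point its own hump dominates: the earlier humps contribute little because
  they are mapped into \<open>VMOA\<^sub>1\<close>, the later ones because they are small on the compact disc to which
  the integral is truncated.
\<close>

lemma VMOA_imp_vanishing:
  assumes g: "g holomorphic_on ball 0 1" and T: "T_op g ` BMOA 2 \<subseteq> VMOA 1"
  shows "vanishing_log_carleson g"
proof (rule ccontr)
  assume "\<not> vanishing_log_carleson g"
  then obtain \<epsilon> w where \<epsilon>: "0 < \<epsilon>" and w: "\<And>n::nat. norm (w n) < 1" "(\<lambda>n. norm (w n)) \<longlonglongrightarrow> 1"
    and big: "\<And>n. ennreal \<epsilon> < BMOA_integral 1 (T_op g (test_fun (w n))) (w n)"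
    using not_vanishing_sequence[OF g] by blast
  define F where "F n = test_fun (w n)" for n
  have bb: "bmoa_bound (F n) 12" for n unfolding F_def by (rule bmoa_bound_test_fun[OF w(1)])
  have Fh: "F n holomorphic_on ball 0 1" for n by (rule bmoa_boundD(1)[OF bb])
  have TV: "(BMOA_integral 1 (T_op g f) \<longlongrightarrow> 0) (filtercomap norm (at_left 1))" if "bmoa_bound f A" for f A
    using T bmoa_bound_imp_BMOA(1)[OF that] by (auto simp: VMOA_def)
  define m where "m = enn2real (\<integral>\<^sup>+z. deriv_density g z \<partial>disc_measure)"
  have "T_op g ` BMOA 2 \<subseteq> BMOA 1" using T by (auto simp: VMOA_def)
  from deriv_mass_finite_of_T_op[OF g this]
  have m: "(\<integral>\<^sup>+z. deriv_density g z \<partial>disc_measure) \<le> ennreal m" "0 \<le> m" by (auto simp: m_def)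
  \<comment> \<open>The required size of f cancels (1 - R)^(-2) from the kernel bound and the total
    mass m, with m + 1 to cover m = 0.\<close>
  have small: "truncated_integral g f (w i) R \<le> ennreal d"
    if f: "f holomorphic_on ball 0 1" and R: "R < 1" and d: "0 < d"
      and B: "\<And>z. norm z \<le> R \<Longrightarrow> norm (f z) \<le> d * (1 - R)\<^sup>2 / (m + 1)" for f i R d
  proof -
    have B0: "0 \<le> d * (1 - R)\<^sup>2 / (m + 1)" using d m by simp
    have "truncated_integral g f (w i) R \<le> ennreal (d * (1 - R)\<^sup>2 / (m + 1) * ((1 - (norm (w i))\<^sup>2) / (1 - R)\<^sup>2) * m)"
      unfolding truncated_integral_def
      by (rule kern_inner_integral_le[OF g measurable_disc_holomorphic[OF f] R B B0 w(1) m])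
    also have "\<dots> \<le> ennreal d"
    proof (rule ennreal_leI)
      have "d * (1 - R)\<^sup>2 / (m + 1) * ((1 - (norm (w i))\<^sup>2) / (1 - R)\<^sup>2) * m = d * ((1 - (norm (w i))\<^sup>2) * (m / (m + 1)))"
        using R by simp
      also have "\<dots> \<le> d * (1 * 1)"
        using m d w(1)[of i] by (intro mult_left_mono mult_mono) (auto simp: power_le_one)
      finally show "d * (1 - R)\<^sup>2 / (m + 1) * ((1 - (norm (w i))\<^sup>2) / (1 - R)\<^sup>2) * m \<le> d" by simp
    qed
    finally show ?thesis .
  qed
  have "\<exists>R. 0 \<le> R \<and> R < 1 \<and> ennreal \<epsilon> < truncated_integral g (F n) (w n) R" for n
    by (rule truncated_integral_exhausts[OF Fh g w(1)]) (use big in \<open>simp add: F_def\<close>)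
  then obtain R where R: "\<And>n. 0 \<le> R n" "\<And>n. R n < 1" "\<And>n. ennreal \<epsilon> < truncated_integral g (F n) (w n) (R n)" by metis
  have "\<exists>\<rho><1. \<forall>a. \<rho> \<le> norm a \<longrightarrow> norm a < 1 \<longrightarrow> BMOA_integral 2 (F n) a \<le> ennreal ((1/4) ^ n)" for n
    unfolding F_def by (rule test_fun_integral_boundary[OF w(1)]) simp
  then obtain \<rho> where \<rho>: "\<And>n. \<rho> n < 1" "\<And>n a. \<rho> n \<le> norm a \<Longrightarrow> norm a < 1 \<Longrightarrow> BMOA_integral 2 (F n) a \<le> ennreal ((1/4) ^ n)" by metis
  \<comment> \<open>c \<le> \<epsilon> / 16 keeps all other humps together below 2 c \<le>
    \<epsilon> / 8; c \<le> 1 gives the decay required by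
    \<open>bmoa_bound_hump_sum\<close>.\<close>
  define c where "c = min 1 (\<epsilon> / 16)"
  have c: "0 < c" "c \<le> 1" "c \<le> \<epsilon> / 16" using \<epsilon> by (auto simp: c_def)
  define \<delta> where "\<delta> j = c * (1/4) ^ j" for j
  have \<delta>: "0 < \<delta> j" for j using c by (simp add: \<delta>_def)
  \<comment> \<open>What a new index n must satisfy relative to an older l: the old hump is small at
    the new point, the new hump is small in the old truncated integral and at the base points where
    the old one may be large, and it is small at 0.\<close>
  define E where "E l n d \<longleftrightarrow> BMOA_integral 1 (T_op g (F l)) (w n) \<le> ennreal d \<and>
    truncated_integral g (F n) (w l) (R l) \<le> ennreal d \<and>
    (\<forall>a. norm a \<le> \<rho> l \<longrightarrow> BMOA_integral 2 (F n) a \<le> ennreal d) \<and> norm (F n 0) \<le> d" for l n :: nat and d :: real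
  have evE: "eventually (\<lambda>n. \<forall>l\<in>{..N}. E l n d) sequentially" if d: "0 < d" for N d
  proof (intro eventually_ball_finite ballI)
    fix l
    have "0 < d * (1 - R l)\<^sup>2 / (m + 1)" using d R(2)[of l] m by (intro divide_pos_pos mult_pos_pos) auto
    from test_fun_small[OF w R(1)[of l] R(2)[of l] this]
    have "eventually (\<lambda>n. truncated_integral g (F n) (w l) (R l) \<le> ennreal d) sequentially"
      by eventually_elim (intro small Fh R(2) d, simp add: F_def)
    moreover have "eventually (\<lambda>n. BMOA_integral 1 (T_op g (F l)) (w n) < ennreal d) sequentially"
      by (rule eventually_boundary_sequence[OF ennreal_tendsto_0D[OF TV[OF bb] d] w])
    moreover have "eventually (\<lambda>n. \<forall>a. norm a \<le> \<rho> l \<longrightarrow> BMOA_integral 2 (F n) a \<le> ennreal d) sequentially"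
      unfolding F_def by (rule test_fun_integral_small[OF w \<rho>(1) d])
    moreover from test_fun_small[OF w order_refl _ d]
    have "eventually (\<lambda>n. norm (F n 0) \<le> d) sequentially"
      by (simp add: F_def eventually_conj_iff)
    ultimately show "eventually (\<lambda>n. E l n d) sequentially"
      by eventually_elim (auto simp: E_def less_imp_le)
  qed simp
  \<comment> \<open>Demanding \<open>E\<close> for every l up to k j, and not merely for selected
    indices, makes each choice depend only on the last one, so no history has to be
    recorded.\<close>
  have "\<exists>k. \<forall>j. True \<and> (k j < k (Suc j) \<and> (\<forall>l\<in>{..k j}. E l (k (Suc j)) (\<delta> (Suc j))))"
  proof (rule dependent_nat_choice[where P = "\<lambda>_ _. True" and Q = "\<lambda>j x y. x < y \<and> (\<forall>l\<in>{..x}. E l y (\<delta> (Suc j)))"])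
    fix x j :: nat
    from eventually_conj[OF evE[OF \<delta>[of "Suc j"], of x] eventually_gt_at_top[of x]]
    show "\<exists>y. True \<and> (x < y \<and> (\<forall>l\<in>{..x}. E l y (\<delta> (Suc j))))"
      by (auto simp: eventually_sequentially)
  qed simp
  then obtain k where k: "\<And>j. k j < k (Suc j)" "\<And>j l. l \<le> k j \<Longrightarrow> E l (k (Suc j)) (\<delta> (Suc j))" by auto
  have kmono: "strict_mono k" using k(1) by (simp add: strict_mono_Suc_iff)
  have Ek: "E (k i) (k j) (\<delta> j)" if "i < j" for i j
  proof -
    from \<open>i < j\<close> obtain l where l: "j = Suc l" by (cases j) auto
    then have "k i \<le> k l" using that strict_mono_less_eq[OF kmono] by simp
    from k(2)[OF this] show ?thesis by (simp add: l)
  qed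
  define G where "G i = F (k i)" for i
  have \<delta>_le: "\<delta> j \<le> c * (1/2) ^ i" if "i \<le> j" for i j
  proof -
    have "(1/4::real) ^ j \<le> (1/4) ^ i" using that by (intro power_decreasing) auto
    also have "\<dots> \<le> (1/2) ^ i" by (intro power_mono) auto
    finally show ?thesis unfolding \<delta>_def using c by (intro mult_left_mono) auto
  qed
  have hump: "\<exists>j. \<forall>i. i \<noteq> j \<longrightarrow> BMOA_integral 2 (G i) a \<le> ennreal ((1/4) ^ i)" if a: "norm a < 1" for a
  proof -
    have below: "BMOA_integral 2 (G i) a \<le> ennreal ((1/4) ^ i)" if "\<rho> (k i) \<le> norm a" for i
    proof -
      have "BMOA_integral 2 (G i) a \<le> ennreal ((1/4) ^ k i)" unfolding G_def by (rule \<rho>(2)[OF that a])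
      also have "\<dots> \<le> ennreal ((1/4) ^ i)"
        using strict_mono_imp_increasing[OF kmono, of i] by (intro ennreal_leI power_decreasing) auto
      finally show ?thesis .
    qed
    show ?thesis
    proof (cases "\<exists>i. norm a < \<rho> (k i)")
      case False
      then show ?thesis using below by (auto simp: not_less)
    next
      case True
      \<comment> \<open>The first hump for which |a| is not yet in the boundary zone. Earlier humps
        are small at \<open>a\<close> by their boundary decay; later ones because |a| \<le> \<rho>
        (k j), where they were chosen small.\<close>
      define j where "j = (LEAST i. norm a < \<rho> (k i))"
      have j: "norm a < \<rho> (k j)" unfolding j_def by (rule LeastI_ex[OF True])
      have "BMOA_integral 2 (G i) a \<le> ennreal ((1/4) ^ i)" if "i \<noteq> j" for i
      proof (cases "i < j")
        case True
        then have "\<not> norm a < \<rho> (k i)" unfolding j_def by (rule not_less_Least)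
        then show ?thesis by (intro below) simp
      next
        case False
        then have "j < i" using that by simp
        from Ek[OF this] have "BMOA_integral 2 (G i) a \<le> ennreal (\<delta> i)" using j by (simp add: E_def G_def)
        also have "\<dots> \<le> ennreal ((1/4) ^ i)" using c by (intro ennreal_leI) (simp add: \<delta>_def)
        finally show ?thesis .
      qed
      then show ?thesis by blast
    qed
  qed
  define S where "S n z = (\<Sum>i<n. G i z)" for n z
  have Sbb: "bmoa_bound (S n) 21" for n
    unfolding S_def
  proof (rule bmoa_bound_hump_sum)
    show "bmoa_bound (G i) 12" for i unfolding G_def by (rule bb)
    show "norm (G i 0) \<le> (1/2) ^ i" if "0 < i" for i
    proof -
      have "norm (G i 0) \<le> \<delta> i" using Ek[OF that] by (simp add: E_def G_def)
      also have "\<dots> \<le> c * (1/2) ^ i" by (rule \<delta>_le) simp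
      also have "\<dots> \<le> 1 * (1/2) ^ i" using c by (intro mult_right_mono) auto
      finally show ?thesis by simp
    qed
  qed (rule hump)
  \<comment> \<open>Convergence of the series is never proved: a subsequential limit of the partial
    sums is enough for what follows.\<close>
  obtain f r where f: "bmoa_bound f 21" and r: "strict_mono (r :: nat \<Rightarrow> nat)"
    and lim: "\<And>K. compact K \<Longrightarrow> K \<subseteq> ball 0 1 \<Longrightarrow> uniform_limit K (\<lambda>n. S (r n)) f sequentially"
    using bmoa_bound_Montel[of S 21, OF Sbb] by blast
  have fh: "f holomorphic_on ball 0 1" and Sh: "S n holomorphic_on ball 0 1" and Gh: "G i holomorphic_on ball 0 1" for n i
    using bmoa_boundD(1)[OF f] bmoa_boundD(1)[OF Sbb] Fh by (auto simp: G_def)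
  have lower: "\<not> BMOA_integral 1 (T_op g f) (w (k j)) < ennreal (\<epsilon> / 4)" for j
  proof
    assume less: "BMOA_integral 1 (T_op g f) (w (k j)) < ennreal (\<epsilon> / 4)"
    define Rj where "Rj = R (k j)"
    have Rj: "0 \<le> Rj" "Rj < 1" using R by (auto simp: Rj_def)
    let ?Q = "\<lambda>u. truncated_integral g u (w (k j)) Rj"
    have e: "0 < \<epsilon> / 16 * (1 - Rj)\<^sup>2 / (m + 1)" using \<epsilon> Rj m by (intro divide_pos_pos mult_pos_pos) auto
    have "cball (0::complex) Rj \<subseteq> ball 0 1" using Rj by auto
    then have "uniform_limit (cball 0 Rj) (\<lambda>n. S (r n)) f sequentially" by (intro lim) auto
    from eventually_conj[OF uniform_limitD[OF this e] eventually_gt_at_top[of j]]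
    obtain N where "j < N" "\<forall>z\<in>cball 0 Rj. dist (S (r N) z) (f z) < \<epsilon> / 16 * (1 - Rj)\<^sup>2 / (m + 1)"
      by (auto simp only: eventually_sequentially)
    then have N: "j < N" "\<And>z. norm z \<le> Rj \<Longrightarrow> norm (S (r N) z - f z) \<le> \<epsilon> / 16 * (1 - Rj)\<^sup>2 / (m + 1)"
      by (simp_all add: dist_norm less_imp_le)
    \<comment> \<open>Since r N \<ge> N > j, the partial sum contains hump j, which can be isolated
      from it.\<close>
    define n where "n = r N"
    have n: "j < n" using N(1) strict_mono_imp_increasing[OF r, of N] by (simp add: n_def)
    have dh: "(\<lambda>z. S n z - f z) holomorphic_on ball 0 1" by (intro holomorphic_intros Sh fh)
    have tri: "?Q (G j) \<le> ?Q f + (?Q (\<lambda>z. S n z - f z) + (\<Sum>i\<in>{..<n} - {j}. ?Q (G i)))"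
    proof -
      let ?u = "\<lambda>u z. ennreal (norm (u z) * kern (w (k j)) z) * (deriv_density g z * indicator {z. norm z \<le> Rj} z)"
      note meas = measurable_truncated[OF g, where a = "w (k j)" and R = Rj]
      have "?Q (G j) \<le> (\<integral>\<^sup>+z. ?u f z + (?u (\<lambda>z. S n z - f z) z + (\<Sum>i\<in>{..<n} - {j}. ?u (G i) z)) \<partial>disc_measure)"
        unfolding truncated_integral_def
      proof (rule nn_integral_mono)
        fix z
        define q where "q = kern (w (k j)) z"
        have q: "0 \<le> q" unfolding q_def using w(1)[of "k j"] by (intro kern_nonneg) simp
        define \<psi> where "\<psi> = deriv_density g z * indicator {z. norm z \<le> Rj} z"
        have "S n z = G j z + (\<Sum>i\<in>{..<n} - {j}. G i z)"
          unfolding S_def using n by (intro sum.remove) auto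
        \<comment> \<open>Hump j is recovered from f, the error of the partial sum and the other
          humps; on the truncation disc every term on the right is under control.\<close>
        then have "G j z = f z + ((S n z - f z) - (\<Sum>i\<in>{..<n} - {j}. G i z))" by simp
        then have "norm (G j z) \<le> norm (f z) + norm ((S n z - f z) - (\<Sum>i\<in>{..<n} - {j}. G i z))"
          by (metis norm_triangle_ineq)
        also have "\<dots> \<le> norm (f z) + (norm (S n z - f z) + norm (\<Sum>i\<in>{..<n} - {j}. G i z))"
          by (intro add_left_mono norm_triangle_ineq4)
        also have "\<dots> \<le> norm (f z) + (norm (S n z - f z) + (\<Sum>i\<in>{..<n} - {j}. norm (G i z)))"
          by (intro add_left_mono norm_sum)
        finally have "norm (G j z) * q \<le> (norm (f z) + (norm (S n z - f z) + (\<Sum>i\<in>{..<n} - {j}. norm (G i z)))) * q"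
          using q by (rule mult_right_mono)
        then have "ennreal (norm (G j z) * q) \<le> ennreal (norm (f z) * q + (norm (S n z - f z) * q + (\<Sum>i\<in>{..<n} - {j}. norm (G i z) * q)))"
          by (intro ennreal_leI) (simp add: distrib_right sum_distrib_right)
        also have "\<dots> = ennreal (norm (f z) * q) + (ennreal (norm (S n z - f z) * q) + (\<Sum>i\<in>{..<n} - {j}. ennreal (norm (G i z) * q)))"
          using q by (simp add: ennreal_plus[symmetric] sum_nonneg del: ennreal_plus)
        finally have "ennreal (norm (G j z) * q) * \<psi> \<le> (ennreal (norm (f z) * q) + (ennreal (norm (S n z - f z) * q) + (\<Sum>i\<in>{..<n} - {j}. ennreal (norm (G i z) * q)))) * \<psi>"
          by (rule mult_right_mono) simp
        then show "?u (G j) z \<le> ?u f z + (?u (\<lambda>z. S n z - f z) z + (\<Sum>i\<in>{..<n} - {j}. ?u (G i) z))"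
          unfolding q_def[symmetric] \<psi>_def[symmetric] by (simp only: distrib_right sum_distrib_right)
      qed
      also have "\<dots> = ?Q f + (?Q (\<lambda>z. S n z - f z) + (\<Sum>i\<in>{..<n} - {j}. ?Q (G i)))"
        unfolding truncated_integral_def
        using meas[OF fh] meas[OF dh] meas[OF Gh]
        by (subst nn_integral_add nn_integral_sum | simp)+
      finally show ?thesis .
    qed
    have "?Q (G i) \<le> ennreal (c * (1/2) ^ i)" if "i \<noteq> j" for i
    proof (cases "i < j")
      case True
      have "?Q (G i) \<le> BMOA_integral 1 (T_op g (G i)) (w (k j))" by (rule truncated_integral_le[OF Gh g w(1)])
      also have "\<dots> \<le> ennreal (\<delta> j)" using Ek[OF True] by (simp add: E_def G_def)
      also have "\<dots> \<le> ennreal (c * (1/2) ^ i)" using True by (intro ennreal_leI \<delta>_le) simp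
      finally show ?thesis .
    next
      case False
      then have "j < i" using that by simp
      from Ek[OF this] have "?Q (G i) \<le> ennreal (\<delta> i)" by (simp add: E_def G_def Rj_def)
      also have "\<dots> \<le> ennreal (c * (1/2) ^ i)" by (intro ennreal_leI \<delta>_le) simp
      finally show ?thesis .
    qed
    then have "(\<Sum>i\<in>{..<n} - {j}. ?Q (G i)) \<le> (\<Sum>i\<in>{..<n} - {j}. ennreal (c * (1/2) ^ i))"
      by (intro sum_mono) auto
    also have "\<dots> = ennreal (\<Sum>i\<in>{..<n} - {j}. c * (1/2) ^ i)" using c by (intro sum_ennreal) auto
    also have "\<dots> \<le> ennreal (\<epsilon> / 8)"
    proof (rule ennreal_leI)
      have "(\<Sum>i\<in>{..<n} - {j}. c * (1/2) ^ i) \<le> (\<Sum>i<n. c * (1/2) ^ i)"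
        using c by (intro sum_mono2) auto
      also have "\<dots> = c * (\<Sum>i<n. (1/2) ^ i)" by (simp add: sum_distrib_left)
      also have "\<dots> \<le> c * 2" using c sum_half_power_le[of n] by (intro mult_left_mono) auto
      finally show "(\<Sum>i\<in>{..<n} - {j}. c * (1/2) ^ i) \<le> \<epsilon> / 8" using c by simp
    qed
    finally have 3: "(\<Sum>i\<in>{..<n} - {j}. ?Q (G i)) \<le> ennreal (\<epsilon> / 8)" .
    have 2: "?Q (\<lambda>z. S n z - f z) \<le> ennreal (\<epsilon> / 16)"
      by (rule small[OF dh Rj(2)]) (use \<epsilon> N(2) in \<open>auto simp: n_def\<close>)
    have 1: "?Q f \<le> ennreal (\<epsilon> / 4)"
      using truncated_integral_le[OF fh g w(1)] less by (meson less_imp_le order_trans)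
    have "ennreal \<epsilon> < ?Q (G j)" using R(3)[of "k j"] by (simp add: G_def Rj_def)
    also have "\<dots> \<le> ennreal (\<epsilon> / 4) + (ennreal (\<epsilon> / 16) + ennreal (\<epsilon> / 8))"
      by (rule order_trans[OF tri]) (intro add_mono 1 2 3)
    \<comment> \<open>The total is 7 \<epsilon> / 16, below the \<epsilon> that hump j contributes
      by itself.\<close>
    also have "\<dots> = ennreal (\<epsilon> / 4 + (\<epsilon> / 16 + \<epsilon> / 8))" using \<epsilon> by (simp flip: ennreal_plus)
    also have "\<dots> \<le> ennreal \<epsilon>" using \<epsilon> by (intro ennreal_leI) simp
    finally show False by simp
  qed
  have "0 < \<epsilon> / 4" using \<epsilon> by simp
  have wk: "norm (w (k j)) < 1" "(\<lambda>j. norm (w (k j))) \<longlonglongrightarrow> 1" for j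
    using w(1) LIMSEQ_subseq_LIMSEQ[OF w(2) kmono] by (auto simp: o_def)
  from eventually_boundary_sequence[OF ennreal_tendsto_0D[OF TV[OF f] \<open>0 < \<epsilon> / 4\<close>], of "\<lambda>j. w (k j)", OF wk]
  show False using lower by simp
qed

theorem theorem6:
  fixes g :: "complex \<Rightarrow> complex"
  assumes "g holomorphic_on ball 0 1"
  shows "(BMOA_bounded 2 1 (T_op g) \<longleftrightarrow>
            (SUP I\<in>circle_arcs. log_carleson_quotient g I) < \<infinity>) \<and>
         (BMOA_compact 2 1 (T_op g) \<longleftrightarrow>
            (log_carleson_quotient g \<longlongrightarrow> 0) small_arcs) \<and>
         (BMOA_compact 2 1 (T_op g) \<longleftrightarrow> T_op g ` BMOA 2 \<subseteq> VMOA 1)"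
  using T_op_bounded_iff[OF assms] vanishing_imp_compact[OF assms] compact_imp_vanishing[OF assms]
    vanishing_imp_VMOA[OF assms] VMOA_imp_vanishing[OF assms]
  unfolding vanishing_log_carleson_def by blast

end
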